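(* The following decision problem (One-To-One Reachability Trip Temporalisation, o2o-rtt) is NP-complete: given a trip network $(D,\mathbb{T})$ and two nodes $s,t$ of $D$, decide whether $(D,\mathbb{T})$ is $(s,t)$-temporalisable, i.e. whether there exists a temporalisation $\tau$ of $(D,\mathbb{T})$ such that $t$ is temporally reachable from $s$ in the induced temporal graph $G[D,\mathbb{T},\tau]$.
   Context: A weighted multidigraph $D=(V,E)$ has a finite node set $V$ and a finite multiset $E$ of edges $(u,v,w)$ with tail $u$, head $v$ and weight $w>0$. A walk is a sequence of edges $e_1,\dots,e_k$ where the head of $e_i$ equals the tail of $e_{i+1}$. A trip network is a pair $(D,\mathbb{T})$ where $\mathbb{T}$ is a finite multiset (collection) of walks in $D$, called trips; it is assumed that every node and every edge of $D$ appears in at least one trip. A temporalisation $\tau$ assigns a real starting time $\tau(T)$ to each trip $T\in\mathbb{T}$. For a trip $T=e_1,\dots,e_k$ with $e_i=(u_i,v_i,w_i)$, it induces the temporal edges $(u_i,v_i,\tau(T)+\sum_{j<i}w_j,w_i)$, $i=1,\dots,k$ (tail, head, starting time, travel time). The induced temporal graph $G[D,\mathbb{T},\tau]$ has node set $V$ and as temporal edges the disjoint union of the temporal edges induced by all trips. A temporal edge $(u,v,t,\lambda)$ has arrival time $t+\lambda$. A temporal path from $u$ to $v$ is a sequence of temporal edges $f_1,\dots,f_k$ with tail of $f_1$ equal to $u$, head of $f_k$ equal to $v$, the head of $f_i$ equal to the tail of $f_{i+1}$, and the starting time of $f_{i+1}$ at least the arrival time of $f_i$. A node $v$ is temporally reachable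 from $u$ if there is a temporal path from $u$ to $v$ (every node is temporally reachable from itself). *)

theory Defs
  imports
    "Graph_Theory.Arc_Walk"
    "HOL-Library.Multiset"
    "HOL-Computational_Algebra.Polynomial"
begin

section \<open>Trip networks and temporalisations\<close>

text \<open>
  A weighted multidigraph is a finite multidigraph in the sense of \<^locale>\<open>fin_digraph\<close> (arcs have
  an identity, so parallel arcs of equal weight are distinct) with a weight function \<open>w\<close> on its arcs.
  The finite collection of trips is a list \<open>TT\<close>: the trips are the positions of the list, so that
  several copies of the same walk are different trips. The order of the list plays no role.
\<close>

definition trip_network :: "('v, 'e) pre_digraph \<Rightarrow> ('e \<Rightarrow> real) \<Rightarrow> 'e list list \<Rightarrow> bool" where
  "trip_network D w TT \<longleftrightarrow>
     fin_digraph D \<and>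
     (\<forall>e \<in> arcs D. w e > 0) \<and>
     (\<forall>T \<in> set TT. T \<noteq> [] \<and> (\<exists>u v. pre_digraph.awalk D u T v)) \<and>
     (\<forall>v \<in> verts D. \<exists>T \<in> set TT. \<exists>e \<in> set T. v = tail D e \<or> v = head D e) \<and>
     (\<forall>e \<in> arcs D. \<exists>T \<in> set TT. e \<in> set T)"

text \<open>Temporal edges are quadruples (tail, head, starting time, travel time).\<close>

type_synonym 'v temporal_edge = "'v \<times> 'v \<times> real \<times> real"

fun te_tail :: "'v temporal_edge \<Rightarrow> 'v" where "te_tail (u, v, t, l) = u"
fun te_head :: "'v temporal_edge \<Rightarrow> 'v" where "te_head (u, v, t, l) = v"
fun te_start :: "'v temporal_edge \<Rightarrow> real" where "te_start (u, v, t, l) = t"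
fun te_arrival :: "'v temporal_edge \<Rightarrow> real" where "te_arrival (u, v, t, l) = t + l"

record 'v temporal_graph =
  tg_nodes :: "'v set"
  tg_edges :: "'v temporal_edge multiset"

definition trip_temporal_edges ::
  "('v, 'e) pre_digraph \<Rightarrow> ('e \<Rightarrow> real) \<Rightarrow> 'e list \<Rightarrow> real \<Rightarrow> 'v temporal_edge list" where
  "trip_temporal_edges D w T t0 =
     map (\<lambda>i. (tail D (T ! i), head D (T ! i), t0 + (\<Sum>j<i. w (T ! j)), w (T ! i))) [0..<length T]"

text \<open>A temporalisation \<open>\<tau>\<close> gives the starting time \<open>\<tau> k\<close> to the trip at position \<open>k\<close>.\<close>

definition induced_temporal_graph ::
  "('v, 'e) pre_digraph \<Rightarrow> ('e \<Rightarrow> real) \<Rightarrow> 'e list list \<Rightarrow> (nat \<Rightarrow> real) \<Rightarrow> 'v temporal_graph" where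
  "induced_temporal_graph D w TT \<tau> =
     \<lparr> tg_nodes = verts D,
       tg_edges = (\<Sum>k<length TT. mset (trip_temporal_edges D w (TT ! k) (\<tau> k))) \<rparr>"

definition temporal_path ::
  "'v temporal_graph \<Rightarrow> 'v \<Rightarrow> 'v temporal_edge list \<Rightarrow> 'v \<Rightarrow> bool" where
  "temporal_path G u fs v \<longleftrightarrow>
     fs \<noteq> [] \<and> set fs \<subseteq> set_mset (tg_edges G) \<and>
     te_tail (hd fs) = u \<and> te_head (last fs) = v \<and>
     (\<forall>i. Suc i < length fs \<longrightarrow>
        te_head (fs ! i) = te_tail (fs ! Suc i) \<and> te_arrival (fs ! i) \<le> te_start (fs ! Suc i))"

definition temporally_reachable :: "'v temporal_graph \<Rightarrow> 'v \<Rightarrow> 'v \<Rightarrow> bool" where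
  "temporally_reachable G u v \<longleftrightarrow>
     u \<in> tg_nodes G \<and> v \<in> tg_nodes G \<and> (u = v \<or> (\<exists>fs. temporal_path G u fs v))"

definition temporalisable ::
  "('v, 'e) pre_digraph \<Rightarrow> ('e \<Rightarrow> real) \<Rightarrow> 'e list list \<Rightarrow> 'v \<Rightarrow> 'v \<Rightarrow> bool" where
  "temporalisable D w TT s t \<longleftrightarrow>
     (\<exists>\<tau>. temporally_reachable (induced_temporal_graph D w TT \<tau>) s t)"


section \<open>Turing machines\<close>

text \<open>
  Deterministic Turing machines with finitely many two-way infinite tapes. States and symbols are
  initial segments of the natural numbers. State 0 is the start state and state 1 the halting state;
  symbol 0 is the blank, and symbols 1 and 2 are the two bits.
\<close>

datatype move = Move_Left | Stay | Move_Right

record tm =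
  num_tapes :: nat
  num_symbols :: nat
  num_states :: nat
  delta :: "nat \<Rightarrow> nat list \<Rightarrow> nat \<times> (nat \<times> move) list"

definition wf_tm :: "tm \<Rightarrow> bool" where
  "wf_tm M \<longleftrightarrow>
     num_tapes M \<ge> 1 \<and> num_symbols M \<ge> 3 \<and> num_states M \<ge> 2 \<and>
     (\<forall>q ss. q < num_states M \<longrightarrow> length ss = num_tapes M \<longrightarrow> (\<forall>a \<in> set ss. a < num_symbols M) \<longrightarrow>
        (case delta M q ss of (q', as) \<Rightarrow>
           q' < num_states M \<and> length as = num_tapes M \<and> (\<forall>(a, m) \<in> set as. a < num_symbols M)))"

text \<open>A tape consists of its contents and the position of the head.\<close>

type_synonym tape = "(int \<Rightarrow> nat) \<times> int"
type_synonym config = "nat \<times> tape list"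

fun tape_read :: "tape \<Rightarrow> nat" where
  "tape_read (c, h) = c h"

fun move_head :: "move \<Rightarrow> int \<Rightarrow> int" where
  "move_head Move_Left h = h - 1"
| "move_head Stay h = h"
| "move_head Move_Right h = h + 1"

fun tape_act :: "nat \<times> move \<Rightarrow> tape \<Rightarrow> tape" where
  "tape_act (a, m) (c, h) = (c(h := a), move_head m h)"

fun tm_step :: "tm \<Rightarrow> config \<Rightarrow> config" where
  "tm_step M (q, tps) =
     (if q = 1 then (q, tps)
      else case delta M q (map tape_read tps) of (q', as) \<Rightarrow> (q', map2 tape_act as tps))"

definition bit_symbol :: "bool \<Rightarrow> nat" where
  "bit_symbol b = (if b then 2 else 1)"

definition string_contents :: "bool list \<Rightarrow> int \<Rightarrow> nat" where
  "string_contents x i = (if 0 \<le> i \<and> i < int (length x) then bit_symbol (x ! nat i) else 0)"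

text \<open>The input is written on the first tape.\<close>

definition tm_init :: "tm \<Rightarrow> bool list \<Rightarrow> config" where
  "tm_init M x = (0, (string_contents x, 0) # replicate (num_tapes M - 1) (\<lambda>_. 0, 0))"

text \<open>
  The output is the string on the last tape that extends from cell 0 to the first blank. Since the
  halting state is never left, being in it after \<open>t\<close> steps means having halted within \<open>t\<close> steps.
\<close>

definition tape_output :: "tape \<Rightarrow> bool list \<Rightarrow> bool" where
  "tape_output tp y \<longleftrightarrow>
     (\<forall>i < length y. fst tp (int i) = bit_symbol (y ! i)) \<and> fst tp (int (length y)) = 0"

definition tm_halts_with :: "tm \<Rightarrow> bool list \<Rightarrow> nat \<Rightarrow> bool list \<Rightarrow> bool" where
  "tm_halts_with M x t y \<longleftrightarrow>
     (case (tm_step M ^^ t) (tm_init M x) of (q, tps) \<Rightarrow> q = 1 \<and> tape_output (last tps) y)"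


section \<open>NP-completeness\<close>

text \<open>Polynomials with natural coefficients serve as time and length bounds.\<close>

definition poly_time :: "(bool list \<Rightarrow> bool list) \<Rightarrow> bool" where
  "poly_time f \<longleftrightarrow>
     (\<exists>M (p :: nat poly). wf_tm M \<and> (\<forall>x. tm_halts_with M x (poly p (length x)) (f x)))"

text \<open>
  A self-delimiting code for lists: every element is announced by \<^const>\<open>True\<close>, and \<^const>\<open>False\<close>
  ends the list.
\<close>

fun enc_list :: "('a \<Rightarrow> bool list) \<Rightarrow> 'a list \<Rightarrow> bool list" where
  "enc_list f [] = [False]"
| "enc_list f (x # xs) = True # f x @ enc_list f xs"

definition enc_bits :: "bool list \<Rightarrow> bool list" where
  "enc_bits = enc_list (\<lambda>b. [b])"

definition string_pair :: "bool list \<Rightarrow> bool list \<Rightarrow> bool list" where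
  "string_pair x u = enc_bits x @ u"

text \<open>
  NP by polynomial-time verifiers: \<open>u\<close> is a certificate of polynomial length for \<open>x\<close>, and the
  verifier accepts by the output \<open>[True]\<close>.
\<close>

definition NP :: "bool list set set" where
  "NP = {L. \<exists>V (p :: nat poly). poly_time V \<and>
     (\<forall>x. x \<in> L \<longleftrightarrow> (\<exists>u. length u \<le> poly p (length x) \<and> V (string_pair x u) = [True]))}"

definition poly_reducible :: "bool list set \<Rightarrow> bool list set \<Rightarrow> bool" where
  "poly_reducible A B \<longleftrightarrow> (\<exists>f. poly_time f \<and> (\<forall>x. x \<in> A \<longleftrightarrow> f x \<in> B))"

definition NP_hard :: "bool list set \<Rightarrow> bool" where
  "NP_hard L \<longleftrightarrow> (\<forall>A \<in> NP. poly_reducible A L)"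

definition NP_complete :: "bool list set \<Rightarrow> bool" where
  "NP_complete L \<longleftrightarrow> L \<in> NP \<and> NP_hard L"


section \<open>The decision problem\<close>

text \<open>
  Problem instances as finite data. The nodes are \<open>0, \<dots>, n - 1\<close>. The arcs are the positions of the
  list of arcs, whose entry \<open>(u, v, p, q)\<close> is an arc from \<open>u\<close> to \<open>v\<close> of rational weight \<open>p / q\<close> (not
  necessarily in lowest terms); note that \<open>p / q > 0\<close> entails \<open>p > 0\<close> and \<open>q > 0\<close>.
\<close>

record rtt_instance =
  inst_num_nodes :: nat
  inst_arcs :: "(nat \<times> nat \<times> nat \<times> nat) list"
  inst_trips :: "nat list list"
  inst_source :: nat
  inst_target :: nat

definition inst_digraph :: "rtt_instance \<Rightarrow> (nat, nat) pre_digraph" where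
  "inst_digraph I =
     \<lparr> verts = {..<inst_num_nodes I}, arcs = {..<length (inst_arcs I)},
       tail = (\<lambda>e. case inst_arcs I ! e of (u, v, p, q) \<Rightarrow> u),
       head = (\<lambda>e. case inst_arcs I ! e of (u, v, p, q) \<Rightarrow> v) \<rparr>"

definition inst_weight :: "rtt_instance \<Rightarrow> nat \<Rightarrow> real" where
  "inst_weight I e = (case inst_arcs I ! e of (u, v, p, q) \<Rightarrow> real p / real q)"

definition valid_instance :: "rtt_instance \<Rightarrow> bool" where
  "valid_instance I \<longleftrightarrow>
     trip_network (inst_digraph I) (inst_weight I) (inst_trips I) \<and>
     inst_source I \<in> verts (inst_digraph I) \<and> inst_target I \<in> verts (inst_digraph I)"

text \<open>Binary representation, least significant bit first, without leading zeros.\<close>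

fun nat_bits :: "nat \<Rightarrow> bool list" where
  "nat_bits n = (if n = 0 then [] else odd n # nat_bits (n div 2))"

declare nat_bits.simps [simp del]

definition enc_nat :: "nat \<Rightarrow> bool list" where
  "enc_nat n = enc_bits (nat_bits n)"

fun enc_arc :: "nat \<times> nat \<times> nat \<times> nat \<Rightarrow> bool list" where
  "enc_arc (u, v, p, q) = enc_nat u @ enc_nat v @ enc_nat p @ enc_nat q"

definition enc_instance :: "rtt_instance \<Rightarrow> bool list" where
  "enc_instance I =
     enc_nat (inst_num_nodes I) @ enc_list enc_arc (inst_arcs I) @
     enc_list (enc_list enc_nat) (inst_trips I) @
     enc_nat (inst_source I) @ enc_nat (inst_target I)"

definition o2o_rtt :: "bool list set" where
  "o2o_rtt = {enc_instance I | I. valid_instance I \<and>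
     temporalisable (inst_digraph I) (inst_weight I) (inst_trips I) (inst_source I) (inst_target I)}"

subsection \<open>The encoding of instances is injective\<close>

definition prefix_code :: "('a \<Rightarrow> bool list) \<Rightarrow> bool" where
  "prefix_code f \<longleftrightarrow> (\<forall>a b r s. f a @ r = f b @ s \<longrightarrow> a = b \<and> r = s)"

lemma prefix_codeD: "prefix_code f \<Longrightarrow> f a @ r = f b @ s \<longleftrightarrow> a = b \<and> r = s"
  unfolding prefix_code_def by blast

lemma prefix_code_enc_list:
  assumes "prefix_code f"
  shows "prefix_code (enc_list f)"
proof -
  have "enc_list f xs @ r = enc_list f ys @ s \<Longrightarrow> xs = ys \<and> r = s" for xs ys r s
  proof (induction xs arbitrary: ys)
    case Nil
    then show ?case by (cases ys) auto
  next
    case (Cons x xs)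
    then show ?case by (cases ys) (auto simp: prefix_codeD[OF assms])
  qed
  then show ?thesis unfolding prefix_code_def by blast
qed

lemma nat_bits_inj: "nat_bits m = nat_bits n \<Longrightarrow> m = n"
proof (induction m arbitrary: n rule: less_induct)
  case (less m)
  show ?case
  proof (cases "m = 0 \<or> n = 0")
    case True
    then show ?thesis using less.prems
      by (auto simp: nat_bits.simps[of m] nat_bits.simps[of n] split: if_splits)
  next
    case False
    then have "odd m = odd n" "nat_bits (m div 2) = nat_bits (n div 2)"
      using less.prems by (auto simp: nat_bits.simps[of m] nat_bits.simps[of n])
    moreover from this(2) have "m div 2 = n div 2"
      using less.IH[of "m div 2"] False by simp
    ultimately show ?thesis
      by (metis div_mult_mod_eq parity_cases)
  qed
qed

lemma prefix_code_enc_nat: "prefix_code enc_nat"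
proof -
  have "prefix_code enc_bits"
    unfolding enc_bits_def by (rule prefix_code_enc_list) (simp add: prefix_code_def)
  then show ?thesis
    unfolding prefix_code_def enc_nat_def by (blast dest: nat_bits_inj)
qed

lemma prefix_code_enc_arc: "prefix_code enc_arc"
  unfolding prefix_code_def by (auto simp: prefix_codeD[OF prefix_code_enc_nat])

lemma inj_enc_instance: "inj enc_instance"
proof (rule injI)
  fix I J assume eq: "enc_instance I = enc_instance J"
  have "enc_instance I @ [] = enc_instance J @ []"
    using eq by simp
  then show "I = J"
    unfolding enc_instance_def append_assoc
    by (simp only: prefix_codeD[OF prefix_code_enc_nat]
        prefix_codeD[OF prefix_code_enc_list[OF prefix_code_enc_arc]]
        prefix_codeD[OF prefix_code_enc_list[OF prefix_code_enc_list[OF prefix_code_enc_nat]]]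
        rtt_instance.equality) simp
qed

end

theory Submission
  imports Defs
begin

text \<open>
  Whether \<open>t\<close> can be reached from \<open>s\<close> does not depend on the weights: a temporal path that uses a trip
  twice can stay on it in between, so it may be assumed to consist of segments of pairwise different
  trips, and conversely every such sequence of segments is realised by starting the trips one after
  the other. This gives short certificates.

  For hardness, the computation of a verifier is written as a CNF formula in the manner of Cook and
  Levin, and the formula is turned into a network. A route first crosses one gadget per variable,
  on the side of \<open>True\<close> or of \<open>False\<close>, and then one gadget per clause. Crossing clause \<open>j\<close> by the literal \<open>l\<close>
  is the first part of a trip whose last part is the \<open>j\<close>-th edge of the side that makes \<open>l\<close> false.

  Polynomial-time computability is obtained from a class of functions on tree-encoded data that is
  closed under composition, pairing, conditionals and polynomially bounded iteration, and whose
  members are computed by programs for a machine with four stacks.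
\<close>

section \<open>Stack programs and their compilation to Turing machines\<close>

text \<open>Since starting times are free, a trip is a resource: a route rides one forward segment
  of it and cannot come back to it. This is what couples the gadgets. On its way to the clauses the
  route crosses side \<open>b\<close> of variable \<open>i\<close> on the last parts of all
  \<open>lit_trip cs i (\<not> b) j\<close>. The clause edge lies earlier on the same trip, hence it
  is lost. Only literals that agree with \<open>b\<close> keep their trips, so all later clause
  crossings are consistent with one assignment.

  For membership in NP the obstacle is the format of numbers. The function class works with unary
  numbers, while an instance holds binary ones that may be exponential in its length. Node numbers
  are harmless: in a valid instance every node is an endpoint of an arc, so there are at most twice
  as many nodes as arcs. Weights can really be large, but only their positivity matters;
  certificates keep them as bit strings, and nothing is ever computed with their values.\<close>

type_synonym store = "nat \<Rightarrow> bool list"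

datatype prog =
    Push nat bool
  | Pop nat
  | Emit bool
  | Seq prog prog (infixr ";;" 60)
  | Branch nat prog prog
  | While nat prog

text \<open>Time is counted in instructions of the compiled code; the extra steps of \<open>Branch\<close> and \<open>While\<close> are its jumps.\<close>

inductive exec :: "prog \<Rightarrow> store \<Rightarrow> nat \<Rightarrow> store \<Rightarrow> bool" where
  Push: "i < 4 \<Longrightarrow> exec (Push i b) \<sigma> 1 (\<sigma>(i := b # \<sigma> i))"
| Pop: "i < 4 \<Longrightarrow> exec (Pop i) \<sigma> 1 (\<sigma>(i := tl (\<sigma> i)))"
| Emit: "exec (Emit b) \<sigma> 1 (\<sigma>(4 := \<sigma> 4 @ [b]))"
| Seq: "exec P \<sigma> t \<sigma>' \<Longrightarrow> exec Q \<sigma>' u \<sigma>'' \<Longrightarrow> exec (P ;; Q) \<sigma> (t + u) \<sigma>''"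
| BranchTrue: "i < 4 \<Longrightarrow> \<sigma> i = True # s \<Longrightarrow> exec P \<sigma> t \<sigma>' \<Longrightarrow> exec (Branch i P Q) \<sigma> (t + 2) \<sigma>'"
| BranchFalse: "i < 4 \<Longrightarrow> \<sigma> i = [] \<or> \<not> hd (\<sigma> i) \<Longrightarrow> exec Q \<sigma> t \<sigma>' \<Longrightarrow> exec (Branch i P Q) \<sigma> (t + 1) \<sigma>'"
| WhileEnd: "i < 4 \<Longrightarrow> \<sigma> i = [] \<Longrightarrow> exec (While i P) \<sigma> 1 \<sigma>"
| WhileStep: "i < 4 \<Longrightarrow> \<sigma> i \<noteq> [] \<Longrightarrow> exec P \<sigma> t \<sigma>' \<Longrightarrow> exec (While i P) \<sigma>' u \<sigma>'' \<Longrightarrow>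
    exec (While i P) \<sigma> (t + u + 2) \<sigma>''"

section \<open>Flat code with jumps\<close>

datatype instr =
    IPush nat bool
  | IPop nat
  | IEmit bool
  | IBranch nat nat nat
  | IEmpty nat nat
  | IJump nat

text \<open>The bound \<open>l \<le> length cs\<close> on targets makes the clamping of jumps in
  \<open>code_delta\<close> invisible; the target \<open>length cs\<close> itself is the
  exit.\<close>

inductive istep :: "instr list \<Rightarrow> nat \<times> store \<Rightarrow> nat \<times> store \<Rightarrow> bool" for cs where
  "pc < length cs \<Longrightarrow> cs ! pc = IPush i b \<Longrightarrow> i < 4 \<Longrightarrow> istep cs (pc, \<sigma>) (Suc pc, \<sigma>(i := b # \<sigma> i))"
| "pc < length cs \<Longrightarrow> cs ! pc = IPop i \<Longrightarrow> i < 4 \<Longrightarrow> istep cs (pc, \<sigma>) (Suc pc, \<sigma>(i := tl (\<sigma> i)))"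
| "pc < length cs \<Longrightarrow> cs ! pc = IEmit b \<Longrightarrow> istep cs (pc, \<sigma>) (Suc pc, \<sigma>(4 := \<sigma> 4 @ [b]))"
| "pc < length cs \<Longrightarrow> cs ! pc = IBranch i l m \<Longrightarrow> i < 4 \<Longrightarrow> \<sigma> i = True # s \<Longrightarrow> l \<le> length cs \<Longrightarrow>
    istep cs (pc, \<sigma>) (l, \<sigma>)"
| "pc < length cs \<Longrightarrow> cs ! pc = IBranch i l m \<Longrightarrow> i < 4 \<Longrightarrow> \<sigma> i = [] \<or> \<not> hd (\<sigma> i) \<Longrightarrow> m \<le> length cs \<Longrightarrow>
    istep cs (pc, \<sigma>) (m, \<sigma>)"
| "pc < length cs \<Longrightarrow> cs ! pc = IEmpty i l \<Longrightarrow> i < 4 \<Longrightarrow> \<sigma> i = [] \<Longrightarrow> l \<le> length cs \<Longrightarrow>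
    istep cs (pc, \<sigma>) (l, \<sigma>)"
| "pc < length cs \<Longrightarrow> cs ! pc = IEmpty i l \<Longrightarrow> i < 4 \<Longrightarrow> \<sigma> i \<noteq> [] \<Longrightarrow>
    istep cs (pc, \<sigma>) (Suc pc, \<sigma>)"
| "pc < length cs \<Longrightarrow> cs ! pc = IJump l \<Longrightarrow> l \<le> length cs \<Longrightarrow> istep cs (pc, \<sigma>) (l, \<sigma>)"

fun code_length :: "prog \<Rightarrow> nat" where
  "code_length (Push i b) = 1"
| "code_length (Pop i) = 1"
| "code_length (Emit b) = 1"
| "code_length (P ;; Q) = code_length P + code_length Q"
| "code_length (Branch i P Q) = code_length P + code_length Q + 2"
| "code_length (While i P) = code_length P + 2"

fun compile :: "prog \<Rightarrow> nat \<Rightarrow> instr list" where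
  "compile (Push i b) n = [IPush i b]"
| "compile (Pop i) n = [IPop i]"
| "compile (Emit b) n = [IEmit b]"
| "compile (P ;; Q) n = compile P n @ compile Q (n + code_length P)"
| "compile (Branch i P Q) n =
     IBranch i (n + 1) (n + code_length P + 2) # compile P (n + 1) @
     IJump (n + code_length P + code_length Q + 2) # compile Q (n + code_length P + 2)"
| "compile (While i P) n = IEmpty i (n + code_length P + 2) # compile P (n + 1) @ [IJump n]"

lemma length_compile [simp]: "length (compile P n) = code_length P"
  by (induction P arbitrary: n) auto

text \<open>Jump targets are absolute, so the code of \<open>P\<close> is compiled for the address
  where it stands and runs inside an arbitrary context \<open>xs\<close>, \<open>ys\<close>; this
  generality lets the induction reach subprograms. The step count is exact because
  \<open>exec\<close> already charges the jumps.\<close>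

lemma exec_compile:
  "exec P \<sigma> t \<sigma>' \<Longrightarrow> cs = xs @ compile P (length xs) @ ys \<Longrightarrow>
    (istep cs ^^ t) (length xs, \<sigma>) (length xs + code_length P, \<sigma>')"
proof (induction arbitrary: xs ys rule: exec.induct)
  case (Push i b \<sigma>)
  then show ?case unfolding relpowp_1 compile.simps code_length.simps by (simp only: Suc_eq_plus1[symmetric]) (rule istep.intros(1), auto)
next
  case (Pop i \<sigma>)
  then show ?case unfolding relpowp_1 compile.simps code_length.simps by (simp only: Suc_eq_plus1[symmetric]) (rule istep.intros(2), auto)
next
  case (Emit b \<sigma>)
  then show ?case unfolding relpowp_1 compile.simps code_length.simps by (simp only: Suc_eq_plus1[symmetric]) (rule istep.intros(3), auto)
next
  case (Seq P \<sigma> t \<sigma>' Q u \<sigma>'')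
  have "(istep cs ^^ t) (length xs, \<sigma>) (length xs + code_length P, \<sigma>')"
    using Seq.prems by (intro Seq.IH(1)[of xs "compile Q (length xs + code_length P) @ ys"]) simp
  moreover have "(istep cs ^^ u) (length (xs @ compile P (length xs)), \<sigma>')
      (length (xs @ compile P (length xs)) + code_length Q, \<sigma>'')"
    using Seq.prems by (intro Seq.IH(2)[of _ ys]) simp
  ultimately show ?case
    using relpowp_trans by (fastforce simp: add.assoc)
next
  case (BranchTrue i \<sigma> s P t \<sigma>' Q)
  let ?n = "length xs"
  have "istep cs (?n, \<sigma>) (?n + 1, \<sigma>)"
    using BranchTrue.hyps BranchTrue.prems
    by (intro istep.intros(4)[where i = i and m = "?n + code_length P + 2"]) auto
  moreover have "(istep cs ^^ t) (length (xs @ [IBranch i (?n + 1) (?n + code_length P + 2)]), \<sigma>)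
      (length (xs @ [IBranch i (?n + 1) (?n + code_length P + 2)]) + code_length P, \<sigma>')"
    using BranchTrue.prems by (intro BranchTrue.IH) simp
  moreover have "istep cs (?n + 1 + code_length P, \<sigma>') (?n + code_length P + code_length Q + 2, \<sigma>')"
    using BranchTrue.prems by (intro istep.intros(8)) (auto simp: nth_append)
  ultimately have "(istep cs ^^ Suc (Suc t)) (?n, \<sigma>) (?n + code_length P + code_length Q + 2, \<sigma>')"
    by (intro relpowp_Suc_I[OF relpowp_Suc_I2]) auto
  then show ?case by (simp add: add.assoc)
next
  case (BranchFalse i \<sigma> Q t \<sigma>' P)
  let ?n = "length xs"
  have "istep cs (?n, \<sigma>) (?n + code_length P + 2, \<sigma>)"
    using BranchFalse.hyps BranchFalse.prems
    by (intro istep.intros(5)[where i = i and l = "?n + 1"]) auto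
  moreover have "(istep cs ^^ t) (length (xs @ IBranch i (?n + 1) (?n + code_length P + 2) # compile P (?n + 1) @
        [IJump (?n + code_length P + code_length Q + 2)]), \<sigma>)
      (length (xs @ IBranch i (?n + 1) (?n + code_length P + 2) # compile P (?n + 1) @
        [IJump (?n + code_length P + code_length Q + 2)]) + code_length Q, \<sigma>')"
    using BranchFalse.prems by (intro BranchFalse.IH[where ys = ys]) simp
  ultimately have "(istep cs ^^ Suc t) (?n, \<sigma>) (?n + code_length P + code_length Q + 2, \<sigma>')"
    by (intro relpowp_Suc_I2) (auto simp: algebra_simps)
  then show ?case by (simp add: add.assoc)
next
  case (WhileEnd i \<sigma> P)
  then show ?case unfolding relpowp_1 by (auto intro!: istep.intros(6)[where i = i])
next
  case (WhileStep i \<sigma> P t \<sigma>' u \<sigma>'')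
  let ?n = "length xs"
  have "istep cs (?n, \<sigma>) (Suc ?n, \<sigma>)"
    using WhileStep.hyps WhileStep.prems
    by (intro istep.intros(7)[where i = i and l = "?n + code_length P + 2"]) auto
  moreover have "(istep cs ^^ t) (length (xs @ [IEmpty i (?n + code_length P + 2)]), \<sigma>)
      (length (xs @ [IEmpty i (?n + code_length P + 2)]) + code_length P, \<sigma>')"
    using WhileStep.prems by (intro WhileStep.IH(1)) simp
  moreover have "istep cs (Suc ?n + code_length P, \<sigma>') (?n, \<sigma>')"
    using WhileStep.prems by (intro istep.intros(8)) (auto simp: nth_append)
  ultimately have "(istep cs ^^ Suc (Suc t)) (?n, \<sigma>) (?n, \<sigma>')"
    by (intro relpowp_Suc_I[OF relpowp_Suc_I2]) auto
  from relpowp_trans[OF this WhileStep.IH(2)[OF WhileStep.prems]] show ?case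
    by (simp add: algebra_simps)
qed

text \<open>Every instruction takes two steps of the machine, in the states \<open>2 * pc + 2\<close> and \<open>2 * pc + 3\<close>, because a push
  has to move the head to a new cell before writing. The fifth tape is the output.\<close>

definition code_delta :: "instr list \<Rightarrow> nat \<Rightarrow> nat list \<Rightarrow> nat \<times> (nat \<times> move) list" where
  "code_delta cs q ss =
     (let stay = map (\<lambda>a. (a, Stay)) ss; pc = q div 2 - 1; jump = (\<lambda>l. 2 * min l (length cs) + 2) in
      if q < 2 then (2, stay)
      else if length cs \<le> pc then (1, stay)
      else if even q then
        (Suc q, case cs ! pc of IPush i b \<Rightarrow> (if i < length ss then stay[i := (ss ! i, Move_Left)] else stay) | _ \<Rightarrow> stay)
      else (case cs ! pc of
          IPush i b \<Rightarrow> (Suc q, stay[i := (bit_symbol b, Stay)])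
        | IPop i \<Rightarrow> (Suc q, stay[i := (0, Move_Right)])
        | IEmit b \<Rightarrow> (Suc q, stay[4 := (bit_symbol b, Move_Right)])
        | IBranch i l m \<Rightarrow> (jump (if ss ! i = 2 then l else m), stay)
        | IEmpty i l \<Rightarrow> (if ss ! i = 0 then jump l else Suc q, stay)
        | IJump l \<Rightarrow> (jump l, stay)))"

definition pc_state :: "nat \<Rightarrow> nat" where
  "pc_state pc = 2 * pc + 2"

lemma pc_state_neq_1 [simp]: "pc_state pc \<noteq> Suc 0" "pc_state pc \<noteq> 0"
  by (auto simp: pc_state_def)

lemma code_delta_phase0:
  "pc < length cs \<Longrightarrow> code_delta cs (pc_state pc) ss =
     (Suc (pc_state pc), case cs ! pc of
        IPush i b \<Rightarrow> (if i < length ss then (map (\<lambda>a. (a, Stay)) ss)[i := (ss ! i, Move_Left)] else map (\<lambda>a. (a, Stay)) ss)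
      | _ \<Rightarrow> map (\<lambda>a. (a, Stay)) ss)"
  by (auto simp: code_delta_def pc_state_def Let_def)

lemma code_delta_phase1:
  "pc < length cs \<Longrightarrow> code_delta cs (Suc (pc_state pc)) ss =
     (let stay = map (\<lambda>a. (a, Stay)) ss; jump = (\<lambda>l. pc_state (min l (length cs))) in
      case cs ! pc of
        IPush i b \<Rightarrow> (pc_state (Suc pc), stay[i := (bit_symbol b, Stay)])
      | IPop i \<Rightarrow> (pc_state (Suc pc), stay[i := (0, Move_Right)])
      | IEmit b \<Rightarrow> (pc_state (Suc pc), stay[4 := (bit_symbol b, Move_Right)])
      | IBranch i l m \<Rightarrow> (jump (if ss ! i = 2 then l else m), stay)
      | IEmpty i l \<Rightarrow> (if ss ! i = 0 then jump l else pc_state (Suc pc), stay)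
      | IJump l \<Rightarrow> (jump l, stay))"
  by (auto simp: code_delta_def pc_state_def Let_def split: instr.splits)

text \<open>Tapes 0 to 3 hold the stacks and tape 4 the output. Besides the states 0 and 1 there are
  two states for each address from 0 up to the exit \<open>length cs\<close>.\<close>

definition code_tm :: "instr list \<Rightarrow> tm" where
  "code_tm cs = \<lparr>num_tapes = 5, num_symbols = 3, num_states = 2 * length cs + 4, delta = code_delta cs\<rparr>"

lemma code_delta_wf:
  assumes "q < 2 * length cs + 4" "\<forall>a \<in> set ss. a < 3" "code_delta cs q ss = (q', as)"
  shows "q' < 2 * length cs + 4 \<and> length as = length ss \<and> (\<forall>(a, m) \<in> set as. a < 3)"
proof -
  have upd: "a < 3" if "(a, m) \<in> set ((map (\<lambda>a. (a, Stay)) ss)[i := (c, d)])" "c < 3" for i a m c d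
    using that assms(2) set_update_subset_insert[of "map (\<lambda>a. (a, Stay)) ss" i "(c, d)"] by fastforce
  have "even q \<longrightarrow> q \<ge> 2 \<longrightarrow> q div 2 - 1 < length cs \<longrightarrow> Suc q < 2 * length cs + 4"
    and "odd q \<longrightarrow> q \<ge> 2 \<longrightarrow> q div 2 - 1 < length cs \<longrightarrow> Suc q < 2 * length cs + 4"
    by presburger+
  then show ?thesis
    using assms
    by (auto simp: code_delta_def Let_def bit_symbol_def split: if_splits instr.splits dest!: upd)
qed

lemma wf_code_tm: "wf_tm (code_tm cs)"
  unfolding wf_tm_def code_tm_def using code_delta_wf[of _ cs] by (auto split: prod.splits) 

text \<open>The top of a stack is the cell under the head; the cells to the left of it may contain anything.\<close>

definition stack_tape :: "bool list \<Rightarrow> tape \<Rightarrow> bool" where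
  "stack_tape xs tp \<longleftrightarrow>
     (\<forall>j. fst tp (snd tp + int j) = (if j < length xs then bit_symbol (xs ! j) else 0))"

definition out_tape :: "bool list \<Rightarrow> tape \<Rightarrow> bool" where
  "out_tape xs tp \<longleftrightarrow> snd tp = int (length xs) \<and>
     (\<forall>j. fst tp (int j) = (if j < length xs then bit_symbol (xs ! j) else 0))"

definition store_tapes :: "store \<Rightarrow> tape list \<Rightarrow> bool" where
  "store_tapes \<sigma> tps \<longleftrightarrow> length tps = 5 \<and> (\<forall>i < 4. stack_tape (\<sigma> i) (tps ! i)) \<and> out_tape (\<sigma> 4) (tps ! 4)"

lemma bit_symbol_neq_0 [simp]: "bit_symbol b \<noteq> 0"
  by (simp add: bit_symbol_def)

lemma bit_symbol_eq_2 [simp]: "bit_symbol b = 2 \<longleftrightarrow> b"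
  by (simp add: bit_symbol_def)

lemma tape_read_stack:
  "stack_tape xs tp \<Longrightarrow> tape_read tp = (if xs = [] then 0 else bit_symbol (hd xs))"
  by (cases tp) (auto simp: stack_tape_def hd_conv_nth dest: spec[of _ 0])

text \<open>The two actions are the two phases of a push. Stacks grow to the left, and whatever the
  new top cell contained is overwritten by the second action.\<close>

lemma stack_tape_push:
  assumes "stack_tape xs tp"
  shows "stack_tape (b # xs) (tape_act (bit_symbol b, Stay) (tape_act (tape_read tp, Move_Left) tp))"
proof -
  obtain c h where tp: "tp = (c, h)" by fastforce
  have "c (h - 1 + int j) = (if j - 1 < length xs then bit_symbol (xs ! (j - 1)) else 0)" if "j > 0" for j
  proof -
    have "h - 1 + int j = h + int (j - 1)" using that by auto
    then show ?thesis using assms tp unfolding stack_tape_def by (metis fst_conv snd_conv)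
  qed
  then show ?thesis
    by (auto simp: tp stack_tape_def nth_Cons split: nat.splits)
qed

lemma stack_tape_pop:
  assumes "stack_tape xs tp"
  shows "stack_tape (tl xs) (tape_act (0, Move_Right) tp)"
proof -
  obtain c h where tp: "tp = (c, h)" by fastforce
  have "c (h + 1 + int j) = (if Suc j < length xs then bit_symbol (xs ! Suc j) else 0)" for j
  proof -
    have "h + 1 + int j = h + int (Suc j)" by auto
    then show ?thesis using assms tp unfolding stack_tape_def by (metis fst_conv snd_conv)
  qed
  moreover have "h + 1 + int j \<noteq> h" for j by simp
  ultimately show ?thesis
    by (auto simp: tp stack_tape_def nth_tl)
qed

lemma out_tape_emit:
  "out_tape xs tp \<Longrightarrow> out_tape (xs @ [b]) (tape_act (bit_symbol b, Move_Right) tp)"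
  by (cases tp) (auto simp: out_tape_def nth_append)

lemma stay_acts [simp]: "map2 tape_act (map ((\<lambda>a. (a, Stay)) \<circ> tape_read) tps) tps = tps"
proof (induction tps)
  case (Cons tp tps)
  then show ?case by (cases tp) auto
qed auto

lemma update_acts:
  "length as = length tps \<Longrightarrow> map2 tape_act (as[i := x]) tps = (map2 tape_act as tps)[i := tape_act x (tps ! i)]"
proof (induction as arbitrary: tps i)
  case (Cons a as)
  then show ?case by (cases tps) (auto split: nat.splits)
qed auto

lemma store_tapes_update:
  "store_tapes \<sigma> tps \<Longrightarrow> i < 4 \<Longrightarrow> stack_tape xs tp \<Longrightarrow> store_tapes (\<sigma>(i := xs)) (tps[i := tp])"
  by (auto simp: store_tapes_def nth_list_update)

lemma funpow_2: "(f ^^ 2) x = f (f x)"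
  by (simp add: numeral_2_eq_2)

lemma istep_code_tm:
  assumes "istep cs (pc, \<sigma>) (pc', \<sigma>')" "store_tapes \<sigma> tps"
  shows "\<exists>tps'. (tm_step (code_tm cs) ^^ 2) (pc_state pc, tps) = (pc_state pc', tps') \<and> store_tapes \<sigma>' tps'"
proof -
  have len: "length tps = 5" and st: "\<And>i. i < 4 \<Longrightarrow> stack_tape (\<sigma> i) (tps ! i)" and out: "out_tape (\<sigma> 4) (tps ! 4)"
    using assms(2) by (auto simp: store_tapes_def)
  note rd = tape_read_stack[OF st]
  show ?thesis
    using assms(1)
  proof cases
    case (1 i b)
    have "(tm_step (code_tm cs) ^^ 2) (pc_state pc, tps) = (pc_state pc',
        tps[i := tape_act (bit_symbol b, Stay) (tape_act (tape_read (tps ! i), Move_Left) (tps ! i))])"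
      using 1 len by (simp add: funpow_2 code_tm_def code_delta_phase0 code_delta_phase1 Let_def update_acts del: tape_act.simps)
    then show ?thesis
      using store_tapes_update[OF assms(2) 1(5) stack_tape_push[OF st[OF 1(5)]]] 1 by auto
  next
    case (2 i)
    have "(tm_step (code_tm cs) ^^ 2) (pc_state pc, tps) = (pc_state pc', tps[i := tape_act (0, Move_Right) (tps ! i)])"
      using 2 len by (simp add: funpow_2 code_tm_def code_delta_phase0 code_delta_phase1 Let_def update_acts del: tape_act.simps)
    then show ?thesis
      using store_tapes_update[OF assms(2) 2(5) stack_tape_pop[OF st[OF 2(5)]]] 2 by auto
  next
    case (3 b)
    have "(tm_step (code_tm cs) ^^ 2) (pc_state pc, tps) = (pc_state pc', tps[4 := tape_act (bit_symbol b, Move_Right) (tps ! 4)])"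
      using 3 len by (simp add: funpow_2 code_tm_def code_delta_phase0 code_delta_phase1 Let_def update_acts del: tape_act.simps)
    moreover have "store_tapes \<sigma>' (tps[4 := tape_act (bit_symbol b, Move_Right) (tps ! 4)])"
      using 3 assms(2) out_tape_emit[OF out] by (auto simp: store_tapes_def nth_list_update)
    ultimately show ?thesis by blast
  next
    case (4 i m s)
    then show ?thesis
      using len rd[of i] assms(2) by (simp add: funpow_2 code_tm_def code_delta_phase0 code_delta_phase1 Let_def)
  next
    case (5 i l)
    then show ?thesis
      using len rd[of i] assms(2) by (auto simp: funpow_2 code_tm_def code_delta_phase0 code_delta_phase1 Let_def)
  next
    case (6 i)
    then show ?thesis
      using len rd[of i] assms(2) by (simp add: funpow_2 code_tm_def code_delta_phase0 code_delta_phase1 Let_def)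
  next
    case (7 i l)
    then show ?thesis
      using len rd[of i] assms(2) by (simp add: funpow_2 code_tm_def code_delta_phase0 code_delta_phase1 Let_def)
  next
    case 8
    then show ?thesis
      using len assms(2) by (simp add: funpow_2 code_tm_def code_delta_phase0 code_delta_phase1 Let_def)
  qed
qed

lemma isteps_code_tm:
  "(istep cs ^^ n) (pc, \<sigma>) (pc', \<sigma>') \<Longrightarrow> store_tapes \<sigma> tps \<Longrightarrow>
    \<exists>tps'. (tm_step (code_tm cs) ^^ (2 * n)) (pc_state pc, tps) = (pc_state pc', tps') \<and> store_tapes \<sigma>' tps'"
proof (induction n arbitrary: pc' \<sigma>')
  case (Suc n)
  from Suc.prems(1) obtain pc1 \<sigma>1 where *: "(istep cs ^^ n) (pc, \<sigma>) (pc1, \<sigma>1)" "istep cs (pc1, \<sigma>1) (pc', \<sigma>')"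
    by auto
  obtain tps1 where 1: "(tm_step (code_tm cs) ^^ (2 * n)) (pc_state pc, tps) = (pc_state pc1, tps1)" "store_tapes \<sigma>1 tps1"
    using Suc.IH[OF *(1) Suc.prems(2)] by auto
  obtain tps2 where 2: "(tm_step (code_tm cs) ^^ 2) (pc_state pc1, tps1) = (pc_state pc', tps2)" "store_tapes \<sigma>' tps2"
    using istep_code_tm[OF *(2) 1(2)] by auto
  have "(tm_step (code_tm cs) ^^ (2 * Suc n)) (pc_state pc, tps) = (pc_state pc', tps2)"
    using 1(1) 2(1) funpow_add[of 2 "2 * n" "tm_step (code_tm cs)"] by simp
  then show ?case using 2(2) by auto
qed auto

lemma tm_step_halted: "(tm_step M ^^ n) (1, tps) = (1, tps)"
  by (induction n) auto

text \<open>Beyond two steps per instruction, one step leads from state 0 to the first address and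
  one from the exit to the halting state. Any larger \<open>n\<close> serves as well, as the halting
  state is never left.\<close>

lemma exec_tm_halts_with:
  assumes "exec P ((\<lambda>_. [])(0 := x)) t \<sigma>" "2 * t + 2 \<le> n"
  shows "tm_halts_with (code_tm (compile P 0)) x n (\<sigma> 4)"
proof -
  define M where "M = code_tm (compile P 0)"
  define tps0 where "tps0 = (string_contents x, 0::int) # replicate 4 (\<lambda>_. 0, 0)"
  have init: "store_tapes ((\<lambda>_. [])(0 := x)) tps0"
    by (auto simp: store_tapes_def tps0_def stack_tape_def out_tape_def string_contents_def nth_Cons split: nat.splits)
  have run: "(istep (compile P 0) ^^ t) (0, (\<lambda>_. [])(0 := x)) (code_length P, \<sigma>)"
    using exec_compile[OF assms(1), of "compile P 0" "[]" "[]"] by simp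
  obtain tps where tps: "(tm_step M ^^ (2 * t)) (pc_state 0, tps0) = (pc_state (code_length P), tps)" "store_tapes \<sigma> tps"
    using isteps_code_tm[OF run init] unfolding M_def by auto
  have "tm_step M (pc_state (code_length P), tps) = (1, tps)"
    by (simp add: M_def code_tm_def code_delta_def pc_state_def Let_def)
  moreover have "tm_step M (0, tps0) = (pc_state 0, tps0)"
    by (simp add: M_def code_tm_def code_delta_def pc_state_def Let_def)
  ultimately have "(tm_step M ^^ (Suc (2 * t + 1))) (0, tps0) = (1, tps)"
    using tps(1) by (simp add: funpow_swap1 del: tm_step.simps)
  then have "(tm_step M ^^ (n - (2 * t + 2) + (2 * t + 2))) (0, tps0) = (1, tps)"
    unfolding funpow_add by (simp add: tm_step_halted[unfolded One_nat_def] numeral_2_eq_2 funpow_swap1 del: tm_step.simps)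
  moreover have "n - (2 * t + 2) + (2 * t + 2) = n"
    using assms(2) by simp
  moreover have "tm_init M x = (0, tps0)"
    by (simp add: tm_init_def M_def code_tm_def tps0_def)
  ultimately have "(tm_step M ^^ n) (tm_init M x) = (1, tps)"
    by metis
  moreover have "last tps = tps ! 4" "out_tape (\<sigma> 4) (tps ! 4)"
    using tps(2) last_conv_nth[of tps] by (cases tps; auto simp: store_tapes_def)+
  ultimately show ?thesis
    by (auto simp: tm_halts_with_def M_def[symmetric] tape_output_def out_tape_def)
qed

section \<open>Executions within a step budget\<close>

definition runs :: "prog \<Rightarrow> store \<Rightarrow> nat \<Rightarrow> store \<Rightarrow> bool" where
  "runs P \<sigma> n \<sigma>' \<longleftrightarrow> (\<exists>t \<le> n. exec P \<sigma> t \<sigma>')"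

lemma runs_mono: "runs P \<sigma> n \<sigma>' \<Longrightarrow> n \<le> m \<Longrightarrow> runs P \<sigma> m \<sigma>'"
  unfolding runs_def by (meson order_trans)

lemma runs_Push: "i < 4 \<Longrightarrow> runs (Push i b) \<sigma> 1 (\<sigma>(i := b # \<sigma> i))"
  unfolding runs_def using exec.Push by blast

lemma runs_Pop: "i < 4 \<Longrightarrow> runs (Pop i) \<sigma> 1 (\<sigma>(i := tl (\<sigma> i)))"
  unfolding runs_def using exec.Pop by blast

lemma runs_Emit: "runs (Emit b) \<sigma> 1 (\<sigma>(4 := \<sigma> 4 @ [b]))"
  unfolding runs_def using exec.Emit by blast

lemma runs_Seq: "runs P \<sigma> n \<sigma>' \<Longrightarrow> runs Q \<sigma>' m \<sigma>'' \<Longrightarrow> runs (P ;; Q) \<sigma> (n + m) \<sigma>''"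
  unfolding runs_def using exec.Seq by (meson add_mono)

lemma runs_BranchTrue: "i < 4 \<Longrightarrow> \<sigma> i = True # s \<Longrightarrow> runs P \<sigma> n \<sigma>' \<Longrightarrow> runs (Branch i P Q) \<sigma> (n + 2) \<sigma>'"
  unfolding runs_def using exec.BranchTrue by (meson add_le_mono1)

lemma runs_BranchFalse:
  "i < 4 \<Longrightarrow> \<sigma> i = [] \<or> \<not> hd (\<sigma> i) \<Longrightarrow> runs Q \<sigma> n \<sigma>' \<Longrightarrow> runs (Branch i P Q) \<sigma> (n + 1) \<sigma>'"
  unfolding runs_def using exec.BranchFalse by (meson add_le_mono1)

lemma runs_Branch:
  "i < 4 \<Longrightarrow> \<sigma> i = b # s \<Longrightarrow> runs (if b then P else Q) \<sigma> n \<sigma>' \<Longrightarrow> runs (Branch i P Q) \<sigma> (n + 2) \<sigma>'"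
  using runs_BranchTrue[of i \<sigma> s P n \<sigma>' Q] runs_mono[OF runs_BranchFalse[of i \<sigma> Q n \<sigma>' P], of "n + 2"]
  by (cases b) auto

lemma runs_WhileEnd: "i < 4 \<Longrightarrow> \<sigma> i = [] \<Longrightarrow> runs (While i P) \<sigma> 1 \<sigma>"
  unfolding runs_def using exec.WhileEnd by blast

lemma runs_WhileStep:
  assumes "i < 4" "\<sigma> i \<noteq> []" "runs P \<sigma> n \<sigma>'" "runs (While i P) \<sigma>' m \<sigma>''"
  shows "runs (While i P) \<sigma> (n + m + 2) \<sigma>''"
proof -
  obtain t u where "t \<le> n" "exec P \<sigma> t \<sigma>'" "u \<le> m" "exec (While i P) \<sigma>' u \<sigma>''"
    using assms unfolding runs_def by auto
  then have "exec (While i P) \<sigma> (t + u + 2) \<sigma>''" "t + u + 2 \<le> n + m + 2"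
    using exec.WhileStep[of i \<sigma> P t \<sigma>' u \<sigma>''] assms by auto
  then show ?thesis
    unfolding runs_def by blast
qed

lemma exec_length: "exec P \<sigma> t \<sigma>' \<Longrightarrow> i < 4 \<Longrightarrow> length (\<sigma>' i) \<le> length (\<sigma> i) + t"
  by (induction rule: exec.induct) auto

lemma runs_length: "runs P \<sigma> t \<sigma>' \<Longrightarrow> i < 4 \<Longrightarrow> length (\<sigma>' i) \<le> length (\<sigma> i) + t"
  unfolding runs_def using exec_length by (meson add_left_mono order_trans)

lemma runs_eq: "runs P \<sigma> n \<sigma>' \<Longrightarrow> n \<le> m \<Longrightarrow> \<sigma>' = \<sigma>'' \<Longrightarrow> runs P \<sigma> m \<sigma>''"
  using runs_mono by blast

declare One_nat_def [simp del]

definition move_stack :: "nat \<Rightarrow> nat \<Rightarrow> prog" where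
  "move_stack i j = While i (Branch i (Pop i ;; Push j True) (Pop i ;; Push j False))"

lemma runs_move_stack:
  assumes "i < 4" "j < 4" "i \<noteq> j"
  shows "runs (move_stack i j) \<sigma> (6 * length (\<sigma> i) + 1) (\<sigma>(i := [], j := rev (\<sigma> i) @ \<sigma> j))"
proof (induction "\<sigma> i" arbitrary: \<sigma>)
  case Nil
  then show ?case
    unfolding move_stack_def using assms by (intro runs_eq[OF runs_WhileEnd]) (auto simp: fun_eq_iff)
next
  case (Cons b xs)
  let ?\<sigma> = "\<sigma>(i := xs, j := b # \<sigma> j)"
  have "runs (Pop i ;; Push j b) \<sigma> (1 + 1) ?\<sigma>"
    by (rule runs_Seq[OF runs_Pop runs_eq[OF runs_Push]]) (use assms Cons in \<open>auto simp: Cons(2)[symmetric]\<close>)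
  then have body: "runs (Branch i (Pop i ;; Push j True) (Pop i ;; Push j False)) \<sigma> (1 + 1 + 2) ?\<sigma>"
    using assms(1) Cons(2) by (intro runs_Branch[of _ _ b xs]) auto
  have "runs (move_stack i j) ?\<sigma> (6 * length xs + 1) (?\<sigma>(i := [], j := rev xs @ b # \<sigma> j))"
    using Cons(1)[of ?\<sigma>] assms by simp
  moreover have "?\<sigma>(i := [], j := rev xs @ b # \<sigma> j) = \<sigma>(i := [], j := rev (\<sigma> i) @ \<sigma> j)"
    using assms by (intro ext) (auto simp: Cons(2)[symmetric])
  ultimately show ?case
    unfolding move_stack_def
    by (intro runs_eq[OF runs_WhileStep[OF assms(1) _ body]]) (auto simp: Cons(2)[symmetric])
qed

section \<open>Binary trees and stack routines on their codes\<close>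

datatype bt = Lf | Nd bt bt

fun code :: "bt \<Rightarrow> bool list" where
  "code Lf = [False]"
| "code (Nd a b) = True # code a @ code b"

lemma code_append_eq: "code a @ r = code b @ s \<longleftrightarrow> a = b \<and> r = s"
proof (induction a arbitrary: b r s)
  case Lf
  then show ?case by (cases b) auto
next
  case (Nd a1 a2)
  then show ?case by (cases b) auto
qed

lemma code_eq [simp]: "code a = code b \<longleftrightarrow> a = b"
  using code_append_eq[of a "[]" b "[]"] by simp

lemma code_nonempty [simp]: "code t \<noteq> []"
  by (cases t) auto

text \<open>Stack 3 is a unary counter of the subtrees still to be read: an inner node replaces one
  pending subtree by two, a leaf finishes one. The code itself lands reversed on stack
  \<open>j\<close>.\<close>

definition pull_loop :: "nat \<Rightarrow> prog" where
  "pull_loop j = While 3 (Branch 0 (Pop 0 ;; Push j True ;; Push 3 True) (Pop 0 ;; Push j False ;; Pop 3))"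

text \<open>The loop does not stop between the two subtrees of a node, so the statement is in
  continuation style: a run of the loop on what follows the tree is extended backwards over the
  tree. Each bit costs three instructions, two for the branch and two for the loop.\<close>

lemma pull_loop_tree:
  assumes "j = 1 \<or> j = 2" "\<sigma> 0 = code t @ m" "\<sigma> 3 = True # c"
    "runs (pull_loop j) (\<sigma>(0 := m, j := rev (code t) @ \<sigma> j, 3 := c)) n \<sigma>'"
  shows "runs (pull_loop j) \<sigma> (n + 7 * length (code t)) \<sigma>'"
  using assms
proof (induction t arbitrary: \<sigma> m c n)
  case Lf
  have "runs (Branch 0 (Pop 0 ;; Push j True ;; Push 3 True) (Pop 0 ;; Push j False ;; Pop 3)) \<sigma> (1 + (1 + 1) + 1)
      (\<sigma>(0 := m, j := rev (code Lf) @ \<sigma> j, 3 := c))"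
    by (intro runs_BranchFalse, use Lf in simp, use Lf in simp, rule runs_Seq[OF runs_Pop runs_Seq[OF runs_Push runs_eq[OF runs_Pop]]])
      (use Lf in auto)
  from runs_WhileStep[OF _ _ this Lf(4)[unfolded pull_loop_def]] show ?case
    unfolding pull_loop_def by (rule runs_mono) (use Lf in auto)
next
  case (Nd t1 t2)
  let ?\<sigma> = "\<sigma>(0 := code t1 @ code t2 @ m, j := True # \<sigma> j, 3 := True # True # c)"
  have body: "runs (Branch 0 (Pop 0 ;; Push j True ;; Push 3 True) (Pop 0 ;; Push j False ;; Pop 3)) \<sigma> (1 + (1 + 1) + 2) ?\<sigma>"
    by (intro runs_BranchTrue, use Nd in simp, use Nd in simp, rule runs_Seq[OF runs_Pop runs_Seq[OF runs_Push runs_eq[OF runs_Push]]])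
      (use Nd.prems in auto)
  let ?\<sigma>1 = "\<sigma>(0 := code t2 @ m, j := rev (code t1) @ True # \<sigma> j, 3 := True # c)"
  have "runs (pull_loop j) ?\<sigma>1 (n + 7 * length (code t2)) \<sigma>'"
  proof (rule Nd.IH(2)[where m = m and c = c])
    have "?\<sigma>1(0 := m, j := rev (code t2) @ ?\<sigma>1 j, 3 := c) = \<sigma>(0 := m, j := rev (code (Nd t1 t2)) @ \<sigma> j, 3 := c)"
      using Nd.prems by (intro ext) auto
    then show "runs (pull_loop j) (?\<sigma>1(0 := m, j := rev (code t2) @ ?\<sigma>1 j, 3 := c)) n \<sigma>'"
      using Nd.prems(4) by (simp only:)
  qed (use Nd.prems in auto)
  moreover have "?\<sigma>(0 := code t2 @ m, j := rev (code t1) @ ?\<sigma> j, 3 := True # c) = ?\<sigma>1"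
    using Nd.prems(1) by (intro ext) auto
  ultimately have "runs (pull_loop j) (?\<sigma>(0 := code t2 @ m, j := rev (code t1) @ ?\<sigma> j, 3 := True # c))
      (n + 7 * length (code t2)) \<sigma>'"
    by (simp only:)
  then have "runs (pull_loop j) ?\<sigma> (n + 7 * length (code t2) + 7 * length (code t1)) \<sigma>'"
    by (rule Nd.IH(1)[OF Nd.prems(1), rotated 2]) (use Nd.prems(1) in auto)
  from runs_WhileStep[OF _ _ body this[unfolded pull_loop_def]] show ?case
    unfolding pull_loop_def by (rule runs_mono) (use Nd.prems in auto)
qed

definition pull :: "nat \<Rightarrow> prog" where
  "pull j = Push 3 True ;; pull_loop j"

lemma runs_pull:
  assumes "j = 1 \<or> j = 2" "\<sigma> 0 = code t @ m" "\<sigma> 3 = []"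
  shows "runs (pull j) \<sigma> (7 * length (code t) + 2) (\<sigma>(0 := m, j := rev (code t) @ \<sigma> j))"
proof -
  let ?\<sigma> = "\<sigma>(3 := [True])"
  have "runs (pull_loop j) (?\<sigma>(0 := m, j := rev (code t) @ ?\<sigma> j, 3 := [])) 1 (?\<sigma>(0 := m, j := rev (code t) @ ?\<sigma> j, 3 := []))"
    unfolding pull_loop_def by (intro runs_WhileEnd) auto
  then have "runs (pull_loop j) ?\<sigma> (1 + 7 * length (code t)) (?\<sigma>(0 := m, j := rev (code t) @ ?\<sigma> j, 3 := []))"
    using assms by (intro pull_loop_tree[where m = m and c = "[]"]) auto
  moreover have "?\<sigma>(0 := m, j := rev (code t) @ ?\<sigma> j, 3 := []) = \<sigma>(0 := m, j := rev (code t) @ \<sigma> j)"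
    using assms by (intro ext) auto
  ultimately show ?thesis
    unfolding pull_def using assms runs_Push[of 3 True \<sigma>]
    by (intro runs_mono[OF runs_Seq[of _ _ 1 ?\<sigma>]]) auto
qed

definition main :: "bool list \<Rightarrow> store" where
  "main m = (\<lambda>_. [])(0 := m)"

definition swap :: prog where
  "swap = pull 1 ;; pull 2 ;; move_stack 1 0 ;; move_stack 2 0"

lemma runs_swap:
  "runs swap (main (code a @ code b @ r)) (13 * (length (code a) + length (code b)) + 6) (main (code b @ code a @ r))"
proof -
  have 1: "runs (pull 1) (main (code a @ code b @ r)) (7 * length (code a) + 2)
      ((\<lambda>_. [])(0 := code b @ r, 1 := rev (code a)))"
    by (rule runs_eq[OF runs_pull[where t = a and m = "code b @ r"]]) (auto simp: main_def)
  have 2: "runs (pull 2) ((\<lambda>_. [])(0 := code b @ r, 1 := rev (code a))) (7 * length (code b) + 2)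
      ((\<lambda>_. [])(0 := r, 1 := rev (code a), 2 := rev (code b)))"
    by (rule runs_eq[OF runs_pull[where t = b and m = r]]) (auto simp: main_def)
  have 3: "runs (move_stack 1 0) ((\<lambda>_. [])(0 := r, 1 := rev (code a), 2 := rev (code b))) (6 * length (code a) + 1)
      ((\<lambda>_. [])(0 := code a @ r, 2 := rev (code b)))"
    by (rule runs_eq[OF runs_move_stack]) (auto simp: main_def)
  have 4: "runs (move_stack 2 0) ((\<lambda>_. [])(0 := code a @ r, 2 := rev (code b))) (6 * length (code b) + 1)
      (main (code b @ code a @ r))"
    by (rule runs_eq[OF runs_move_stack]) (auto simp: main_def)
  show ?thesis
    unfolding swap_def by (rule runs_mono[OF runs_Seq[OF 1 runs_Seq[OF 2 runs_Seq[OF 3 4]]]]) simp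
qed

definition drop_top :: prog where
  "drop_top = pull 1 ;; While 1 (Pop 1)"

lemma runs_clear: "i < 4 \<Longrightarrow> runs (While i (Pop i)) \<sigma> (3 * length (\<sigma> i) + 1) (\<sigma>(i := []))"
proof (induction "\<sigma> i" arbitrary: \<sigma>)
  case Nil
  then show ?case by (intro runs_eq[OF runs_WhileEnd]) (auto simp: fun_eq_iff)
next
  case (Cons b xs)
  then have "runs (While i (Pop i)) (\<sigma>(i := tl (\<sigma> i))) (3 * length xs + 1) (\<sigma>(i := []))"
    using Cons(1)[of "\<sigma>(i := tl (\<sigma> i))"] by (simp add: Cons(2)[symmetric])
  from runs_WhileStep[OF _ _ runs_Pop this] show ?case
    by (rule runs_mono) (use Cons(3) in \<open>auto simp: Cons(2)[symmetric]\<close>)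
qed

lemma runs_drop: "runs drop_top (main (code a @ r)) (10 * length (code a) + 3) (main r)"
proof -
  have 1: "runs (pull 1) (main (code a @ r)) (7 * length (code a) + 2) ((\<lambda>_. [])(0 := r, 1 := rev (code a)))"
    by (rule runs_eq[OF runs_pull[where t = a and m = r]]) (auto simp: main_def)
  have 2: "runs (While 1 (Pop 1)) ((\<lambda>_. [])(0 := r, 1 := rev (code a))) (3 * length (code a) + 1) (main r)"
    by (rule runs_eq[OF runs_clear]) (auto simp: main_def)
  show ?thesis
    unfolding drop_top_def by (rule runs_mono[OF runs_Seq[OF 1 2]]) simp
qed

definition split_stack :: prog where
  "split_stack = While 1 (Branch 1 (Pop 1 ;; Push 0 True ;; Push 2 True) (Pop 1 ;; Push 0 False ;; Push 2 False))"

lemma runs_split_stack: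
  "runs split_stack \<sigma> (7 * length (\<sigma> 1) + 1) (\<sigma>(0 := rev (\<sigma> 1) @ \<sigma> 0, 1 := [], 2 := rev (\<sigma> 1) @ \<sigma> 2))"
proof (induction "\<sigma> 1" arbitrary: \<sigma>)
  case Nil
  then show ?case unfolding split_stack_def by (intro runs_eq[OF runs_WhileEnd]) (auto simp: fun_eq_iff)
next
  case (Cons b xs)
  let ?\<sigma> = "\<sigma>(0 := b # \<sigma> 0, 1 := xs, 2 := b # \<sigma> 2)"
  have "runs (Pop 1 ;; Push 0 b ;; Push 2 b) \<sigma> (1 + (1 + 1)) ?\<sigma>"
    by (rule runs_Seq[OF runs_Pop runs_Seq[OF runs_Push runs_eq[OF runs_Push]]]) (auto simp: Cons(2)[symmetric])
  then have body: "runs (Branch 1 (Pop 1 ;; Push 0 True ;; Push 2 True) (Pop 1 ;; Push 0 False ;; Push 2 False)) \<sigma> (1 + (1 + 1) + 2) ?\<sigma>"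
    using Cons(2) by (intro runs_Branch[of _ _ b xs]) auto
  have "runs split_stack ?\<sigma> (7 * length xs + 1) (?\<sigma>(0 := rev xs @ b # \<sigma> 0, 1 := [], 2 := rev xs @ b # \<sigma> 2))"
    using Cons(1)[of ?\<sigma>] by simp
  moreover have "?\<sigma>(0 := rev xs @ b # \<sigma> 0, 1 := [], 2 := rev xs @ b # \<sigma> 2) =
      \<sigma>(0 := rev (\<sigma> 1) @ \<sigma> 0, 1 := [], 2 := rev (\<sigma> 1) @ \<sigma> 2)"
    by (intro ext) (auto simp: Cons(2)[symmetric])
  ultimately show ?case
    unfolding split_stack_def
    by (intro runs_eq[OF runs_WhileStep[OF _ _ body]]) (auto simp: Cons(2)[symmetric])
qed

text \<open>\<open>split_stack\<close> restores the original and leaves the copy in forward order on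
  stack 2; two further moves, each a reversal, put it on top.\<close>

definition dup :: prog where
  "dup = pull 1 ;; split_stack ;; move_stack 2 1 ;; move_stack 1 0"

lemma runs_dup: "runs dup (main (code a @ r)) (26 * length (code a) + 5) (main (code a @ code a @ r))"
proof -
  have 1: "runs (pull 1) (main (code a @ r)) (7 * length (code a) + 2) ((\<lambda>_. [])(0 := r, 1 := rev (code a)))"
    by (rule runs_eq[OF runs_pull[where t = a and m = r]]) (auto simp: main_def)
  have 2: "runs split_stack ((\<lambda>_. [])(0 := r, 1 := rev (code a))) (7 * length (code a) + 1)
      ((\<lambda>_. [])(0 := code a @ r, 2 := code a))"
    by (rule runs_eq[OF runs_split_stack]) (auto simp: main_def)
  have 3: "runs (move_stack 2 1) ((\<lambda>_. [])(0 := code a @ r, 2 := code a)) (6 * length (code a) + 1)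
      ((\<lambda>_. [])(0 := code a @ r, 1 := rev (code a)))"
    by (rule runs_eq[OF runs_move_stack]) auto
  have 4: "runs (move_stack 1 0) ((\<lambda>_. [])(0 := code a @ r, 1 := rev (code a))) (6 * length (code a) + 1)
      (main (code a @ code a @ r))"
    by (rule runs_eq[OF runs_move_stack]) (auto simp: main_def)
  show ?thesis
    unfolding dup_def by (rule runs_mono[OF runs_Seq[OF 1 runs_Seq[OF 2 runs_Seq[OF 3 4]]]]) simp
qed

text \<open>An exhausted second stack reads as \<open>False\<close>. For reversed codes this cannot produce a wrong match, since
  every code of length greater than one starts with \<open>True\<close>.\<close>

fun padded_match :: "bool list \<Rightarrow> bool list \<Rightarrow> bool" where
  "padded_match [] ys = True"
| "padded_match (x # xs) ys \<longleftrightarrow> x = (ys \<noteq> [] \<and> hd ys) \<and> padded_match xs (tl ys)"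

definition match_loop :: prog where
  "match_loop = While 1 (Branch 1 (Branch 2 (Pop 1 ;; Pop 2) (Pop 1 ;; Pop 2 ;; Push 3 True))
     (Branch 2 (Pop 1 ;; Pop 2 ;; Push 3 True) (Pop 1 ;; Pop 2)))"

text \<open>Mismatches are collected in unary on stack 3. For the result only \<open>k = 0\<close>
  matters; the bound on \<open>k\<close> pays for clearing the stack later.\<close>

lemma runs_match_loop:
  "\<exists>k. runs match_loop \<sigma> (9 * length (\<sigma> 1) + 1)
      (\<sigma>(1 := [], 2 := drop (length (\<sigma> 1)) (\<sigma> 2), 3 := replicate k True @ \<sigma> 3)) \<and>
    (k = 0 \<longleftrightarrow> padded_match (\<sigma> 1) (\<sigma> 2)) \<and> k \<le> length (\<sigma> 1)"
proof (induction "\<sigma> 1" arbitrary: \<sigma>)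
  case Nil
  then have "runs match_loop \<sigma> (9 * length (\<sigma> 1) + 1)
      (\<sigma>(1 := [], 2 := drop (length (\<sigma> 1)) (\<sigma> 2), 3 := replicate 0 True @ \<sigma> 3))"
    unfolding match_loop_def by (intro runs_eq[OF runs_WhileEnd]) (auto simp: fun_eq_iff)
  moreover have "padded_match (\<sigma> 1) (\<sigma> 2)"
    using Nil by (metis padded_match.simps(1))
  ultimately show ?case
    by blast
next
  case (Cons b xs)
  define e where "e \<longleftrightarrow> b = (\<sigma> 2 \<noteq> [] \<and> hd (\<sigma> 2))"
  define \<sigma>1 where "\<sigma>1 = \<sigma>(1 := xs, 2 := tl (\<sigma> 2), 3 := (if e then [] else [True]) @ \<sigma> 3)"
  have "runs (Pop 1 ;; Pop 2) \<sigma> (1 + 1) \<sigma>1" if e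
    by (rule runs_Seq[OF runs_Pop runs_eq[OF runs_Pop]]) (use that in \<open>auto simp: Cons(2)[symmetric] \<sigma>1_def fun_eq_iff\<close>)
  then have eq: "runs (Pop 1 ;; Pop 2) \<sigma> 3 \<sigma>1" if e
    using that by (auto intro: runs_mono)
  have neq: "runs (Pop 1 ;; Pop 2 ;; Push 3 True) \<sigma> (1 + (1 + 1)) \<sigma>1" if "\<not> e"
    by (rule runs_Seq[OF runs_Pop runs_Seq[OF runs_Pop runs_eq[OF runs_Push]]])
      (use that in \<open>auto simp: Cons(2)[symmetric] \<sigma>1_def fun_eq_iff\<close>)
  have body: "runs (Branch 1 (Branch 2 (Pop 1 ;; Pop 2) (Pop 1 ;; Pop 2 ;; Push 3 True))
     (Branch 2 (Pop 1 ;; Pop 2 ;; Push 3 True) (Pop 1 ;; Pop 2))) \<sigma> 7 \<sigma>1"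
  proof (cases b)
    case b: True
    have "runs (Branch 2 (Pop 1 ;; Pop 2) (Pop 1 ;; Pop 2 ;; Push 3 True)) \<sigma> (3 + 2) \<sigma>1"
    proof (cases e)
      case True
      then obtain s where "\<sigma> 2 = True # s" using b by (cases "\<sigma> 2") (auto simp: e_def)
      then show ?thesis using runs_BranchTrue[OF _ _ eq[OF True]] by simp
    next
      case False
      then show ?thesis using runs_mono[OF runs_BranchFalse[OF _ _ neq[OF False]]] b by (simp add: e_def)
    qed
    from runs_BranchTrue[OF _ _ this, of 1 xs] show ?thesis
      using b by (simp add: Cons(2)[symmetric])
  next
    case b: False
    have "runs (Branch 2 (Pop 1 ;; Pop 2 ;; Push 3 True) (Pop 1 ;; Pop 2)) \<sigma> (3 + 2) \<sigma>1"
    proof (cases e)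
      case False
      then obtain s where "\<sigma> 2 = True # s" using b by (cases "\<sigma> 2") (auto simp: e_def)
      then show ?thesis using runs_mono[OF runs_BranchTrue[OF _ _ neq[OF False]]] by simp
    next
      case True
      then show ?thesis using runs_mono[OF runs_BranchFalse[OF _ _ eq[OF True]]] b by (simp add: e_def)
    qed
    from runs_mono[OF runs_BranchFalse[OF _ _ this, of 1], of 7] show ?thesis
      using b by (simp add: Cons(2)[symmetric])
  qed
  obtain k where k: "runs match_loop \<sigma>1 (9 * length (\<sigma>1 1) + 1)
      (\<sigma>1(1 := [], 2 := drop (length (\<sigma>1 1)) (\<sigma>1 2), 3 := replicate k True @ \<sigma>1 3))"
    "k = 0 \<longleftrightarrow> padded_match (\<sigma>1 1) (\<sigma>1 2)" "k \<le> length (\<sigma>1 1)"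
    using Cons(1)[of \<sigma>1] by (auto simp: \<sigma>1_def)
  define k' where "k' = (if e then k else Suc k)"
  have "\<sigma>1(1 := [], 2 := drop (length (\<sigma>1 1)) (\<sigma>1 2), 3 := replicate k True @ \<sigma>1 3) =
      \<sigma>(1 := [], 2 := drop (length (\<sigma> 1)) (\<sigma> 2), 3 := replicate k' True @ \<sigma> 3)"
    by (intro ext) (auto simp: \<sigma>1_def k'_def Cons(2)[symmetric] drop_Suc replicate_app_Cons_same)
  then have "runs match_loop \<sigma>1 (9 * length xs + 1)
      (\<sigma>(1 := [], 2 := drop (length (\<sigma> 1)) (\<sigma> 2), 3 := replicate k' True @ \<sigma> 3))"
    using k(1) by (simp add: \<sigma>1_def)
  then have "runs match_loop \<sigma> (9 * length (\<sigma> 1) + 1)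
      (\<sigma>(1 := [], 2 := drop (length (\<sigma> 1)) (\<sigma> 2), 3 := replicate k' True @ \<sigma> 3))"
    unfolding match_loop_def
    by (intro runs_mono[OF runs_WhileStep[OF _ _ body]]) (auto simp: Cons(2)[symmetric])
  moreover have "k' = 0 \<longleftrightarrow> padded_match (\<sigma> 1) (\<sigma> 2)"
    using k(2) by (auto simp: k'_def \<sigma>1_def Cons(2)[symmetric] e_def)
  moreover have "k' \<le> length (\<sigma> 1)"
    using k(3) by (auto simp: k'_def \<sigma>1_def Cons(2)[symmetric])
  ultimately show ?case by blast
qed

text \<open>Reading an exhausted \<open>ys\<close> as \<open>False\<close> lets \<open>xs\<close> be
  longer exactly when its surplus is all \<open>False\<close>; the condition on \<open>drop\<close>
  excludes a longer \<open>ys\<close>.\<close>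

lemma padded_match_iff: "padded_match xs ys \<and> drop (length xs) ys = [] \<longleftrightarrow> (\<exists>k. xs = ys @ replicate k False)"
proof (induction xs arbitrary: ys)
  case (Cons x xs)
  show ?case
  proof (cases ys)
    case Nil
    then show ?thesis using Cons[of "[]"] by (auto simp: Cons_replicate_eq)
  next
    case (Cons y ys')
    then show ?thesis using Cons.IH[of ys'] by auto
  qed
qed auto

lemma code_hd: "hd (code t) = (t \<noteq> Lf)"
  by (cases t) auto

lemma rev_code_match:
  "padded_match (rev (code a)) (rev (code b)) \<and> drop (length (code a)) (rev (code b)) = [] \<longleftrightarrow> a = b"
proof -
  have "a = b" if "rev (code a) = rev (code b) @ replicate k False" for k
  proof (cases k)
    case 0
    then show ?thesis using that by simp
  next
    case (Suc n)
    have *: "code a = replicate k False @ code b"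
      using that by (metis rev_append rev_replicate rev_rev_ident)
    then have "hd (code a) = False" using Suc by simp
    then have "a = Lf" by (simp add: code_hd)
    then show ?thesis using * Suc by (cases n) (auto dest: sym[of "[]"])
  qed
  then show ?thesis
    using padded_match_iff[of "rev (code a)" "rev (code b)"] by (auto intro: exI[of _ 0])
qed

definition equal_top :: prog where
  "equal_top = pull 1 ;; pull 2 ;; match_loop ;; While 2 (Pop 2 ;; Push 3 True) ;;
     Branch 3 (Push 0 False) (Push 0 False ;; Push 0 False ;; Push 0 True) ;; While 3 (Pop 3)"

text \<open>Bits of the second code that survive the comparison are added to the mismatches, so that
  a single test of stack 3 also detects a second code that is too long.\<close>

lemma runs_count_loop:
  "runs (While 2 (Pop 2 ;; Push 3 True)) \<sigma> (4 * length (\<sigma> 2) + 1)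
     (\<sigma>(2 := [], 3 := replicate (length (\<sigma> 2)) True @ \<sigma> 3))"
proof (induction "\<sigma> 2" arbitrary: \<sigma>)
  case Nil
  then show ?case by (intro runs_eq[OF runs_WhileEnd]) (auto simp: fun_eq_iff)
next
  case (Cons b xs)
  let ?\<sigma> = "\<sigma>(2 := xs, 3 := True # \<sigma> 3)"
  have body: "runs (Pop 2 ;; Push 3 True) \<sigma> (1 + 1) ?\<sigma>"
    by (rule runs_Seq[OF runs_Pop runs_eq[OF runs_Push]]) (auto simp: Cons(2)[symmetric])
  have "runs (While 2 (Pop 2 ;; Push 3 True)) ?\<sigma> (4 * length xs + 1) (?\<sigma>(2 := [], 3 := replicate (length xs) True @ True # \<sigma> 3))"
    using Cons(1)[of ?\<sigma>] by simp
  moreover have "?\<sigma>(2 := [], 3 := replicate (length xs) True @ True # \<sigma> 3) =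
      \<sigma>(2 := [], 3 := replicate (length (\<sigma> 2)) True @ \<sigma> 3)"
    by (intro ext) (auto simp: Cons(2)[symmetric] replicate_app_Cons_same)
  ultimately show ?case
    by (intro runs_eq[OF runs_WhileStep[OF _ _ body]]) (auto simp: Cons(2)[symmetric])
qed

lemma runs_equal:
  "runs equal_top (main (code a @ code b @ r)) (19 * (length (code a) + length (code b)) + 20)
     (main (code (if a = b then Nd Lf Lf else Lf) @ r))"
proof -
  let ?A = "length (code a)" and ?B = "length (code b)"
  have 1: "runs (pull 1) (main (code a @ code b @ r)) (7 * ?A + 2)
      ((\<lambda>_. [])(0 := code b @ r, 1 := rev (code a)))"
    by (rule runs_eq[OF runs_pull[where t = a and m = "code b @ r"]]) (auto simp: main_def)
  have 2: "runs (pull 2) ((\<lambda>_. [])(0 := code b @ r, 1 := rev (code a))) (7 * ?B + 2)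
      ((\<lambda>_. [])(0 := r, 1 := rev (code a), 2 := rev (code b)))"
    by (rule runs_eq[OF runs_pull[where t = b and m = r]]) (auto simp: main_def)
  let ?D = "drop ?A (rev (code b))"
  obtain k where 3: "runs match_loop ((\<lambda>_. [])(0 := r, 1 := rev (code a), 2 := rev (code b))) (9 * ?A + 1)
      ((\<lambda>_. [])(0 := r, 2 := ?D, 3 := replicate k True))"
    and k: "k = 0 \<longleftrightarrow> padded_match (rev (code a)) (rev (code b))" "k \<le> ?A"
  proof -
    let ?s = "(\<lambda>_. [])(0 := r, 1 := rev (code a), 2 := rev (code b)) :: store"
    obtain k where "runs match_loop ?s (9 * length (?s 1) + 1)
        (?s(1 := [], 2 := drop (length (?s 1)) (?s 2), 3 := replicate k True @ ?s 3))"
      "k = 0 \<longleftrightarrow> padded_match (?s 1) (?s 2)" "k \<le> length (?s 1)"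
      using runs_match_loop[of ?s] by blast
    moreover from this(1) have "runs match_loop ?s (9 * ?A + 1) ((\<lambda>_. [])(0 := r, 2 := ?D, 3 := replicate k True))"
      by (rule runs_eq) auto
    ultimately show thesis
      using that[of k] by simp
  qed
  define l where "l = length ?D + k"
  have 4: "runs (While 2 (Pop 2 ;; Push 3 True)) ((\<lambda>_. [])(0 := r, 2 := ?D, 3 := replicate k True)) (4 * length ?D + 1)
      ((\<lambda>_. [])(0 := r, 3 := replicate l True))"
    by (rule runs_eq[OF runs_count_loop]) (auto simp: l_def replicate_add)
  have l: "l = 0 \<longleftrightarrow> a = b"
    using rev_code_match[of a b] k(1) by (auto simp: l_def)
  let ?c = "code (if a = b then Nd Lf Lf else Lf)"
  have 5: "runs (Branch 3 (Push 0 False) (Push 0 False ;; Push 0 False ;; Push 0 True))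
      ((\<lambda>_. [])(0 := r, 3 := replicate l True)) 5 ((\<lambda>_. [])(0 := ?c @ r, 3 := replicate l True))"
  proof (cases "a = b")
    case True
    have "runs (Push 0 False ;; Push 0 False ;; Push 0 True) ((\<lambda>_. [])(0 := r, 3 := replicate l True)) (1 + (1 + 1))
        ((\<lambda>_. [])(0 := ?c @ r, 3 := replicate l True))"
      by (rule runs_Seq[OF runs_Push runs_Seq[OF runs_Push runs_eq[OF runs_Push]]]) (use True in auto)
    from runs_mono[OF runs_BranchFalse[OF _ _ this, of 3], of 5] show ?thesis
      using True l by simp
  next
    case False
    have "runs (Push 0 False) ((\<lambda>_. [])(0 := r, 3 := replicate l True)) 1 ((\<lambda>_. [])(0 := ?c @ r, 3 := replicate l True))"
      by (rule runs_eq[OF runs_Push]) (use False in auto)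
    from runs_mono[OF runs_BranchTrue[OF _ _ this, of 3 "replicate (l - 1) True"], of 5] show ?thesis
      using False l by (cases l) auto
  qed
  have 6: "runs (While 3 (Pop 3)) ((\<lambda>_. [])(0 := ?c @ r, 3 := replicate l True)) (3 * l + 1) (main (?c @ r))"
    by (rule runs_eq[OF runs_clear]) (auto simp: main_def)
  have "l \<le> ?A + ?B" using k(2) by (simp add: l_def)
  then show ?thesis
    unfolding equal_top_def
    by (intro runs_mono[OF runs_Seq[OF 1 runs_Seq[OF 2 runs_Seq[OF 3 runs_Seq[OF 4 runs_Seq[OF 5 6]]]]]]) simp
qed

section \<open>Polynomial-time functions on encoded data\<close>

declare One_nat_def [simp]

text \<open>The base \<open>n + 2\<close> is at least 2 even for \<open>n = 0\<close>, so constants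
  and sums are absorbed by raising the exponent, and a bound is a single number
  \<open>d\<close>.\<close>

definition poly_bounded :: "(nat \<Rightarrow> nat) \<Rightarrow> bool" where
  "poly_bounded g \<longleftrightarrow> (\<exists>d. \<forall>n. g n \<le> (n + 2) ^ d)"

lemma poly_bounded_const: "poly_bounded (\<lambda>n. c)"
proof -
  have "c \<le> (n + 2) ^ c" for n :: nat
  proof -
    have "c < 2 ^ c" by (rule less_exp)
    also have "(2::nat) ^ c \<le> (n + 2) ^ c" by (rule power_mono) auto
    finally show ?thesis by simp
  qed
  then show ?thesis unfolding poly_bounded_def by blast
qed

lemma poly_bounded_id: "poly_bounded (\<lambda>n. n)"
  unfolding poly_bounded_def by (intro exI[of _ 1]) simp

lemma poly_bounded_mult:
  assumes "poly_bounded g" "poly_bounded h"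
  shows "poly_bounded (\<lambda>n. g n * h n)"
proof -
  obtain d e where "\<forall>n. g n \<le> (n + 2) ^ d" "\<forall>n. h n \<le> (n + 2) ^ e"
    using assms unfolding poly_bounded_def by blast
  then have "g n * h n \<le> (n + 2) ^ (d + e)" for n
    unfolding power_add by (intro mult_mono) auto
  then show ?thesis unfolding poly_bounded_def by blast
qed

lemma poly_bounded_add:
  assumes "poly_bounded g" "poly_bounded h"
  shows "poly_bounded (\<lambda>n. g n + h n)"
proof -
  obtain d e where de: "\<forall>n. g n \<le> (n + 2) ^ d" "\<forall>n. h n \<le> (n + 2) ^ e"
    using assms unfolding poly_bounded_def by blast
  have "g n + h n \<le> (n + 2) ^ (d + e + 1)" for n
  proof -
    have "(n + 2) ^ d \<le> (n + 2) ^ (d + e)" "(n + 2) ^ e \<le> (n + 2) ^ (d + e)"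
      by (rule power_increasing; simp)+
    then have "g n + h n \<le> 2 * (n + 2) ^ (d + e)"
      using de[THEN spec[of _ n]] by linarith
    also have "\<dots> \<le> (n + 2) * (n + 2) ^ (d + e)" by simp
    also have "\<dots> = (n + 2) ^ (d + e + 1)" by simp
    finally show ?thesis .
  qed
  then show ?thesis unfolding poly_bounded_def by blast
qed

lemma poly_bounded_comp:
  assumes "poly_bounded g" "poly_bounded h"
  shows "poly_bounded (\<lambda>n. g (h n))"
proof -
  obtain d where d: "\<forall>n. g n \<le> (n + 2) ^ d"
    using assms unfolding poly_bounded_def by blast
  obtain e where e: "\<forall>n. h n + 2 \<le> (n + 2) ^ e"
    using poly_bounded_add[OF assms(2) poly_bounded_const[of 2]] unfolding poly_bounded_def by blast
  have "g (h n) \<le> (n + 2) ^ (e * d)" for n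
  proof -
    have "g (h n) \<le> (h n + 2) ^ d" using d by blast
    also have "\<dots> \<le> ((n + 2) ^ e) ^ d" by (rule power_mono) (use e in auto)
    finally show ?thesis by (simp add: power_mult)
  qed
  then show ?thesis unfolding poly_bounded_def by blast
qed

lemma poly_bounded_power: "poly_bounded g \<Longrightarrow> poly_bounded (\<lambda>n. g n ^ d)"
  by (induction d) (auto intro: poly_bounded_const poly_bounded_mult)

lemma poly_bounded_Suc: "poly_bounded g \<Longrightarrow> poly_bounded (\<lambda>n. Suc (g n))"
  using poly_bounded_add[OF _ poly_bounded_const[of 1], of g] by simp

lemmas poly_bounded_intros =
  poly_bounded_const poly_bounded_id poly_bounded_add poly_bounded_mult poly_bounded_power poly_bounded_Suc

text \<open>Decoding is total, so that an arbitrary tree can be read as a certificate. Natural numbers are encoded in unary.\<close>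

class enc =
  fixes to_tree :: "'a \<Rightarrow> bt" and of_tree :: "bt \<Rightarrow> 'a"
  assumes of_tree_to_tree [simp]: "of_tree (to_tree x) = x"

lemma to_tree_eq [simp]: "to_tree x = to_tree y \<longleftrightarrow> x = y"
  by (metis of_tree_to_tree)

definition enc_size :: "'a::enc \<Rightarrow> nat" where
  "enc_size x = length (code (to_tree x))"

instantiation bt :: enc
begin
definition to_tree_bt :: "bt \<Rightarrow> bt" where [simp]: "to_tree_bt x = x"
definition of_tree_bt :: "bt \<Rightarrow> bt" where [simp]: "of_tree_bt x = x"
instance by standard simp
end

instantiation unit :: enc
begin
definition to_tree_unit :: "unit \<Rightarrow> bt" where [simp]: "to_tree_unit x = Lf"
definition of_tree_unit :: "bt \<Rightarrow> unit" where [simp]: "of_tree_unit x = ()"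
instance by standard simp
end

instantiation bool :: enc
begin
definition to_tree_bool :: "bool \<Rightarrow> bt" where [simp]: "to_tree_bool b = (if b then Nd Lf Lf else Lf)"
definition of_tree_bool :: "bt \<Rightarrow> bool" where [simp]: "of_tree_bool x = (x \<noteq> Lf)"
instance by standard simp
end

instantiation nat :: enc
begin
primrec to_tree_nat :: "nat \<Rightarrow> bt" where
  "to_tree_nat 0 = Lf"
| "to_tree_nat (Suc n) = Nd Lf (to_tree_nat n)"
primrec of_tree_nat :: "bt \<Rightarrow> nat" where
  "of_tree_nat Lf = 0"
| "of_tree_nat (Nd a b) = Suc (of_tree_nat b)"
instance
proof
  show "of_tree (to_tree n) = n" for n :: nat by (induction n) auto
qed
end

instantiation list :: (enc) enc
begin
primrec to_tree_list :: "'a list \<Rightarrow> bt" where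
  "to_tree_list [] = Lf"
| "to_tree_list (x # xs) = Nd (to_tree x) (to_tree_list xs)"
primrec of_tree_list :: "bt \<Rightarrow> 'a list" where
  "of_tree_list Lf = []"
| "of_tree_list (Nd a b) = of_tree a # of_tree_list b"
instance
proof
  show "of_tree (to_tree xs) = xs" for xs :: "'a list" by (induction xs) auto
qed
end

instantiation prod :: (enc, enc) enc
begin
definition to_tree_prod :: "'a \<times> 'b \<Rightarrow> bt" where [simp]: "to_tree_prod z = Nd (to_tree (fst z)) (to_tree (snd z))"
definition of_tree_prod :: "bt \<Rightarrow> 'a \<times> 'b" where
  "of_tree_prod t = (case t of Lf \<Rightarrow> (of_tree Lf, of_tree Lf) | Nd a b \<Rightarrow> (of_tree a, of_tree b))"
instance by standard (simp add: of_tree_prod_def)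
end

lemma enc_size_pair [simp]: "enc_size (a, b) = Suc (enc_size a + enc_size b)"
  by (simp add: enc_size_def)

lemma enc_size_nat [simp]: "enc_size (n::nat) = 2 * n + 1"
  by (induction n) (auto simp: enc_size_def)

lemma enc_size_unit [simp]: "enc_size () = 1"
  by (simp add: enc_size_def)

lemma enc_size_bool: "enc_size (b::bool) \<le> 3"
  by (simp add: enc_size_def)

lemma enc_size_Nil [simp]: "enc_size [] = 1"
  by (simp add: enc_size_def)

lemma enc_size_Cons [simp]: "enc_size (x # xs) = Suc (enc_size x + enc_size xs)"
  by (simp add: enc_size_def)

lemma enc_size_pos: "enc_size x \<ge> 1"
  unfolding enc_size_def by (cases "code (to_tree x)") auto

text \<open>The arbitrary rest \<open>r\<close> turns the main stack into an evaluation stack on which programs can be composed.\<close>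

definition computes :: "prog \<Rightarrow> nat \<Rightarrow> ('a::enc \<Rightarrow> 'b::enc) \<Rightarrow> bool" where
  "computes P d f \<longleftrightarrow>
     (\<forall>x r. runs P (main (code (to_tree x) @ r)) ((enc_size x + 2) ^ d) (main (code (to_tree (f x)) @ r)))"

definition ptime :: "('a::enc \<Rightarrow> 'b::enc) \<Rightarrow> bool" where
  "ptime f \<longleftrightarrow> (\<exists>P d. computes P d f)"

lemma computes_runs:
  "computes P d f \<Longrightarrow> runs P (main (code (to_tree x) @ r)) ((enc_size x + 2) ^ d) (main (code (to_tree (f x)) @ r))"
  unfolding computes_def by blast

text \<open>A step adds at most one bit to a stack, so the time bound also limits the size of the
  result. Composition and pairing rest on this: the next program is timed by the size of its own
  input.\<close>

lemma computes_enc_size: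
  assumes "computes P d f"
  shows "enc_size (f x) \<le> (enc_size x + 2) ^ (d + 1)"
proof -
  have 1: "enc_size (f x) \<le> enc_size x + (enc_size x + 2) ^ d"
    using runs_length[OF computes_runs[OF assms, of x "[]"], of 0] by (simp add: main_def enc_size_def)
  have 2: "enc_size x \<le> (enc_size x + 1) * (enc_size x + 2) ^ d"
    using mult_le_mono[of "enc_size x" "enc_size x + 1" 1 "(enc_size x + 2) ^ d"] by simp
  have 3: "(enc_size x + 2) ^ (d + 1) = (enc_size x + 1) * (enc_size x + 2) ^ d + (enc_size x + 2) ^ d"
    by simp
  show ?thesis
    unfolding 3 using 1 2 by (meson add_le_mono1 order_trans)
qed

lemma ptime_I:
  assumes "poly_bounded g" "\<And>x r. runs P (main (code (to_tree x) @ r)) (g (enc_size x)) (main (code (to_tree (f x)) @ r))"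
  shows "ptime f"
proof -
  obtain d where "\<forall>n. g n \<le> (n + 2) ^ d"
    using assms(1) unfolding poly_bounded_def by blast
  then have "computes P d f"
    unfolding computes_def using runs_mono[OF assms(2)] by blast
  then show ?thesis
    unfolding ptime_def by blast
qed

section \<open>Closure properties of the polynomial-time functions\<close>

named_theorems ptime_intros

lemma main_apply [simp]: "main m 0 = m" "i \<noteq> 0 \<Longrightarrow> main m i = []"
  by (simp_all add: main_def)

lemma runs_Pop_main: "runs (Pop 0) (main (b # m)) 1 (main m)"
  by (rule runs_eq[OF runs_Pop]) (auto simp: main_def)

lemma runs_Branch_true:
  assumes "runs P (main m) n \<sigma>"
  shows "runs (Branch 0 (Pop 0 ;; Pop 0 ;; Pop 0 ;; P) Q) (main (code (to_tree True) @ m)) (n + 5) \<sigma>"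
proof -
  have "runs (Pop 0 ;; Pop 0 ;; Pop 0 ;; P) (main (True # False # False # m)) (1 + (1 + (1 + n))) \<sigma>"
    by (intro runs_Seq[OF runs_Pop_main] assms)
  from runs_mono[OF runs_BranchTrue[OF _ _ this, of 0 "False # False # m" Q], of "n + 5"] show ?thesis by simp
qed

lemma runs_Branch_false:
  assumes "runs Q (main m) n \<sigma>"
  shows "runs (Branch 0 P (Pop 0 ;; Q)) (main (code (to_tree False) @ m)) (n + 2) \<sigma>"
proof -
  have "runs (Pop 0 ;; Q) (main (False # m)) (1 + n) \<sigma>"
    by (intro runs_Seq[OF runs_Pop_main] assms)
  from runs_mono[OF runs_BranchFalse[OF _ _ this, of 0 P], of "n + 2"] show ?thesis by simp
qed

text \<open>Changing the type without changing the tree costs nothing; constructors such as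
  \<open>#\<close> and \<open>Suc\<close> are obtained from pairs in this way. The push followed by
  a pop is a program that does nothing.\<close>

lemma ptime_cast:
  assumes "\<And>x. to_tree (f x) = to_tree x"
  shows "ptime f"
proof (rule ptime_I)
  fix x r
  have "runs (Push 0 True ;; Pop 0) (main (code (to_tree x) @ r)) (1 + 1) (main (code (to_tree (f x)) @ r))"
    by (rule runs_Seq[OF runs_Push runs_eq[OF runs_Pop]]) (auto simp: main_def assms)
  then show "runs (Push 0 True ;; Pop 0) (main (code (to_tree x) @ r)) 2 (main (code (to_tree (f x)) @ r))"
    by (simp add: numeral_2_eq_2 One_nat_def)
qed (rule poly_bounded_const)

lemma ptime_id [ptime_intros]: "ptime (\<lambda>x. x)"
  by (rule ptime_cast) simp

lemma ptime_comp:
  assumes "ptime f" "ptime g"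
  shows "ptime (\<lambda>x. f (g x))"
proof -
  obtain P d where f': "computes P d f"
    using assms(1) unfolding ptime_def by blast
  note f = computes_runs[OF f'] and sf = computes_enc_size[OF f']
  obtain Q e where g': "computes Q e g"
    using assms(2) unfolding ptime_def by blast
  note g = computes_runs[OF g'] and sg = computes_enc_size[OF g']
  show ?thesis
  proof (rule ptime_I)
    show "poly_bounded (\<lambda>n. (n + 2) ^ e + ((n + 2) ^ (e + 1) + 2) ^ d)"
      by (intro poly_bounded_intros)
    fix x r
    have "(enc_size (g x) + 2) ^ d \<le> ((enc_size x + 2) ^ (e + 1) + 2) ^ d"
      by (rule power_mono) (use sg[of x] in auto)
    then show "runs (Q ;; P) (main (code (to_tree x) @ r)) ((enc_size x + 2) ^ e + ((enc_size x + 2) ^ (e + 1) + 2) ^ d) (main (code (to_tree (f (g x))) @ r))"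
      by (intro runs_mono[OF runs_Seq[OF g f]]) simp
  qed
qed

text \<open>Every program consumes its argument, hence the initial copy. The code of
  \<open>Nd a b\<close> is \<open>True\<close> followed by the codes of \<open>a\<close> and
  \<open>b\<close>, so two stacked results become a pair by one push.\<close>

lemma ptime_pair [ptime_intros]:
  assumes "ptime f" "ptime g"
  shows "ptime (\<lambda>x. (f x, g x))"
proof -
  obtain P d where f': "computes P d f"
    using assms(1) unfolding ptime_def by blast
  note f = computes_runs[OF f'] and sf = computes_enc_size[OF f']
  obtain Q e where g': "computes Q e g"
    using assms(2) unfolding ptime_def by blast
  note g = computes_runs[OF g'] and sg = computes_enc_size[OF g']
  show ?thesis
  proof (rule ptime_I)
    let ?B = "\<lambda>n. (26 * n + 5) + ((n + 2) ^ d + ((13 * ((n + 2) ^ (d + 1) + n) + 6) +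
        ((n + 2) ^ e + ((13 * ((n + 2) ^ (e + 1) + (n + 2) ^ (d + 1)) + 6) + 1))))"
    show "poly_bounded ?B"
      by (intro poly_bounded_intros)
    fix x r
    have push: "runs (Push 0 True) (main (code (to_tree (f x)) @ code (to_tree (g x)) @ r)) 1 (main (code (to_tree (f x, g x)) @ r))"
      by (rule runs_eq[OF runs_Push]) (auto simp: main_def)
    have "runs (dup ;; P ;; swap ;; Q ;; swap ;; Push 0 True) (main (code (to_tree x) @ r))
        ((26 * enc_size x + 5) + ((enc_size x + 2) ^ d + ((13 * (enc_size (f x) + enc_size x) + 6) + ((enc_size x + 2) ^ e + ((13 * (enc_size (g x) + enc_size (f x)) + 6) + 1)))))
        (main (code (to_tree (f x, g x)) @ r))"
      unfolding enc_size_def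
      by (intro runs_Seq[OF runs_dup runs_Seq[OF f[unfolded enc_size_def] runs_Seq[OF runs_swap runs_Seq[OF g[unfolded enc_size_def] runs_Seq[OF runs_swap push]]]]])
    then show "runs (dup ;; P ;; swap ;; Q ;; swap ;; Push 0 True) (main (code (to_tree x) @ r)) (?B (enc_size x)) (main (code (to_tree (f x, g x)) @ r))"
      by (rule runs_mono) (intro add_mono mult_le_mono order_refl sf sg)
  qed
qed

lemma ptime_fst0: "ptime fst"
proof (rule ptime_I)
  show "poly_bounded (\<lambda>n. 23 * n + 10)" by (intro poly_bounded_intros)
  fix x :: "'a \<times> 'b" and r
  obtain a b where x: "x = (a, b)" by fastforce
  have pop: "runs (Pop 0) (main (code (to_tree x) @ r)) 1 (main (code (to_tree a) @ code (to_tree b) @ r))"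
    by (rule runs_eq[OF runs_Pop]) (auto simp: main_def x)
  show "runs (Pop 0 ;; swap ;; drop_top) (main (code (to_tree x) @ r)) (23 * enc_size x + 10) (main (code (to_tree (fst x)) @ r))"
    by (rule runs_eq[OF runs_Seq[OF pop runs_Seq[OF runs_swap runs_drop]]]) (auto simp: x enc_size_def)
qed

lemma ptime_snd0: "ptime snd"
proof (rule ptime_I)
  show "poly_bounded (\<lambda>n. 10 * n + 10)" by (intro poly_bounded_intros)
  fix x :: "'a \<times> 'b" and r
  obtain a b where x: "x = (a, b)" by fastforce
  have pop: "runs (Pop 0) (main (code (to_tree x) @ r)) 1 (main (code (to_tree a) @ code (to_tree b) @ r))"
    by (rule runs_eq[OF runs_Pop]) (auto simp: main_def x)
  show "runs (Pop 0 ;; drop_top) (main (code (to_tree x) @ r)) (10 * enc_size x + 10) (main (code (to_tree (snd x)) @ r))"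
    by (rule runs_eq[OF runs_Seq[OF pop runs_drop]]) (auto simp: x enc_size_def)
qed

lemmas ptime_fst [ptime_intros] = ptime_comp[OF ptime_fst0]
lemmas ptime_snd [ptime_intros] = ptime_comp[OF ptime_snd0]

fun push_bits :: "bool list \<Rightarrow> prog" where
  "push_bits [] = Push 0 True ;; Pop 0"
| "push_bits (b # bs) = push_bits bs ;; Push 0 b"

lemma runs_push_bits: "runs (push_bits bs) (main r) (length bs + 2) (main (bs @ r))"
proof (induction bs)
  case Nil
  have "runs (Push 0 True ;; Pop 0) (main r) (1 + 1) (main r)"
    by (rule runs_Seq[OF runs_Push runs_eq[OF runs_Pop]]) (auto simp: main_def)
  then show ?case by (simp add: numeral_2_eq_2 One_nat_def)
next
  case (Cons b bs)
  have "runs (Push 0 b) (main (bs @ r)) 1 (main (b # bs @ r))"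
    by (rule runs_eq[OF runs_Push]) (auto simp: main_def)
  from runs_Seq[OF Cons this] show ?case by (simp add: One_nat_def)
qed

lemma ptime_const [ptime_intros]: "ptime (\<lambda>x. c)"
proof (rule ptime_I)
  show "poly_bounded (\<lambda>n. 10 * n + 3 + (length (code (to_tree c)) + 2))" by (intro poly_bounded_intros)
  fix x :: 'a and r
  show "runs (drop_top ;; push_bits (code (to_tree c))) (main (code (to_tree x) @ r)) (10 * enc_size x + 3 + (length (code (to_tree c)) + 2)) (main (code (to_tree c) @ r))"
    unfolding enc_size_def by (rule runs_Seq[OF runs_drop runs_push_bits])
qed

lemma ptime_if [ptime_intros]:
  assumes "ptime c" "ptime f" "ptime g"
  shows "ptime (\<lambda>x. if c x then f x else g x)"
proof -
  obtain P d where f': "computes P d f"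
    using assms(2) unfolding ptime_def by blast
  note f = computes_runs[OF f'] and sf = computes_enc_size[OF f']
  obtain Q e where g': "computes Q e g"
    using assms(3) unfolding ptime_def by blast
  note g = computes_runs[OF g'] and sg = computes_enc_size[OF g']
  obtain R u where c': "computes R u c"
    using assms(1) unfolding ptime_def by blast
  note c = computes_runs[OF c'] and sc = computes_enc_size[OF c']
  show ?thesis
  proof (rule ptime_I)
    show "poly_bounded (\<lambda>n. (26 * n + 5) + ((n + 2) ^ u + ((n + 2) ^ d + (n + 2) ^ e + 5)))"
      by (intro poly_bounded_intros)
    fix x r
    let ?B = "Branch 0 (Pop 0 ;; Pop 0 ;; Pop 0 ;; P) (Pop 0 ;; Q)"
    have "runs ?B (main (code (to_tree (c x)) @ code (to_tree x) @ r)) ((enc_size x + 2) ^ d + (enc_size x + 2) ^ e + 5)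
        (main (code (to_tree (if c x then f x else g x)) @ r))"
      using runs_mono[OF runs_Branch_true[OF f[of x r]]] runs_mono[OF runs_Branch_false[OF g[of x r]]]
      by (cases "c x") auto
    from runs_Seq[OF runs_dup runs_Seq[OF c this]]
    show "runs (dup ;; R ;; ?B) (main (code (to_tree x) @ r))
       ((26 * enc_size x + 5) + ((enc_size x + 2) ^ u + ((enc_size x + 2) ^ d + (enc_size x + 2) ^ e + 5))) (main (code (to_tree (if c x then f x else g x)) @ r))"
      unfolding enc_size_def .
  qed
qed

lemma ptime_eq0: "ptime (\<lambda>x::'a::enc \<times> 'a. fst x = snd x)"
proof (rule ptime_I)
  show "poly_bounded (\<lambda>n. 1 + (19 * n + 20))" by (intro poly_bounded_intros)
  fix x :: "'a \<times> 'a" and r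
  obtain a b where x: "x = (a, b)" by fastforce
  have pop: "runs (Pop 0) (main (code (to_tree x) @ r)) 1 (main (code (to_tree a) @ code (to_tree b) @ r))"
    by (rule runs_eq[OF runs_Pop]) (auto simp: main_def x)
  show "runs (Pop 0 ;; equal_top) (main (code (to_tree x) @ r)) (1 + (19 * enc_size x + 20)) (main (code (to_tree (fst x = snd x)) @ r))"
    by (rule runs_eq[OF runs_Seq[OF pop runs_equal]]) (auto simp: x enc_size_def)
qed

lemma ptime_eq [ptime_intros]: "ptime f \<Longrightarrow> ptime g \<Longrightarrow> ptime (\<lambda>x. f x = g x)"
  using ptime_comp[OF ptime_eq0 ptime_pair[of f g]] by simp

text \<open>All iterates need a size bound, not only the result: polynomially many rounds of a
  polynomial-time function can otherwise produce exponential sizes.\<close>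

lemma ptime_while:
  fixes c :: "'b::enc \<Rightarrow> bool" and f :: "'b \<Rightarrow> 'b" and s :: "'a::enc \<Rightarrow> 'b"
  assumes "ptime c" "ptime f" "ptime s" "poly_bounded p"
    and it: "\<And>x. \<exists>n \<le> p (enc_size x). (\<forall>i<n. c ((f ^^ i) (s x))) \<and> \<not> c ((f ^^ n) (s x)) \<and> g x = (f ^^ n) (s x) \<and>
      (\<forall>i\<le>n. enc_size ((f ^^ i) (s x)) \<le> p (enc_size x))"
  shows "ptime g"
proof -
  obtain P d where f': "computes P d f"
    using assms(2) unfolding ptime_def by blast
  note f = computes_runs[OF f'] and sf = computes_enc_size[OF f']
  obtain Q e where s': "computes Q e s"
    using assms(3) unfolding ptime_def by blast
  note s = computes_runs[OF s'] and ss = computes_enc_size[OF s']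
  obtain R u where c': "computes R u c"
    using assms(1) unfolding ptime_def by blast
  note c = computes_runs[OF c'] and sc = computes_enc_size[OF c']
  \<comment> \<open>Stack 3 carries the loop flag. It is popped before \<open>R\<close> and
    \<open>P\<close> run, because these are specified only on stores whose other stacks are empty,
    and it is set again only if the condition held.\<close>
  define B where "B = Pop 3 ;; dup ;; R ;; Branch 0 (Pop 0 ;; Pop 0 ;; Pop 0 ;; P ;; Push 3 True) (Pop 0 ;; Push 0 True ;; Pop 0)"
  define flag where "flag m = (main m)(3 := [True])" for m
  define K where "K n = 1 + ((26 * n + 5) + ((n + 2) ^ u + ((n + 2) ^ d + 6)))" for n :: nat
  have pop: "runs (Pop 0) (main (b # m)) 1 (main m)" for b m
    by (rule runs_eq[OF runs_Pop]) (auto simp: main_def)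
  have unflag: "runs (Pop 3) (flag m) 1 (main m)" for m
    by (rule runs_eq[OF runs_Pop]) (auto simp: main_def flag_def)
  have setflag: "runs (Push 3 True) (main m) 1 (flag m)" for m
    by (rule runs_eq[OF runs_Push]) (auto simp: main_def flag_def)
  have body1: "runs B (flag (code (to_tree y) @ r)) (K (enc_size y)) (flag (code (to_tree (f y)) @ r))" if "c y" for y r
  proof -
    have "runs R (main (code (to_tree y) @ code (to_tree y) @ r)) ((enc_size y + 2) ^ u) (main (code (to_tree True) @ code (to_tree y) @ r))"
      using c[of y "code (to_tree y) @ r"] that by simp
    from runs_Seq[OF unflag runs_Seq[OF runs_dup runs_Seq[OF this runs_Branch_true[OF runs_Seq[OF f setflag]]]]]
    show ?thesis
      unfolding B_def K_def enc_size_def by (rule runs_mono) simp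
  qed
  have skip: "runs (Push 0 True ;; Pop 0) (main m) (1 + 1) (main m)" for m
    by (rule runs_Seq[OF runs_Push runs_eq[OF runs_Pop]]) (auto simp: main_def)
  have body2: "runs B (flag (code (to_tree y) @ r)) (K (enc_size y)) (main (code (to_tree y) @ r))" if "\<not> c y" for y r
  proof -
    have "runs R (main (code (to_tree y) @ code (to_tree y) @ r)) ((enc_size y + 2) ^ u) (main (code (to_tree False) @ code (to_tree y) @ r))"
      using c[of y "code (to_tree y) @ r"] that by simp
    from runs_Seq[OF unflag runs_Seq[OF runs_dup runs_Seq[OF this runs_Branch_false[OF skip]]]]
    show ?thesis
      unfolding B_def K_def enc_size_def by (rule runs_mono) simp
  qed
  have K_mono: "K m \<le> K n" if "m \<le> n" for m n
    unfolding K_def using that by (intro add_mono mult_mono power_mono) auto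
  have loop: "runs (While 3 B) (flag (code (to_tree y) @ r)) (n * (K S + 2) + K S + 3) (main (code (to_tree ((f ^^ n) y)) @ r))"
    if "\<forall>i<n. c ((f ^^ i) y)" "\<not> c ((f ^^ n) y)" "\<forall>i\<le>n. enc_size ((f ^^ i) y) \<le> S" for n y r S
    using that
  proof (induction n arbitrary: y)
    case 0
    have "runs (While 3 B) (main (code (to_tree y) @ r)) 1 (main (code (to_tree y) @ r))"
      by (rule runs_WhileEnd) (auto simp: main_def)
    from runs_WhileStep[OF _ _ body2 this] show ?case
      by (rule runs_eq) (use 0 K_mono[of "enc_size y" S] in \<open>auto simp: flag_def\<close>)
  next
    case (Suc n)
    have "\<forall>i<n. c ((f ^^ i) (f y))" "\<not> c ((f ^^ n) (f y))" "\<forall>i\<le>n. enc_size ((f ^^ i) (f y)) \<le> S"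
      using Suc.prems(1)[rule_format, of "Suc _"] Suc.prems(2) Suc.prems(3)[rule_format, of "Suc _"]
      by (auto simp: funpow_swap1)
    then have *: "runs (While 3 B) (flag (code (to_tree (f y)) @ r)) (n * (K S + 2) + K S + 3) (main (code (to_tree ((f ^^ n) (f y))) @ r))"
      by (rule Suc.IH)
    have "c y" "enc_size y \<le> S" using Suc.prems(1,3) by (auto dest: spec[of _ 0])
    then show ?case
      by (intro runs_eq[OF runs_WhileStep[OF _ _ body1 *]]) (use K_mono[of "enc_size y" S] in \<open>auto simp: flag_def funpow_swap1\<close>)
  qed
  show ?thesis
  proof (rule ptime_I)
    show "poly_bounded (\<lambda>n. (n + 2) ^ e + (1 + (p n * (K (p n) + 2) + K (p n) + 3)))"
      unfolding K_def by (intro poly_bounded_intros assms(4))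
    fix x r
    obtain n where n: "n \<le> p (enc_size x)" "\<forall>i<n. c ((f ^^ i) (s x))" "\<not> c ((f ^^ n) (s x))" "g x = (f ^^ n) (s x)"
      "\<forall>i\<le>n. enc_size ((f ^^ i) (s x)) \<le> p (enc_size x)"
      using it[of x] by blast
    from runs_Seq[OF s runs_Seq[OF setflag loop[OF n(2,3,5)]]]
    show "runs (Q ;; Push 3 True ;; While 3 B) (main (code (to_tree x) @ r))
        ((enc_size x + 2) ^ e + (1 + (p (enc_size x) * (K (p (enc_size x)) + 2) + K (p (enc_size x)) + 3))) (main (code (to_tree (g x)) @ r))"
      unfolding n(4) by (rule runs_mono) (intro add_mono mult_le_mono order_refl n(1))
  qed
qed

lemma ptime_enc_size: "ptime f \<Longrightarrow> \<exists>p. poly_bounded p \<and> (\<forall>x. enc_size (f x) \<le> p (enc_size x)) \<and> mono p"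
proof -
  assume "ptime f"
  then obtain d where "\<forall>x. enc_size (f x) \<le> (enc_size x + 2) ^ (d + 1)"
    using computes_enc_size unfolding ptime_def by blast
  then show ?thesis
    by (intro exI[of _ "\<lambda>n. (n + 2) ^ (d + 1)"]) (auto intro!: poly_bounded_intros monoI power_mono simp del: add_2_eq_Suc' power_Suc)
qed

lemma ptime_comp2: "ptime (\<lambda>z. f (fst z) (snd z)) \<Longrightarrow> ptime g \<Longrightarrow> ptime h \<Longrightarrow> ptime (\<lambda>x. f (g x) (h x))"
  using ptime_comp[OF _ ptime_pair[of g h], of "\<lambda>z. f (fst z) (snd z)"] by simp

lemma ptime_comp3:
  "ptime (\<lambda>z. f (fst z) (fst (snd z)) (snd (snd z))) \<Longrightarrow> ptime g \<Longrightarrow> ptime h \<Longrightarrow> ptime k \<Longrightarrow> ptime (\<lambda>x. f (g x) (h x) (k x))"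
  using ptime_comp[OF _ ptime_pair[OF _ ptime_pair[of h k], of g], of "\<lambda>z. f (fst z) (fst (snd z)) (snd (snd z))"] by simp

lemma ptime_conj [ptime_intros]:
  assumes "ptime P" "ptime Q"
  shows "ptime (\<lambda>x. P x \<and> Q x)"
proof -
  have "(\<lambda>x. P x \<and> Q x) = (\<lambda>x. if P x then Q x else False)" by auto
  then show ?thesis using ptime_if[OF assms ptime_const[of False]] by (simp only:)
qed

lemma ptime_not [ptime_intros]:
  assumes "ptime P"
  shows "ptime (\<lambda>x. \<not> P x)"
proof -
  have "(\<lambda>x. \<not> P x) = (\<lambda>x. if P x then False else True)" by auto
  then show ?thesis using ptime_if[OF assms ptime_const[of False] ptime_const[of True]] by (simp only:)
qed

lemma ptime_disj [ptime_intros]: "ptime P \<Longrightarrow> ptime Q \<Longrightarrow> ptime (\<lambda>x. P x \<or> Q x)"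
  using ptime_not[OF ptime_conj[OF ptime_not[of P] ptime_not[of Q]]] by simp

lemma ptime_Cons [ptime_intros]: "ptime f \<Longrightarrow> ptime g \<Longrightarrow> ptime (\<lambda>x. f x # g x)"
  by (rule ptime_comp2[of "(#)"], rule ptime_cast) auto

lemma ptime_tl0: "ptime tl"
proof (rule ptime_I)
  show "poly_bounded (\<lambda>n. 10 * n + 10)" by (intro poly_bounded_intros)
  fix xs :: "'a list" and r
  let ?P = "Branch 0 (Pop 0 ;; drop_top) (Push 0 True ;; Pop 0)"
  show "runs ?P (main (code (to_tree xs) @ r)) (10 * enc_size xs + 10) (main (code (to_tree (tl xs)) @ r))"
  proof (cases xs)
    case Nil
    have "runs (Push 0 True ;; Pop 0) (main (False # r)) (1 + 1) (main (False # r))"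
      by (rule runs_Seq[OF runs_Push runs_eq[OF runs_Pop]]) (auto simp: main_def)
    from runs_mono[OF runs_BranchFalse[OF _ _ this, of 0 "Pop 0 ;; drop_top"], of "10 * enc_size xs + 10"] show ?thesis
      using Nil by simp
  next
    case (Cons y ys)
    have "runs (Pop 0 ;; drop_top) (main (code (to_tree xs) @ r)) (1 + (10 * length (code (to_tree y)) + 3)) (main (code (to_tree ys) @ r))"
      unfolding Cons using runs_Seq[OF runs_Pop_main runs_drop[of "to_tree y" "code (to_tree ys) @ r"], of True] by simp
    from runs_mono[OF runs_BranchTrue[OF _ _ this, of 0 "code (to_tree y) @ code (to_tree ys) @ r"], of "10 * enc_size xs + 10"] show ?thesis
      using Cons by (simp add: enc_size_def)
  qed
qed

text \<open>The value of \<open>hd []\<close> is unknown but fixed, hence its code can be built into the program.\<close>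

lemma ptime_hd0: "ptime (hd :: 'a::enc list \<Rightarrow> 'a)"
proof (rule ptime_I)
  let ?c = "code (to_tree (hd [] :: 'a))"
  show "poly_bounded (\<lambda>n. 23 * n + 20 + length ?c)" by (intro poly_bounded_intros)
  fix xs :: "'a list" and r
  let ?P = "Branch 0 (Pop 0 ;; swap ;; drop_top) (Pop 0 ;; push_bits ?c)"
  show "runs ?P (main (code (to_tree xs) @ r)) (23 * enc_size xs + 20 + length ?c) (main (code (to_tree (hd xs)) @ r))"
  proof (cases xs)
    case Nil
    from runs_mono[OF runs_Branch_false[OF runs_push_bits[of ?c r]], of "23 * enc_size xs + 20 + length ?c" "Pop 0 ;; swap ;; drop_top"]
    show ?thesis using Nil by simp
  next
    case (Cons y ys)
    have "runs (Pop 0 ;; swap ;; drop_top) (main (code (to_tree xs) @ r))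
        (1 + ((13 * (length (code (to_tree y)) + length (code (to_tree ys))) + 6) + (10 * length (code (to_tree ys)) + 3))) (main (code (to_tree y) @ r))"
      unfolding Cons using runs_Seq[OF runs_Pop_main runs_Seq[OF runs_swap[of "to_tree y" "to_tree ys" r] runs_drop], of True] by simp
    from runs_mono[OF runs_BranchTrue[OF _ _ this, of 0 "code (to_tree y) @ code (to_tree ys) @ r"], of "23 * enc_size xs + 20 + length ?c"] show ?thesis
      using Cons by (simp add: enc_size_def)
  qed
qed

lemmas ptime_tl [ptime_intros] = ptime_comp[OF ptime_tl0]
lemmas ptime_hd [ptime_intros] = ptime_comp[OF ptime_hd0]

lemma ptime_Suc [ptime_intros]: "ptime f \<Longrightarrow> ptime (\<lambda>x. Suc (f x))"
proof -
  \<comment> \<open>The tree of \<open>Suc n\<close> is that of the pair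
    \<open>((), n)\<close>.\<close>
  have "ptime (\<lambda>z::unit \<times> nat. Suc (snd z))" by (rule ptime_cast) simp
  then show "ptime f \<Longrightarrow> ptime (\<lambda>x. Suc (f x))"
    using ptime_comp[OF _ ptime_pair[OF ptime_const[of "()"], of f], of "\<lambda>z. Suc (snd z)"] by simp
qed

text \<open>A number and the list of that many units have the same tree. Hence loops bounded by a
  number become folds over a list, and arithmetic becomes arithmetic of lengths.\<close>

lemma to_tree_replicate_unit: "to_tree (replicate n ()) = to_tree n"
  by (induction n) auto

lemma ptime_replicate_unit [ptime_intros]: "ptime f \<Longrightarrow> ptime (\<lambda>x. replicate (f x) ())"
  by (rule ptime_comp[of "\<lambda>n. replicate n ()"], rule ptime_cast) (auto simp: to_tree_replicate_unit)

section \<open>List functions as bounded folds\<close>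

lemma enc_size_append: "Suc (enc_size (xs @ ys)) = enc_size xs + enc_size ys"
  by (induction xs) auto

lemma enc_size_rev [simp]: "enc_size (rev xs) = enc_size xs"
proof (induction xs)
  case (Cons x xs)
  then show ?case using enc_size_append[of "rev xs" "[x]"] by simp
qed auto

lemma enc_size_take_le: "enc_size (take i xs) \<le> enc_size xs"
  using enc_size_append[of "take i xs" "drop i xs"] enc_size_pos[of "drop i xs"] by simp

lemma enc_size_drop_le: "enc_size (drop i xs) \<le> enc_size xs"
  using enc_size_append[of "take i xs" "drop i xs"] enc_size_pos[of "take i xs"] by simp

lemma enc_size_elem: "x \<in> set xs \<Longrightarrow> enc_size x < enc_size xs"
  by (induction xs) auto

lemma length_less_enc_size: "length xs < enc_size xs"
  by (induction xs) auto

lemma enc_size_list_bound: "(\<And>x. x \<in> set xs \<Longrightarrow> enc_size x \<le> B) \<Longrightarrow> enc_size xs \<le> length xs * (B + 1) + 1"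
proof (induction xs)
  case (Cons x xs)
  then have "enc_size xs \<le> length xs * (B + 1) + 1" "enc_size x \<le> B" by auto
  then show ?case by simp
qed auto

lemma enc_size_concat: "enc_size (concat xss) \<le> enc_size xss"
proof (induction xss)
  case (Cons xs xss)
  then show ?case using enc_size_append[of xs "concat xss"] by simp
qed auto

text \<open>The environment \<open>e\<close> travels in the loop state, since the body of a loop
  sees nothing else. The size hypothesis ranges over the prefixes \<open>take i (g e)\<close>
  because these give the intermediate accumulators.\<close>

lemma ptime_fold:
  fixes f :: "'e::enc \<Rightarrow> 'y::enc \<Rightarrow> 'a::enc \<Rightarrow> 'a"
  assumes f: "ptime (\<lambda>z. f (fst z) (fst (snd z)) (snd (snd z)))" and g: "ptime g" and h: "ptime h"
    and p: "poly_bounded p" "\<And>e i. enc_size (fold (f e) (take i (g e)) (h e)) \<le> p (enc_size e)"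
  shows "ptime (\<lambda>e. fold (f e) (g e) (h e))"
proof -
  define F where "F z = (fst z, (tl (fst (snd z)), f (fst z) (hd (fst (snd z))) (snd (snd z))))"
    for z :: "'e \<times> 'y list \<times> 'a"
  have F: "ptime F"
    unfolding F_def by (intro ptime_intros ptime_comp3[OF f])
  have it: "(F ^^ i) (e, ys, a) = (e, drop i ys, fold (f e) (take i ys) a)" if "i \<le> length ys" for i e ys a
    using that
  proof (induction i)
    case (Suc i)
    then have "(F ^^ Suc i) (e, ys, a) = F (e, drop i ys, fold (f e) (take i ys) a)" by simp
    also have "F (e, drop i ys, b) = (e, drop (Suc i) ys, f e (ys ! i) b)" for b
      using Suc.prems by (simp add: F_def hd_drop_conv_nth tl_drop drop_Suc)
    finally show ?case
      using Suc.prems by (simp add: take_Suc_conv_app_nth)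
  qed auto
  obtain q where q: "poly_bounded q" "\<And>x. enc_size (g x) \<le> q (enc_size x)"
    using ptime_enc_size[OF g] by blast
  have "ptime (\<lambda>e. (e, ([] :: 'y list), fold (f e) (g e) (h e)))"
  proof (rule ptime_while[where c = "\<lambda>z. fst (snd z) \<noteq> []" and f = F and s = "\<lambda>e. (e, g e, h e)" and p = "\<lambda>n. n + q n + p n + 2"])
    show "ptime (\<lambda>z::'e \<times> 'y list \<times> 'a. fst (snd z) \<noteq> [])" by (intro ptime_intros)
    show "ptime (\<lambda>e. (e, g e, h e))" by (intro ptime_intros g h)
    show "poly_bounded (\<lambda>n. n + q n + p n + 2)" by (intro poly_bounded_intros p q)
    fix e
    let ?n = "length (g e)"
    have "?n \<le> enc_size e + q (enc_size e) + p (enc_size e) + 2"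
      using length_less_enc_size[of "g e"] q(2)[of e] by linarith
    moreover have "enc_size ((F ^^ i) (e, g e, h e)) \<le> enc_size e + q (enc_size e) + p (enc_size e) + 2" if "i \<le> ?n" for i
      using it[OF that, of e "h e"] p(2)[where e = e and i = i] enc_size_drop_le[of i "g e"] q(2)[of e] by simp
    ultimately show "\<exists>n\<le>enc_size e + q (enc_size e) + p (enc_size e) + 2. (\<forall>i<n. fst (snd ((F ^^ i) (e, g e, h e))) \<noteq> []) \<and>
        \<not> fst (snd ((F ^^ n) (e, g e, h e))) \<noteq> [] \<and> (e, [], fold (f e) (g e) (h e)) = (F ^^ n) (e, g e, h e) \<and>
        (\<forall>i\<le>n. enc_size ((F ^^ i) (e, g e, h e)) \<le> enc_size e + q (enc_size e) + p (enc_size e) + 2)"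
      by (intro exI[of _ ?n]) (auto simp: it)
  qed (rule F)
  from ptime_snd[OF ptime_snd[OF this]] show ?thesis by simp
qed

lemma ptime_rev [ptime_intros]:
  assumes "ptime g"
  shows "ptime (\<lambda>e. rev (g e))"
proof -
  obtain q where q: "poly_bounded q" "\<And>x. enc_size (g x) \<le> q (enc_size x)"
    using ptime_enc_size[OF assms] by blast
  have "ptime (\<lambda>e. fold (\<lambda>y a. y # a) (g e) [])"
  proof (rule ptime_fold[OF _ assms _ q(1)])
    fix e i
    have "enc_size (rev (take i (g e))) \<le> q (enc_size e)"
      using enc_size_take_le[of i "g e"] q(2)[of e] by (simp add: order_trans)
    then show "enc_size (fold (\<lambda>y a. y # a) (take i (g e)) []) \<le> q (enc_size e)"
      by (simp add: fold_Cons_rev)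
  qed (intro ptime_intros)+
  then show ?thesis by (simp add: fold_Cons_rev)
qed

lemma fold_map_Cons: "fold (\<lambda>y a. f y # a) ys zs = rev (map f ys) @ zs"
  by (induction ys arbitrary: zs) auto

lemma ptime_map [ptime_intros]:
  assumes f: "ptime (\<lambda>z. f (fst z) (snd z))" and g: "ptime g"
  shows "ptime (\<lambda>e. map (f e) (g e))"
proof -
  obtain q where q: "poly_bounded q" "\<And>x. enc_size (g x) \<le> q (enc_size x)"
    using ptime_enc_size[OF g] by blast
  obtain p where p: "poly_bounded p" "\<And>x. enc_size (f (fst x) (snd x)) \<le> p (enc_size x)" "mono p"
    using ptime_enc_size[OF f] by blast
  \<comment> \<open>There are at most \<open>q n\<close> results. An element paired with
    \<open>e\<close> has size at most \<open>n + q n\<close>, so by monotonicity of \<open>p\<close>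
    each result has size at most \<open>p (n + q n)\<close>; the added ones are the list nodes and
    the end of the list.\<close>
  let ?b = "\<lambda>n. q n * (p (n + q n) + 1) + 1"
  have "ptime (\<lambda>e. fold (\<lambda>y a. f e y # a) (g e) [])"
  proof (rule ptime_fold[where p = ?b])
    show "poly_bounded ?b"
      by (intro poly_bounded_intros q poly_bounded_comp[OF p(1)])
    fix e i
    have "enc_size (map (f e) (take i (g e))) \<le> length (map (f e) (take i (g e))) * (p (enc_size e + q (enc_size e)) + 1) + 1"
    proof (rule enc_size_list_bound)
      fix x assume "x \<in> set (map (f e) (take i (g e)))"
      then obtain y where y: "y \<in> set (g e)" "x = f e y" by (auto dest: in_set_takeD)
      have "enc_size x \<le> p (enc_size (e, y))" using p(2)[of "(e, y)"] y by simp
      also have "\<dots> \<le> p (enc_size e + q (enc_size e))"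
        using enc_size_elem[OF y(1)] q(2)[of e] by (intro monoD[OF p(3)]) simp
      finally show "enc_size x \<le> p (enc_size e + q (enc_size e))" .
    qed
    also have "\<dots> \<le> ?b (enc_size e)"
      using length_less_enc_size[of "g e"] q(2)[of e] by (intro add_mono mult_le_mono order_refl) auto
    finally show "enc_size (fold (\<lambda>y a. f e y # a) (take i (g e)) []) \<le> ?b (enc_size e)"
      by (simp add: fold_map_Cons)
  qed (intro ptime_intros g ptime_comp2[OF f])+
  from ptime_rev[OF this] show ?thesis by (simp add: fold_map_Cons)
qed

lemma ptime_append [ptime_intros]:
  assumes "ptime f" "ptime g"
  shows "ptime (\<lambda>e. f e @ g e)"
proof -
  obtain q where q: "poly_bounded q" "\<And>x. enc_size (f x) \<le> q (enc_size x)"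
    using ptime_enc_size[OF assms(1)] by blast
  obtain p where p: "poly_bounded p" "\<And>x. enc_size (g x) \<le> p (enc_size x)"
    using ptime_enc_size[OF assms(2)] by blast
  have "ptime (\<lambda>e. fold (\<lambda>y a. y # a) (rev (f e)) (g e))"
  proof (rule ptime_fold[OF _ ptime_rev[OF assms(1)] assms(2), where p = "\<lambda>n. q n + p n"])
    fix e i
    have "enc_size (rev (take i (rev (f e))) @ g e) \<le> q (enc_size e) + p (enc_size e)"
      using enc_size_append[of "rev (take i (rev (f e)))" "g e"] enc_size_take_le[of i "rev (f e)"] q(2)[of e] p(2)[of e] by simp
    then show "enc_size (fold (\<lambda>y a. y # a) (take i (rev (f e))) (g e)) \<le> q (enc_size e) + p (enc_size e)"
      by (simp add: fold_map_Cons[of "\<lambda>x. x", simplified])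
  qed (intro ptime_intros poly_bounded_intros p q)+
  then show ?thesis by (simp add: fold_map_Cons[of "\<lambda>x. x", simplified])
qed

lemma fold_concat: "fold (\<lambda>y a. a @ y) ys zs = zs @ concat ys"
  by (induction ys arbitrary: zs) auto

lemma ptime_concat [ptime_intros]:
  assumes "ptime g"
  shows "ptime (\<lambda>e. concat (g e))"
proof -
  obtain q where q: "poly_bounded q" "\<And>x. enc_size (g x) \<le> q (enc_size x)"
    using ptime_enc_size[OF assms] by blast
  have "ptime (\<lambda>e. fold (\<lambda>y a. a @ y) (g e) [])"
  proof (rule ptime_fold[OF _ assms _ q(1)])
    fix e i
    show "enc_size (fold (\<lambda>y a. a @ y) (take i (g e)) []) \<le> q (enc_size e)"
      using enc_size_concat[of "take i (g e)"] enc_size_take_le[of i "g e"] q(2)[of e] by (simp add: fold_concat)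
  qed (intro ptime_intros)+
  then show ?thesis by (simp add: fold_concat)
qed

lemma ptime_length [ptime_intros]: "ptime g \<Longrightarrow> ptime (\<lambda>e. length (g e))"
proof -
  assume g: "ptime g"
  have "ptime (length :: unit list \<Rightarrow> nat)"
  proof (rule ptime_cast)
    show "to_tree (length xs) = to_tree xs" for xs :: "unit list" by (induction xs) auto
  qed
  from ptime_comp[OF this ptime_map[OF ptime_const[of "()"] g]] show ?thesis by simp
qed

lemma fold_tl: "fold (\<lambda>y a. tl a) ys zs = drop (length ys) zs"
  by (induction ys arbitrary: zs) (auto simp: drop_Suc)

lemma ptime_drop [ptime_intros]:
  assumes "ptime n" "ptime g"
  shows "ptime (\<lambda>e. drop (n e) (g e))"
proof -
  obtain q where q: "poly_bounded q" "\<And>x. enc_size (g x) \<le> q (enc_size x)"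
    using ptime_enc_size[OF assms(2)] by blast
  have "ptime (\<lambda>e. fold (\<lambda>y a. tl a) (replicate (n e) ()) (g e))"
  proof (rule ptime_fold[OF _ ptime_replicate_unit[OF assms(1)] assms(2) q(1)])
    fix e i
    show "enc_size (fold (\<lambda>y a. tl a) (take i (replicate (n e) ())) (g e)) \<le> q (enc_size e)"
      using enc_size_drop_le[of "min i (n e)" "g e"] q(2)[of e] by (simp add: fold_tl min.commute del: fold_replicate)
  qed (intro ptime_intros)+
  then show ?thesis by (simp add: fold_tl del: fold_replicate)
qed

text \<open>The length of the list built so far serves as the counter, so none has to be carried
  separately.\<close>

lemma fold_length_Cons: "fold (\<lambda>y a. length a # a) ys [] = rev [0..<length ys]"
  by (induction ys rule: rev_induct) auto

lemma ptime_upt [ptime_intros]: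
  assumes "ptime n"
  shows "ptime (\<lambda>e. [0..<n e])"
proof -
  obtain q where q: "poly_bounded q" "\<And>x. enc_size (n x) \<le> q (enc_size x)"
    using ptime_enc_size[OF assms] by blast
  let ?b = "\<lambda>n. q n * (q n + 1) + 1"
  have "ptime (\<lambda>e. fold (\<lambda>y a. length a # a) (replicate (n e) ()) [])"
  proof (rule ptime_fold[OF _ ptime_replicate_unit[OF assms], where p = ?b])
    fix e i
    have "enc_size [0..<min i (n e)] \<le> length [0..<min i (n e)] * (q (enc_size e) + 1) + 1"
    proof (rule enc_size_list_bound)
      fix x assume "x \<in> set [0..<min i (n e)]"
      then have "x < n e" by simp
      then show "enc_size x \<le> q (enc_size e)" using q(2)[of e] by simp
    qed
    also have "\<dots> \<le> ?b (enc_size e)"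
      using q(2)[of e] by (intro add_mono mult_le_mono order_refl) auto
    finally show "enc_size (fold (\<lambda>y a. length a # a) (take i (replicate (n e) ())) []) \<le> ?b (enc_size e)"
      by (simp add: fold_length_Cons min.commute del: fold_replicate)
  qed (intro ptime_intros poly_bounded_intros q)+
  from ptime_rev[OF this] show ?thesis by (simp add: fold_length_Cons del: fold_replicate)
qed

lemma ptime_filter [ptime_intros]:
  assumes "ptime (\<lambda>z. P (fst z) (snd z))" "ptime g"
  shows "ptime (\<lambda>e. filter (P e) (g e))"
proof -
  have "ptime (\<lambda>e. concat (map (\<lambda>y. if P e y then [y] else []) (g e)))"
    by (intro ptime_intros assms)
  moreover have "concat (map (\<lambda>y. if p y then [y] else []) ys) = filter p ys" for p :: "'b \<Rightarrow> bool" and ys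
    by (induction ys) auto
  ultimately show ?thesis by simp
qed

lemma ptime_Bex [ptime_intros]: "ptime (\<lambda>z. P (fst z) (snd z)) \<Longrightarrow> ptime g \<Longrightarrow> ptime (\<lambda>e. \<exists>y \<in> set (g e). P e y)"
  using ptime_not[OF ptime_eq[OF ptime_filter[of P g] ptime_const[of "[]"]]] by (simp add: filter_empty_conv)

lemma ptime_Ball [ptime_intros]: "ptime (\<lambda>z. P (fst z) (snd z)) \<Longrightarrow> ptime g \<Longrightarrow> ptime (\<lambda>e. \<forall>y \<in> set (g e). P e y)"
  using ptime_not[OF ptime_Bex[OF ptime_not[of "\<lambda>z. P (fst z) (snd z)"], of g]] by simp

lemma ptime_member [ptime_intros]: "ptime f \<Longrightarrow> ptime g \<Longrightarrow> ptime (\<lambda>e. f e \<in> set (g e))"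
proof -
  assume "ptime f" "ptime g"
  then have "ptime (\<lambda>e. \<exists>y \<in> set (g e). y = f e)"
    by (intro ptime_intros ptime_comp[OF \<open>ptime f\<close>])
  then show ?thesis by (simp add: Bex_def cong: conj_cong)
qed

section \<open>Arithmetic on unary numbers\<close>

lemma ptime_less [ptime_intros]: "ptime f \<Longrightarrow> ptime g \<Longrightarrow> ptime (\<lambda>e. f e < (g e :: nat))"
proof -
  assume "ptime f" "ptime g"
  then have "ptime (\<lambda>e. drop (f e) (replicate (g e) ()) \<noteq> [])"
    by (intro ptime_intros)
  then show ?thesis by (simp add: not_le)
qed

lemma ptime_add [ptime_intros]: "ptime f \<Longrightarrow> ptime g \<Longrightarrow> ptime (\<lambda>e. f e + (g e :: nat))"
proof -
  assume "ptime f" "ptime g"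
  then have "ptime (\<lambda>e. length (replicate (f e) () @ replicate (g e) ()))"
    by (intro ptime_intros)
  then show ?thesis by simp
qed

lemma ptime_diff [ptime_intros]: "ptime f \<Longrightarrow> ptime g \<Longrightarrow> ptime (\<lambda>e. f e - (g e :: nat))"
proof -
  assume "ptime f" "ptime g"
  then have "ptime (\<lambda>e. length (drop (g e) (replicate (f e) ())))"
    by (intro ptime_intros)
  then show ?thesis by simp
qed

lemma ptime_mult [ptime_intros]: "ptime f \<Longrightarrow> ptime g \<Longrightarrow> ptime (\<lambda>e. f e * (g e :: nat))"
proof -
  assume "ptime f" "ptime g"
  then have "ptime (\<lambda>e. length (concat (map (\<lambda>y. replicate (g e) ()) (replicate (f e) ()))))"
    by (intro ptime_intros ptime_comp[OF \<open>ptime g\<close>])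
  moreover have "length (concat (map (\<lambda>y. replicate n ()) (replicate m ()))) = m * n" for m n
    by (induction m) auto
  ultimately show ?thesis by simp
qed

lemma ptime_poly [ptime_intros]: "ptime f \<Longrightarrow> ptime (\<lambda>e. poly p (f e :: nat))"
proof (induction p)
  case 0
  then show ?case using ptime_const[of 0] by simp
next
  case (pCons a p)
  then have "ptime (\<lambda>e. a + f e * poly p (f e))" by (intro ptime_intros)
  then show ?case by simp
qed

section \<open>Reading the input and writing the output\<close>

definition read_input :: prog where
  "read_input = move_stack 0 1 ;; Push 0 False ;;
     While 1 (Branch 1 (Pop 1 ;; Push 0 False ;; Push 0 False ;; Push 0 True ;; Push 0 True)
       (Pop 1 ;; Push 0 False ;; Push 0 True))"

text \<open>A list is built by prepending, so the input has first been reversed onto stack 1. The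
  last push of each round is the list node, the pushes before it form the code of the bit.\<close>

lemma runs_read_loop:
  "runs (While 1 (Branch 1 (Pop 1 ;; Push 0 False ;; Push 0 False ;; Push 0 True ;; Push 0 True)
       (Pop 1 ;; Push 0 False ;; Push 0 True))) ((main (code (to_tree ys)))(1 := xs)) (9 * length xs + 1)
     (main (code (to_tree (rev xs @ ys))))"
proof (induction xs arbitrary: ys)
  case Nil
  show ?case by (rule runs_eq[OF runs_WhileEnd]) (auto simp: main_def)
next
  case (Cons b xs)
  let ?\<sigma> = "(main (code (to_tree ys)))(1 := b # xs)"
  let ?\<sigma>' = "(main (code (to_tree (b # ys))))(1 := xs)"
  have "runs (Pop 1 ;; Push 0 False ;; Push 0 False ;; Push 0 True ;; Push 0 True) ?\<sigma> (1 + (1 + (1 + (1 + 1)))) ?\<sigma>'" if b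
    by (rule runs_Seq[OF runs_Pop runs_Seq[OF runs_Push runs_Seq[OF runs_Push runs_Seq[OF runs_Push runs_eq[OF runs_Push]]]]])
      (use that in \<open>auto simp: main_def\<close>)
  moreover have "runs (Pop 1 ;; Push 0 False ;; Push 0 True) ?\<sigma> (1 + (1 + 1)) ?\<sigma>'" if "\<not> b"
    by (rule runs_Seq[OF runs_Pop runs_Seq[OF runs_Push runs_eq[OF runs_Push]]]) (use that in \<open>auto simp: main_def\<close>)
  ultimately have "runs (if b then Pop 1 ;; Push 0 False ;; Push 0 False ;; Push 0 True ;; Push 0 True
      else Pop 1 ;; Push 0 False ;; Push 0 True) ?\<sigma> 5 ?\<sigma>'"
    using runs_mono[of "Pop 1 ;; Push 0 False ;; Push 0 True" ?\<sigma> "1 + (1 + 1)" ?\<sigma>' 5]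
      runs_mono[of "Pop 1 ;; Push 0 False ;; Push 0 False ;; Push 0 True ;; Push 0 True" ?\<sigma> "1 + (1 + (1 + (1 + 1)))" ?\<sigma>' 5]
    by (cases b) simp_all
  from runs_WhileStep[OF _ _ runs_Branch[OF _ _ this] Cons[of "b # ys"]] show ?case
    by (rule runs_eq) auto
qed

lemma runs_read_input: "runs read_input (main xs) (15 * length xs + 3) (main (code (to_tree xs)))"
proof -
  have 1: "runs (move_stack 0 1) (main xs) (6 * length xs + 1) ((main [])(1 := rev xs))"
    by (rule runs_eq[OF runs_move_stack]) (auto simp: main_def)
  have 2: "runs (Push 0 False) ((main [])(1 := rev xs)) 1 ((main (code (to_tree ([] :: bool list))))(1 := rev xs))"
    by (rule runs_eq[OF runs_Push]) (auto simp: main_def)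
  show ?thesis
    unfolding read_input_def by (rule runs_eq[OF runs_Seq[OF 1 runs_Seq[OF 2 runs_read_loop]]]) auto
qed

definition write_output :: prog where
  "write_output = While 0 (Branch 0
     (Pop 0 ;; Branch 0 (Pop 0 ;; Pop 0 ;; Pop 0 ;; Emit True) (Pop 0 ;; Emit False)) (Pop 0))"

lemma runs_write_output:
  "runs write_output ((main (code (to_tree ys)))(4 := out)) (11 * length ys + 5) ((main [])(4 := out @ ys))"
proof (induction ys arbitrary: out)
  case Nil
  have "runs (Pop 0) ((main (code (to_tree ([] :: bool list))))(4 := out)) 1 ((main [])(4 := out))"
    by (rule runs_eq[OF runs_Pop]) (auto simp: main_def)
  then have body: "runs (Branch 0
     (Pop 0 ;; Branch 0 (Pop 0 ;; Pop 0 ;; Pop 0 ;; Emit True) (Pop 0 ;; Emit False)) (Pop 0))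
     ((main (code (to_tree ([] :: bool list))))(4 := out)) (1 + 1) ((main [])(4 := out))"
    by (rule runs_BranchFalse[rotated 2]) auto
  have "runs write_output ((main [])(4 := out)) 1 ((main [])(4 := out))"
    unfolding write_output_def by (rule runs_WhileEnd) auto
  from runs_WhileStep[OF _ _ body this[unfolded write_output_def]] show ?case
    unfolding write_output_def by (rule runs_eq) auto
next
  case (Cons b ys)
  let ?I = "Branch 0 (Pop 0 ;; Pop 0 ;; Pop 0 ;; Emit True) (Pop 0 ;; Emit False)"
  let ?\<sigma> = "(main (code (to_tree (b # ys))))(4 := out)"
  let ?\<sigma>1 = "(main (code (to_tree b) @ code (to_tree ys)))(4 := out)"
  let ?\<sigma>2 = "(main (code (to_tree ys)))(4 := out @ [b])"
  have pop: "runs (Pop 0) ?\<sigma> 1 ?\<sigma>1"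
    by (rule runs_eq[OF runs_Pop]) (auto simp: main_def)
  have "runs ?I ?\<sigma>1 6 ?\<sigma>2"
  proof (cases b)
    case True
    have "runs (Pop 0 ;; Pop 0 ;; Pop 0 ;; Emit True) ?\<sigma>1 (1 + (1 + (1 + 1))) ?\<sigma>2"
      by (rule runs_Seq[OF runs_Pop runs_Seq[OF runs_Pop runs_Seq[OF runs_Pop runs_eq[OF runs_Emit]]]]) (use True in \<open>auto simp: main_def\<close>)
    from runs_mono[OF runs_BranchTrue[OF _ _ this, of 0 "[False, False] @ code (to_tree ys)"], of 6] True show ?thesis by simp
  next
    case False
    have "runs (Pop 0 ;; Emit False) ?\<sigma>1 (1 + 1) ?\<sigma>2"
      by (rule runs_Seq[OF runs_Pop runs_eq[OF runs_Emit]]) (use False in \<open>auto simp: main_def\<close>)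
    from runs_mono[OF runs_BranchFalse[OF _ _ this, of 0], of 6] False show ?thesis by simp
  qed
  from runs_Seq[OF pop this]
  have "runs (Branch 0 (Pop 0 ;; ?I) (Pop 0)) ?\<sigma> (1 + 6 + 2) ?\<sigma>2"
    by (rule runs_BranchTrue[rotated 2]) auto
  from runs_WhileStep[OF _ _ this Cons[unfolded write_output_def]] show ?case
    unfolding write_output_def by (rule runs_eq) auto
qed

lemma poly_bounded_poly:
  assumes "poly_bounded g"
  shows "\<exists>p :: nat poly. \<forall>n. g n \<le> poly p n"
proof -
  obtain d where "\<forall>n. g n \<le> (n + 2) ^ d"
    using assms unfolding poly_bounded_def by blast
  then have "\<forall>n. g n \<le> poly ([:2, 1:] ^ d) n"
    by (simp add: add.commute)
  then show ?thesis by blast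
qed

lemma ptime_poly_time:
  assumes "ptime (f :: bool list \<Rightarrow> bool list)"
  shows "poly_time f"
proof -
  obtain P d where P: "computes P d f"
    using assms unfolding ptime_def by blast
  let ?P = "read_input ;; P ;; write_output"
  \<comment> \<open>A bit list of length \<open>n\<close> has size at most \<open>4 * n + 1\<close>:
    at most three for a bit and one for its list node. The outer factor and summand are the two
    machine steps per instruction and the entry and exit steps.\<close>
  let ?B = "\<lambda>n. 2 * ((15 * n + 3) + ((4 * n + 1 + 2) ^ d + (11 * (4 * n + 1 + 2) ^ (d + 1) + 5))) + 2"
  have "poly_bounded ?B"
    by (intro poly_bounded_intros)
  then obtain p :: "nat poly" where p: "\<forall>n. ?B n \<le> poly p n"
    using poly_bounded_poly by blast
  have "tm_halts_with (code_tm (compile ?P 0)) x (poly p (length x)) (f x)" for x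
  proof -
    have "enc_size x \<le> length x * (3 + 1) + 1"
      by (rule enc_size_list_bound) (rule enc_size_bool)
    then have sx: "enc_size x + 2 \<le> 4 * length x + 1 + 2" by simp
    have "runs P (main (code (to_tree x))) ((enc_size x + 2) ^ d) (main (code (to_tree (f x))))"
      using computes_runs[OF P, of x "[]"] by simp
    moreover have "(main m)(4 := []) = main m" for m
      by (auto simp: main_def)
    then have "runs write_output (main (code (to_tree (f x)))) (11 * length (f x) + 5) ((main [])(4 := f x))"
      using runs_write_output[of "f x" "[]"] by simp
    ultimately have "runs ?P (main x) ((15 * length x + 3) + ((enc_size x + 2) ^ d + (11 * length (f x) + 5))) ((main [])(4 := f x))"
      by (intro runs_Seq[OF runs_read_input] runs_Seq)
    then obtain t where t: "t \<le> (15 * length x + 3) + ((enc_size x + 2) ^ d + (11 * length (f x) + 5))" "exec ?P (main x) t ((main [])(4 := f x))"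
      unfolding runs_def by blast
    have fx: "length (f x) \<le> (4 * length x + 1 + 2) ^ (d + 1)"
      using length_less_enc_size[of "f x"] computes_enc_size[OF P, of x] power_mono[OF sx, of "d + 1"] by linarith
    note t(1)
    also have "(15 * length x + 3) + ((enc_size x + 2) ^ d + (11 * length (f x) + 5)) \<le>
        (15 * length x + 3) + ((4 * length x + 1 + 2) ^ d + (11 * (4 * length x + 1 + 2) ^ (d + 1) + 5))"
      by (intro add_mono mult_le_mono order_refl fx power_mono sx) auto
    finally have "2 * t + 2 \<le> ?B (length x)" by (intro add_mono mult_le_mono order_refl)
    then have "2 * t + 2 \<le> poly p (length x)" using p order_trans by blast
    from exec_tm_halts_with[OF _ this, of ?P x "(main [])(4 := f x)"] t(2) show ?thesis
      by (simp add: main_def)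
  qed
  then show ?thesis
    unfolding poly_time_def using wf_code_tm by blast
qed

section \<open>Duplicates, positions in lists and binary numerals\<close>

definition dedup :: "'a list \<Rightarrow> 'a list" where
  "dedup ys = fold (\<lambda>y a. if y \<in> set a then a else y # a) ys []"

lemma set_dedup [simp]: "set (dedup ys) = set ys"
proof -
  have "set (fold (\<lambda>y a. if y \<in> set a then a else y # a) ys a) = set ys \<union> set a" for a
    by (induction ys arbitrary: a) auto
  then show ?thesis by (simp add: dedup_def)
qed

lemma distinct_dedup [simp]: "distinct (dedup ys)"
proof -
  have "distinct a \<Longrightarrow> distinct (fold (\<lambda>y a. if y \<in> set a then a else y # a) ys a)" for a
    by (induction ys arbitrary: a) auto
  then show ?thesis by (simp add: dedup_def)
qed

lemma ptime_dedup [ptime_intros]: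
  assumes "ptime g"
  shows "ptime (\<lambda>e. dedup (g e))"
proof -
  obtain q where q: "poly_bounded q" "\<And>x. enc_size (g x) \<le> q (enc_size x)"
    using ptime_enc_size[OF assms] by blast
  have enc_size: "enc_size (fold (\<lambda>y a. if y \<in> set a then a else y # a) ys a) \<le> enc_size ys + enc_size a" for ys a :: "'b list"
  proof (induction ys arbitrary: a)
    case (Cons y ys)
    show ?case using Cons[of a] Cons[of "y # a"] by auto
  qed simp
  show ?thesis
    unfolding dedup_def
  proof (rule ptime_fold[OF _ assms, where p = "\<lambda>n. q n + 1"])
    show "enc_size (fold (\<lambda>y a. if y \<in> set a then a else y # a) (take i (g e)) []) \<le> q (enc_size e) + 1" for e i
      using enc_size[of "take i (g e)" "[]"] enc_size_take_le[of i "g e"] q(2)[of e] by simp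
  qed (intro ptime_intros poly_bounded_intros q)+
qed

text \<open>Composed of operations already in the class; for a \<open>v\<close> that does not occur
  the value is unspecified but fixed.\<close>

definition index :: "'a list \<Rightarrow> 'a \<Rightarrow> nat" where
  "index xs v = hd (filter (\<lambda>i. hd (drop i xs) = v) [0..<length xs])"

lemma index_correct:
  assumes "v \<in> set xs"
  shows "index xs v < length xs" "xs ! index xs v = v"
proof -
  let ?F = "filter (\<lambda>i. hd (drop i xs) = v) [0..<length xs]"
  obtain i where "i < length xs" "xs ! i = v" using assms by (auto simp: in_set_conv_nth)
  then have "i \<in> set ?F" by (simp add: hd_drop_conv_nth)
  then have "hd ?F \<in> set ?F" by (intro hd_in_set) (auto simp: filter_empty_conv)
  then have "index xs v \<in> set ?F" by (simp only: index_def)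
  then show "index xs v < length xs" "xs ! index xs v = v" by (auto simp: hd_drop_conv_nth)
qed

lemma index_inj: "inj_on (index xs) (set xs)"
  by (metis index_correct(2) inj_onI)

lemma index_nth: "distinct xs \<Longrightarrow> i < length xs \<Longrightarrow> index xs (xs ! i) = i"
  by (metis index_correct nth_eq_iff_index_eq nth_mem)

lemma ptime_index [ptime_intros]: "ptime f \<Longrightarrow> ptime g \<Longrightarrow> ptime (\<lambda>e. index (f e) (g e))"
  unfolding index_def by (intro ptime_intros ptime_comp[of f, OF _ ptime_fst0] ptime_comp[of g, OF _ ptime_fst0])

lemma div2_filter: "n div 2 = length (filter (\<lambda>i. i + i + 1 < n) [0..<n])"
proof -
  have "{i. i < length [0..<n] \<and> [0..<n] ! i + [0..<n] ! i + 1 < n} = {..<n div 2}"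
    by auto
  then show ?thesis by (simp only: length_filter_conv_card card_lessThan)
qed

lemma ptime_div2 [ptime_intros]: "ptime f \<Longrightarrow> ptime (\<lambda>e. f e div (2::nat))"
  unfolding div2_filter by (intro ptime_intros ptime_comp[of f, OF _ ptime_fst0])

lemma ptime_even [ptime_intros]: "ptime f \<Longrightarrow> ptime (\<lambda>e. even (f e :: nat))"
proof -
  assume "ptime f"
  then have "ptime (\<lambda>e. f e = f e div 2 + f e div 2)" by (intro ptime_intros)
  moreover have "even n \<longleftrightarrow> n = n div 2 + n div 2" for n :: nat by presburger
  ultimately show ?thesis by simp
qed

definition bits_step :: "nat \<times> bool list \<Rightarrow> nat \<times> bool list" where
  "bits_step z = (if fst z = 0 then z else (fst z div 2, snd z @ [odd (fst z)]))"

lemma ptime_bits_step [ptime_intros]: "ptime f \<Longrightarrow> ptime (\<lambda>e. bits_step (f e))"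
  unfolding bits_step_def by (intro ptime_intros)

text \<open>Every round on a positive number decreases it, so \<open>n\<close> rounds suffice, and
  surplus rounds change nothing. With unary numbers this is a polynomial number of rounds.\<close>

lemma fold_bits_step: "n \<le> length us \<Longrightarrow> fold (\<lambda>u. bits_step) us (n, bs) = (0, bs @ nat_bits n)"
proof (induction us arbitrary: n bs)
  case Nil
  then show ?case by (simp add: nat_bits.simps)
next
  case (Cons u us)
  show ?case
  proof (cases "n = 0")
    case True
    then show ?thesis using Cons.IH[of 0 bs] by (simp add: bits_step_def)
  next
    case False
    then show ?thesis
      using Cons.IH[of "n div 2" "bs @ [odd n]"] Cons.prems by (simp add: bits_step_def nat_bits.simps[of n])
  qed
qed

lemma bits_step_bounds:
  "fst (fold (\<lambda>u. bits_step) us z) \<le> fst z \<and> length (snd (fold (\<lambda>u. bits_step) us z)) \<le> length (snd z) + length us"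
proof (induction us arbitrary: z)
  case (Cons u us)
  have "fst (bits_step z) \<le> fst z" "length (snd (bits_step z)) \<le> Suc (length (snd z))"
    by (auto simp: bits_step_def)
  then show ?case using Cons[of "bits_step z"] by simp
qed simp

lemma ptime_nat_bits [ptime_intros]:
  assumes "ptime f"
  shows "ptime (\<lambda>e. nat_bits (f e))"
proof -
  obtain q where q: "poly_bounded q" "\<And>x. enc_size (f x) \<le> q (enc_size x)"
    using ptime_enc_size[OF assms] by blast
  let ?b = "\<lambda>n. 6 * q n + 4"
  have "ptime (\<lambda>e. fold (\<lambda>u z. bits_step z) (replicate (f e) ()) (f e, []))"
  proof (rule ptime_fold[OF _ ptime_replicate_unit[OF assms], where p = ?b])
    fix e i
    let ?z = "fold (\<lambda>u z. bits_step z) (take i (replicate (f e) ())) (f e, [])"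
    have "enc_size (snd ?z) \<le> length (snd ?z) * (3 + 1) + 1"
      by (rule enc_size_list_bound) (rule enc_size_bool)
    moreover have "fst ?z \<le> f e" "length (snd ?z) \<le> f e"
      using bits_step_bounds[of "take i (replicate (f e) ())" "(f e, [])"] by (auto simp del: fold_replicate)
    moreover have "enc_size ?z = Suc (enc_size (fst ?z) + enc_size (snd ?z))"
      by (metis prod.collapse enc_size_pair)
    ultimately show "enc_size ?z \<le> ?b (enc_size e)"
      using q(2)[of e] by (simp del: fold_replicate take_replicate)
  qed (intro ptime_intros poly_bounded_intros q assms)+
  from ptime_snd[OF this] show ?thesis
    by (simp add: fold_bits_step del: fold_replicate)
qed

lemma enc_list_concat: "enc_list f xs = concat (map (\<lambda>x. True # f x) xs) @ [False]"
  by (induction xs) auto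

lemma ptime_enc_list [ptime_intros]:
  "ptime (\<lambda>z. f (fst z) (snd z)) \<Longrightarrow> ptime g \<Longrightarrow> ptime (\<lambda>e. enc_list (f e) (g e))"
  unfolding enc_list_concat by (intro ptime_intros)

lemma ptime_enc_bits [ptime_intros]: "ptime g \<Longrightarrow> ptime (\<lambda>e. enc_bits (g e))"
  unfolding enc_bits_def by (intro ptime_intros)

lemma ptime_enc_nat [ptime_intros]: "ptime g \<Longrightarrow> ptime (\<lambda>e. enc_nat (g e))"
  unfolding enc_nat_def by (intro ptime_intros)

section \<open>Temporalisability as a reachability problem with single-use trips\<close>

definition trip_nodes :: "('v, 'e) pre_digraph \<Rightarrow> 'e list \<Rightarrow> 'v list" where
  "trip_nodes D T = map (tail D) T @ [head D (last T)]"

text \<open>Segments are given by positions and not by nodes, because a walk may visit a node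
  several times. \<open>U\<close> collects the trips used so far.\<close>

inductive reach :: "'v list list \<Rightarrow> 'v \<Rightarrow> nat set \<Rightarrow> 'v \<Rightarrow> bool" for TS s where
  reach_refl: "reach TS s {} s"
| reach_step: "reach TS s U u \<Longrightarrow> k < length TS \<Longrightarrow> k \<notin> U \<Longrightarrow> a < b \<Longrightarrow> b < length (TS ! k) \<Longrightarrow>
    TS ! k ! a = u \<Longrightarrow> reach TS s (insert k U) (TS ! k ! b)"

text \<open>A form of \<open>temporal_path\<close> that can be cut and glued: \<open>t0\<close> is a
  lower bound for the departure and \<open>t1\<close> an upper bound for the arrival, and the empty
  chain amounts to waiting.\<close>

fun timed_chain :: "'v \<Rightarrow> real \<Rightarrow> 'v temporal_edge list \<Rightarrow> 'v \<Rightarrow> real \<Rightarrow> bool" where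
  "timed_chain u t0 [] v t1 \<longleftrightarrow> u = v \<and> t0 \<le> t1"
| "timed_chain u t0 (f # fs) v t1 \<longleftrightarrow> te_tail f = u \<and> t0 \<le> te_start f \<and> timed_chain (te_head f) (te_arrival f) fs v t1"

lemma timed_chain_mono: "timed_chain u t0 fs v t1 \<Longrightarrow> t0' \<le> t0 \<Longrightarrow> timed_chain u t0' fs v t1"
  by (cases fs) auto

lemma timed_chain_append:
  "timed_chain u t0 (fs @ gs) v t1 \<longleftrightarrow> (\<exists>x s1. timed_chain u t0 fs x s1 \<and> timed_chain x s1 gs v t1)"
proof (induction fs arbitrary: u t0)
  case Nil
  then show ?case by (auto intro: timed_chain_mono)
qed auto

lemma temporal_path_Cons:
  "temporal_path G u (f # g # fs) v \<longleftrightarrow>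
     f \<in># tg_edges G \<and> te_tail f = u \<and> te_head f = te_tail g \<and> te_arrival f \<le> te_start g \<and> temporal_path G (te_head f) (g # fs) v"
  unfolding temporal_path_def by (auto simp: nth_Cons less_Suc_eq_0_disj split: nat.splits)

lemma temporal_path_timed_chain:
  "fs \<noteq> [] \<Longrightarrow> temporal_path G u fs v \<longleftrightarrow> set fs \<subseteq> set_mset (tg_edges G) \<and> (\<exists>t0 t1. timed_chain u t0 fs v t1)"
proof (induction fs arbitrary: u rule: induct_list012)
  case (2 f)
  then show ?case by (auto simp: temporal_path_def)
next
  case (3 f g fs)
  have "temporal_path G u (f # g # fs) v \<longleftrightarrow> f \<in># tg_edges G \<and> te_tail f = u \<and> te_head f = te_tail g \<and>
      te_arrival f \<le> te_start g \<and> set (g # fs) \<subseteq> set_mset (tg_edges G) \<and> (\<exists>t0 t1. timed_chain (te_head f) t0 (g # fs) v t1)"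
    using 3(2)[of "te_head f"] by (simp only: temporal_path_Cons) simp
  then show ?case by auto
qed simp

lemma cas_iff:
  assumes "T \<noteq> []"
  shows "pre_digraph.cas D u T v \<longleftrightarrow> u = tail D (hd T) \<and> v = head D (last T) \<and>
    (\<forall>i. Suc i < length T \<longrightarrow> head D (T ! i) = tail D (T ! Suc i))"
  using assms
proof (induction T arbitrary: u rule: induct_list012)
  case (3 e f T)
  have "(\<forall>i. Suc i < length (e # f # T) \<longrightarrow> head D ((e # f # T) ! i) = tail D ((e # f # T) ! Suc i)) \<longleftrightarrow>
      head D e = tail D f \<and> (\<forall>i. Suc i < length (f # T) \<longrightarrow> head D ((f # T) ! i) = tail D ((f # T) ! Suc i))"
    by (auto simp: nth_Cons less_Suc_eq_0_disj split: nat.splits)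
  then show ?case
    using 3(2)[of "head D e"] by (auto simp: pre_digraph.cas.simps)
qed (auto simp: pre_digraph.cas.simps)

lemma awalk_iff:
  assumes "wf_digraph D" "T \<noteq> []"
  shows "(\<exists>u v. pre_digraph.awalk D u T v) \<longleftrightarrow>
    set T \<subseteq> arcs D \<and> (\<forall>i. Suc i < length T \<longrightarrow> head D (T ! i) = tail D (T ! Suc i))"
proof -
  have "tail D (hd T) \<in> verts D" if "set T \<subseteq> arcs D"
    using that assms wf_digraph.tail_in_verts[of D "hd T"] by (cases T) auto
  then show ?thesis
    unfolding pre_digraph.awalk_def cas_iff[OF assms(2)] by blast
qed

context
  fixes D :: "('v, 'e) pre_digraph" and w :: "'e \<Rightarrow> real" and TT :: "'e list list"
  assumes net: "trip_network D w TT"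
begin

definition offset :: "'e list \<Rightarrow> nat \<Rightarrow> real" where
  "offset T i = (\<Sum>j<i. w (T ! j))"

definition trip_edge :: "'e list \<Rightarrow> real \<Rightarrow> nat \<Rightarrow> 'v temporal_edge" where
  "trip_edge T t0 i = (tail D (T ! i), head D (T ! i), t0 + offset T i, w (T ! i))"

lemma trip_temporal_edges_eq: "trip_temporal_edges D w T t0 = map (trip_edge T t0) [0..<length T]"
  by (simp add: trip_temporal_edges_def trip_edge_def offset_def)

lemma trip_props:
  assumes "T \<in> set TT"
  shows "T \<noteq> []" "Suc i < length T \<Longrightarrow> head D (T ! i) = tail D (T ! Suc i)" "i < length T \<Longrightarrow> w (T ! i) > 0"
proof -
  obtain u v where "T \<noteq> []" and walk: "pre_digraph.awalk D u T v"
    using net assms unfolding trip_network_def by blast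
  then show "T \<noteq> []" by blast
  have "pre_digraph.cas D u T v"
    using walk by (simp add: pre_digraph.awalk_def)
  from iffD1[OF cas_iff[OF \<open>T \<noteq> []\<close>] this]
  show "Suc i < length T \<Longrightarrow> head D (T ! i) = tail D (T ! Suc i)"
    by simp
  show "w (T ! i) > 0" if "i < length T"
  proof -
    have "T ! i \<in> arcs D"
      using walk that unfolding pre_digraph.awalk_def by (meson nth_mem subsetD)
    then show ?thesis using net unfolding trip_network_def by blast
  qed
qed

lemma trip_nodes_nth:
  assumes "T \<in> set TT" "i < length T"
  shows "trip_nodes D T ! i = tail D (T ! i)" "trip_nodes D T ! Suc i = head D (T ! i)"
proof -
  show "trip_nodes D T ! i = tail D (T ! i)"
    using assms by (simp add: trip_nodes_def nth_append)
  show "trip_nodes D T ! Suc i = head D (T ! i)"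
  proof (cases "Suc i < length T")
    case True
    then show ?thesis using trip_props(2)[OF assms(1) True] by (simp add: trip_nodes_def nth_append)
  next
    case False
    then have "i = length T - 1" using assms by linarith
    then show ?thesis using assms trip_props(1)[OF assms(1)] by (simp add: trip_nodes_def nth_append last_conv_nth)
  qed
qed

text \<open>Positive weights make the starting times strictly increasing along a trip, so the order
  of positions can be recovered from times even when the walk repeats nodes or arcs.\<close>

lemma offset_mono:
  assumes "T \<in> set TT" "i < j" "j \<le> length T"
  shows "offset T i < offset T j"
proof -
  have "offset T j = offset T i + (\<Sum>k=i..<j. w (T ! k))"
    unfolding offset_def lessThan_atLeast0 using assms by (subst sum.atLeastLessThan_concat) auto
  moreover have "(\<Sum>k=i..<j. w (T ! k)) > 0"
    using assms trip_props(3)[OF assms(1)] by (intro sum_pos) auto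
  ultimately show ?thesis by simp
qed

lemma segment_chain:
  assumes "T \<in> set TT" "a \<le> b" "b \<le> length T" "a < length T"
  shows "timed_chain (trip_nodes D T ! a) (t0 + offset T a) (map (trip_edge T t0) [a..<b]) (trip_nodes D T ! b) (t0 + offset T b)"
  using assms(2,3)
proof (induction b rule: dec_induct)
  case (step n)
  have "timed_chain (trip_nodes D T ! n) (t0 + offset T n) [trip_edge T t0 n] (trip_nodes D T ! Suc n) (t0 + offset T (Suc n))"
    using step trip_nodes_nth[OF assms(1), of n] by (simp add: trip_edge_def offset_def)
  then show ?case
    using step by (auto simp: timed_chain_append)
qed simp

lemma reach_chain:
  "reach (map (trip_nodes D) TT) s U v \<Longrightarrow>
    \<exists>\<tau> fs t1. timed_chain s 0 fs v t1 \<and> (\<forall>f \<in> set fs. \<exists>k \<in> U. k < length TT \<and> f \<in> set (trip_temporal_edges D w (TT ! k) (\<tau> k)))"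
proof (induction rule: reach.induct)
  case reach_refl
  show ?case by (rule exI[of _ "\<lambda>_. 0"], rule exI[of _ "[]"], rule exI[of _ 0]) simp
next
  case (reach_step U u k a b)
  then obtain \<tau> fs t1 where IH: "timed_chain s 0 fs u t1"
    "\<forall>f \<in> set fs. \<exists>k \<in> U. k < length TT \<and> f \<in> set (trip_temporal_edges D w (TT ! k) (\<tau> k))"
    by blast
  \<comment> \<open>Trip \<open>k\<close> is started so that its edge at position \<open>a\<close>
    departs exactly at the arrival time \<open>t1\<close>. As \<open>k \<notin> U\<close>,
    redefining \<open>\<tau> k\<close> leaves the earlier segments untouched.\<close>
  let ?T = "TT ! k" and ?t = "t1 - offset (TT ! k) a"
  have k: "k < length TT" "?T \<in> set TT" using reach_step by auto
  have ab: "a < b" "b \<le> length ?T" "trip_nodes D ?T ! a = u"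
    using reach_step k by (auto simp: trip_nodes_def)
  have "timed_chain u t1 (map (trip_edge ?T ?t) [a..<b]) (trip_nodes D ?T ! b) (?t + offset ?T b)"
    using segment_chain[OF k(2), of a b ?t] ab by simp
  with IH(1) have "timed_chain s 0 (fs @ map (trip_edge ?T ?t) [a..<b]) (trip_nodes D ?T ! b) (?t + offset ?T b)"
    unfolding timed_chain_append by blast
  moreover have "\<forall>f \<in> set (fs @ map (trip_edge ?T ?t) [a..<b]). \<exists>k' \<in> insert k U. k' < length TT \<and>
      f \<in> set (trip_temporal_edges D w (TT ! k') ((\<tau>(k := ?t)) k'))"
  proof
    fix f assume "f \<in> set (fs @ map (trip_edge ?T ?t) [a..<b])"
    then consider "f \<in> set fs" | "f \<in> trip_edge ?T ?t ` {a..<b}" by auto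
    then show "\<exists>k' \<in> insert k U. k' < length TT \<and> f \<in> set (trip_temporal_edges D w (TT ! k') ((\<tau>(k := ?t)) k'))"
    proof cases
      case 1
      then obtain k' where "k' \<in> U" "k' < length TT" "f \<in> set (trip_temporal_edges D w (TT ! k') (\<tau> k'))"
        using IH(2) by blast
      moreover have "k' \<noteq> k" using \<open>k' \<in> U\<close> reach_step by blast
      ultimately show ?thesis by (intro bexI[of _ k']) auto
    next
      case 2
      then show ?thesis using ab k by (auto simp: trip_temporal_edges_eq)
    qed
  qed
  ultimately have "timed_chain s 0 (fs @ map (trip_edge ?T ?t) [a..<b]) (map (trip_nodes D) TT ! k ! b) (?t + offset ?T b) \<and>
      (\<forall>f \<in> set (fs @ map (trip_edge ?T ?t) [a..<b]). \<exists>k' \<in> insert k U. k' < length TT \<and>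
      f \<in> set (trip_temporal_edges D w (TT ! k') ((\<tau>(k := ?t)) k')))"
    using k by simp
  then show ?case by blast
qed

lemma set_induced_edges:
  "set_mset (tg_edges (induced_temporal_graph D w TT \<tau>)) =
     {trip_edge (TT ! k) (\<tau> k) i | k i. k < length TT \<and> i < length (TT ! k)}"
proof (rule set_eqI)
  fix f
  have "f \<in># tg_edges (induced_temporal_graph D w TT \<tau>) \<longleftrightarrow>
      (\<exists>k \<in> {..<length TT}. f \<in> set (trip_temporal_edges D w (TT ! k) (\<tau> k)))"
    by (simp add: induced_temporal_graph_def set_mset_sum)
  also have "\<dots> \<longleftrightarrow> (\<exists>k \<in> {..<length TT}. \<exists>i \<in> {0..<length (TT ! k)}. f = trip_edge (TT ! k) (\<tau> k) i)"
    unfolding trip_temporal_edges_eq set_map set_upt image_iff ..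
  finally show "f \<in># tg_edges (induced_temporal_graph D w TT \<tau>) \<longleftrightarrow>
      f \<in> {trip_edge (TT ! k) (\<tau> k) i | k i. k < length TT \<and> i < length (TT ! k)}"
    unfolding mem_Collect_eq Bex_def lessThan_iff atLeastLessThan_iff by blast
qed

lemma timed_chain_start_mono:
  "timed_chain u t0 (f # fs) v t1 \<Longrightarrow> \<forall>g \<in> set (f # fs). te_start g \<le> te_arrival g \<Longrightarrow> g \<in> set (f # fs) \<Longrightarrow>
    te_start f \<le> te_start g"
proof (induction fs arbitrary: f u t0)
  case (Cons h fs)
  show ?case
  proof (cases "g = f")
    case False
    then have "te_start h \<le> te_start g"
      using Cons.IH[of "te_head f" "te_arrival f" h] Cons.prems by auto
    moreover have "te_start f \<le> te_start h" using Cons.prems by auto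
    ultimately show ?thesis by linarith
  qed simp
qed simp

text \<open>Between two uses of the same trip one can stay on that trip, so every trip is used in one segment.\<close>

lemma chain_reach:
  assumes "timed_chain s t0 fs v t1"
    "\<forall>f \<in> set fs. \<exists>k i. k < length TT \<and> i < length (TT ! k) \<and> f = trip_edge (TT ! k) (\<tau> k) i"
  shows "\<exists>U. reach (map (trip_nodes D) TT) s U v \<and>
    (\<forall>k \<in> U. k < length TT \<and> (\<exists>f \<in> set fs. \<exists>i < length (TT ! k). f = trip_edge (TT ! k) (\<tau> k) i))"
  using assms
proof (induction fs arbitrary: v t1 rule: length_induct)
  case (1 fs)
  show ?case
  proof (cases "fs = []")
    case True
    then have "v = s" using 1(2) by simp
    then show ?thesis using reach.reach_refl[of "map (trip_nodes D) TT" s] by (intro exI[of _ "{}"]) simp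
  next
    case False
    obtain k i where last: "k < length TT" "i < length (TT ! k)" "last fs = trip_edge (TT ! k) (\<tau> k) i"
      using 1(3) False last_in_set by blast
    let ?T = "TT ! k"
    let ?P = "\<lambda>f. \<exists>i < length ?T. f = trip_edge ?T (\<tau> k) i"
    have "\<exists>f \<in> set fs. ?P f" using last False last_in_set by metis
    \<comment> \<open>The chain is cut at the first edge that the trip of the last edge could have
      induced. Different trips may induce equal quadruples, so \<open>?P\<close> compares values;
      this keeps \<open>k\<close> out of the set that the induction hypothesis yields for
      \<open>fs1\<close>.\<close>
    then obtain fs1 f fs2 where split: "fs = fs1 @ f # fs2" "?P f" "\<forall>g \<in> set fs1. \<not> ?P g"
      using split_list_first_prop[of fs ?P] by blast
    then obtain i' where i': "i' < length ?T" "f = trip_edge ?T (\<tau> k) i'" by blast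
    have T: "?T \<in> set TT" using last by simp
    have "timed_chain s t0 (fs1 @ f # fs2) v t1" using 1(2) split by simp
    then obtain x s1 where x: "timed_chain s t0 fs1 x s1" "timed_chain x s1 (f # fs2) v t1"
      unfolding timed_chain_append by blast
    have lst: "last fs = last (f # fs2)" using split by simp
    have "te_start g \<le> te_arrival g" if "g \<in> set (f # fs2)" for g
    proof -
      have "g \<in> set fs" using that unfolding split(1) by auto
      from bspec[OF 1(3) this]
      obtain k i where *: "k < length TT" "i < length (TT ! k)" "g = trip_edge (TT ! k) (\<tau> k) i"
        by blast
      have "w (TT ! k ! i) > 0" using trip_props(3)[of "TT ! k" i] * by simp
      then show ?thesis using * by (simp add: trip_edge_def)
    qed
    \<comment> \<open>Both edges belong to trip \<open>k\<close>, so the order of their starting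
      times gives the order of their positions; the single segment from \<open>i'\<close> to
      \<open>Suc i\<close> then replaces everything in between.\<close>
    then have "te_start f \<le> te_start (last fs)"
      using timed_chain_start_mono[OF x(2)] lst last_in_set[of "f # fs2"] by (metis list.discI)
    then have "offset ?T i' \<le> offset ?T i" using i' last by (simp add: trip_edge_def)
    then have "i' \<le> i" using offset_mono[OF T, of i i'] i' by force
    have "v = te_head (last fs)"
    proof -
      have "timed_chain u t0 gs v t1 \<Longrightarrow> gs \<noteq> [] \<Longrightarrow> te_head (last gs) = v" for u t0 gs
        by (induction gs arbitrary: u t0) auto
      then show ?thesis using 1(2) False by blast
    qed
    then have v: "v = trip_nodes D ?T ! Suc i"
      using last trip_nodes_nth(2)[OF T, of i] by (simp add: trip_edge_def)
    have xn: "trip_nodes D ?T ! i' = x"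
      using x(2) i' trip_nodes_nth(1)[OF T, of i'] by (simp add: trip_edge_def)
    have "length fs1 < length fs" using split by simp
    then obtain U where U: "reach (map (trip_nodes D) TT) s U x"
      "\<forall>k \<in> U. k < length TT \<and> (\<exists>f \<in> set fs1. \<exists>i < length (TT ! k). f = trip_edge (TT ! k) (\<tau> k) i)"
      using 1(1)[rule_format, of fs1 x s1] x(1) bspec[OF 1(3)] split(1) by (metis Un_iff set_append)
    have "k \<notin> U" using U(2) split(3) by blast
    then have "reach (map (trip_nodes D) TT) s (insert k U) (map (trip_nodes D) TT ! k ! Suc i)"
      using last \<open>i' \<le> i\<close> xn by (intro reach_step[OF U(1), where a = i']) (auto simp: trip_nodes_def)
    then have "reach (map (trip_nodes D) TT) s (insert k U) v" using v last by simp
    moreover have "\<forall>k' \<in> insert k U. k' < length TT \<and> (\<exists>f \<in> set fs. \<exists>i < length (TT ! k'). f = trip_edge (TT ! k') (\<tau> k') i)"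
    proof
      fix k' assume k': "k' \<in> insert k U"
      have sub: "set fs1 \<subseteq> set fs" "f \<in> set fs" using split(1) by auto
      show "k' < length TT \<and> (\<exists>f \<in> set fs. \<exists>i < length (TT ! k'). f = trip_edge (TT ! k') (\<tau> k') i)"
      proof (cases "k' = k")
        case True
        then show ?thesis using last(1) sub(2) split(2) by blast
      next
        case False
        then show ?thesis using k' bspec[OF U(2), of k'] sub(1) by blast
      qed
    qed
    ultimately show ?thesis by blast
  qed
qed

lemma temporalisable_iff_reach:
  assumes "s \<in> verts D" "t \<in> verts D"
  shows "temporalisable D w TT s t \<longleftrightarrow> (\<exists>U. reach (map (trip_nodes D) TT) s U t)"
proof
  assume "temporalisable D w TT s t"
  then obtain \<tau> where \<tau>: "s = t \<or> (\<exists>fs. temporal_path (induced_temporal_graph D w TT \<tau>) s fs t)"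
    unfolding temporalisable_def temporally_reachable_def by blast
  show "\<exists>U. reach (map (trip_nodes D) TT) s U t"
  proof (cases "s = t")
    case True
    then show ?thesis using reach.reach_refl by metis
  next
    case False
    then obtain fs where fs: "temporal_path (induced_temporal_graph D w TT \<tau>) s fs t" using \<tau> by blast
    then have "fs \<noteq> []" by (simp add: temporal_path_def)
    from iffD1[OF temporal_path_timed_chain[OF this] fs]
    obtain t0 t1 where "timed_chain s t0 fs t t1" "set fs \<subseteq> set_mset (tg_edges (induced_temporal_graph D w TT \<tau>))"
      by blast
    then show ?thesis using chain_reach[of s t0 fs t t1 \<tau>] unfolding set_induced_edges by blast
  qed
next
  assume "\<exists>U. reach (map (trip_nodes D) TT) s U t"
  then obtain U where "reach (map (trip_nodes D) TT) s U t" by blast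
  from reach_chain[OF this] obtain \<tau> fs t1 where *: "timed_chain s 0 fs t t1"
    "\<forall>f \<in> set fs. \<exists>k \<in> U. k < length TT \<and> f \<in> set (trip_temporal_edges D w (TT ! k) (\<tau> k))"
    by blast
  have sub: "set fs \<subseteq> set_mset (tg_edges (induced_temporal_graph D w TT \<tau>))"
    using *(2) unfolding set_induced_edges by (fastforce simp: trip_temporal_edges_eq)
  have "s = t \<or> (\<exists>fs. temporal_path (induced_temporal_graph D w TT \<tau>) s fs t)"
  proof (cases "fs = []")
    case True
    then show ?thesis using *(1) by simp
  next
    case False
    have "temporal_path (induced_temporal_graph D w TT \<tau>) s fs t"
      by (rule iffD2[OF temporal_path_timed_chain[OF False]]) (use *(1) sub in blast)
    then show ?thesis by blast
  qed
  moreover have "tg_nodes (induced_temporal_graph D w TT \<tau>) = verts D"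
    by (simp add: induced_temporal_graph_def)
  ultimately show "temporalisable D w TT s t"
    using assms unfolding temporalisable_def temporally_reachable_def by auto
qed

end

section \<open>Trips as a set, and renaming of nodes\<close>

definition nthd :: "'a list \<Rightarrow> nat \<Rightarrow> 'a" where
  "nthd xs i = hd (drop i xs)"

lemma nthd_nth: "i < length xs \<Longrightarrow> nthd xs i = xs ! i"
  by (simp add: nthd_def hd_drop_conv_nth)

lemma ptime_nthd [ptime_intros]: "ptime f \<Longrightarrow> ptime g \<Longrightarrow> ptime (\<lambda>e. nthd (f e) (g e))"
  unfolding nthd_def by (intro ptime_intros)

fun hop :: "'v list \<Rightarrow> 'v \<Rightarrow> 'v \<Rightarrow> bool" where
  "hop [] u v \<longleftrightarrow> False"
| "hop (p # T) u v \<longleftrightarrow> u = p \<and> v \<in> set T \<or> hop T u v"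

lemma hop_iff: "hop T u v \<longleftrightarrow> (\<exists>a b. a < b \<and> b < length T \<and> T ! a = u \<and> T ! b = v)"
proof (induction T)
  case (Cons p T)
  show ?case
  proof
    assume "hop (p # T) u v"
    then consider "u = p" "v \<in> set T" | "hop T u v" by auto
    then show "\<exists>a b. a < b \<and> b < length (p # T) \<and> (p # T) ! a = u \<and> (p # T) ! b = v"
    proof cases
      case 1
      then obtain b where "b < length T" "T ! b = v" by (auto simp: in_set_conv_nth)
      then show ?thesis using 1 by (intro exI[of _ 0] exI[of _ "Suc b"]) auto
    next
      case 2
      then obtain a b where "a < b" "b < length T" "T ! a = u" "T ! b = v" using Cons by blast
      then show ?thesis by (intro exI[of _ "Suc a"] exI[of _ "Suc b"]) auto
    qed
  next
    assume "\<exists>a b. a < b \<and> b < length (p # T) \<and> (p # T) ! a = u \<and> (p # T) ! b = v"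
    then obtain a b where ab: "a < b" "b < length (p # T)" "(p # T) ! a = u" "(p # T) ! b = v" by blast
    then obtain b' where b': "b = Suc b'" by (cases b) auto
    show "hop (p # T) u v"
    proof (cases a)
      case 0
      then show ?thesis using ab b' by auto
    next
      case (Suc a')
      then have "hop T u v" unfolding Cons using ab b' by (intro exI[of _ a'] exI[of _ b']) auto
      then show ?thesis by simp
    qed
  qed
qed simp

text \<open>When the trips are pairwise different, a trip may be identified with its node sequence.
  The analysis of the gadgets can then speak of trips by their shape and forget their positions in a
  list.\<close>

inductive set_reach :: "'v list set \<Rightarrow> 'v \<Rightarrow> 'v list set \<Rightarrow> 'v \<Rightarrow> bool" for S s where
  set_reach_refl: "set_reach S s {} s"
| set_reach_step: "set_reach S s U u \<Longrightarrow> T \<in> S \<Longrightarrow> T \<notin> U \<Longrightarrow> hop T u v \<Longrightarrow> set_reach S s (insert T U) v"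

lemma reach_set_reach:
  assumes "distinct TS"
  shows "(\<exists>U. reach TS s U v) \<longleftrightarrow> (\<exists>U. set_reach (set TS) s U v)"
proof
  have "set_reach (set TS) s ((!) TS ` U) v \<and> U \<subseteq> {..<length TS}" if "reach TS s U v" for U
    using that
  proof (induction rule: reach.induct)
    case reach_refl
    then show ?case by (simp add: set_reach_refl)
  next
    case (reach_step U u k a b)
    have "TS ! k \<notin> (!) TS ` U"
    proof
      assume "TS ! k \<in> (!) TS ` U"
      then obtain k' where "k' \<in> U" "TS ! k' = TS ! k" by auto
      moreover have "k' < length TS" using \<open>k' \<in> U\<close> reach_step.IH by auto
      ultimately have "k' = k" using nth_eq_iff_index_eq[OF assms, of k' k] reach_step.hyps by simp
      then show False using \<open>k' \<in> U\<close> reach_step.hyps by simp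
    qed
    moreover have "hop (TS ! k) u (TS ! k ! b)"
      unfolding hop_iff using reach_step.hyps by blast
    ultimately show ?case
      using set_reach_step[of "set TS" s "(!) TS ` U" u "TS ! k"] reach_step.hyps reach_step.IH by auto
  qed
  then show "\<exists>U. reach TS s U v \<Longrightarrow> \<exists>U. set_reach (set TS) s U v" by blast
  have "reach TS s {k. k < length TS \<and> TS ! k \<in> U} v" if "set_reach (set TS) s U v" for U
    using that
  proof (induction rule: set_reach.induct)
    case set_reach_refl
    then show ?case by (simp add: reach.reach_refl)
  next
    case (set_reach_step U u T v)
    obtain k where k: "k < length TS" "TS ! k = T" using set_reach_step(2) by (auto simp: in_set_conv_nth)
    obtain a b where "a < b" "b < length T" "T ! a = u" "T ! b = v"
      using set_reach_step(4) unfolding hop_iff by blast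
    then have "reach TS s (insert k {k. k < length TS \<and> TS ! k \<in> U}) (TS ! k ! b)"
      using set_reach_step.hyps set_reach_step.IH k by (intro reach.reach_step) auto
    moreover have "insert k {k. k < length TS \<and> TS ! k \<in> U} = {k. k < length TS \<and> TS ! k \<in> insert T U}"
      using k nth_eq_iff_index_eq[OF assms] by auto
    ultimately show ?case using k \<open>T ! b = v\<close> by simp
  qed
  then show "\<exists>U. set_reach (set TS) s U v \<Longrightarrow> \<exists>U. reach TS s U v" by blast
qed

lemma reach_map:
  assumes "inj_on f V" "\<And>T. T \<in> set TS \<Longrightarrow> set T \<subseteq> V" "s \<in> V" "t \<in> V"
  shows "(\<exists>U. reach (map (map f) TS) (f s) U (f t)) \<longleftrightarrow> (\<exists>U. reach TS s U t)"
proof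
  have nth_V: "TS ! k ! a \<in> V" if "k < length TS" "a < length (TS ! k)" for k a
    using assms(2)[of "TS ! k"] that by (meson nth_mem subsetD)
  have "\<exists>v \<in> V. x = f v \<and> reach TS s U v" if "reach (map (map f) TS) (f s) U x" for U x
    using that
  proof (induction rule: reach.induct)
    case reach_refl
    then show ?case using assms(3) reach.reach_refl by metis
  next
    case (reach_step U u k a b)
    then obtain v where v: "v \<in> V" "u = f v" "reach TS s U v" by blast
    have k: "k < length TS" "a < b" "b < length (TS ! k)" using reach_step by auto
    then have "f (TS ! k ! a) = f v" using reach_step v by simp
    then have "TS ! k ! a = v" using assms(1) nth_V[of k a] v(1) k by (auto dest: inj_onD)
    then have "reach TS s (insert k U) (TS ! k ! b)" using reach.reach_step[OF v(3)] k reach_step by blast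
    then show ?case using k nth_V[of k b] by auto
  qed
  then show "\<exists>U. reach (map (map f) TS) (f s) U (f t) \<Longrightarrow> \<exists>U. reach TS s U t"
    using assms(1,4) by (metis inj_onD)
  have "reach (map (map f) TS) (f s) U (f v)" if "reach TS s U v" for U v
    using that
  proof (induction rule: reach.induct)
    case reach_refl
    then show ?case by (rule reach.reach_refl)
  next
    case (reach_step U u k a b)
    then show ?case using reach.reach_step[OF reach_step.IH, of k a b] by simp
  qed
  then show "\<exists>U. reach TS s U t \<Longrightarrow> \<exists>U. reach (map (map f) TS) (f s) U (f t)" by blast
qed

text \<open>Every trip gets its own arcs, named by the position of the trip and the position in the trip.\<close>

definition net_nodes :: "'v list list \<Rightarrow> 'v list" where
  "net_nodes TS = dedup (concat TS)"

definition arc_names :: "'v list list \<Rightarrow> (nat \<times> nat) list" where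
  "arc_names TS = dedup (concat (map (\<lambda>k. map (\<lambda>i. (k, i)) [0..<length (nthd TS k) - 1]) [0..<length TS]))"

definition net_arcs :: "'v list list \<Rightarrow> (nat \<times> nat) list" where
  "net_arcs TS = map (\<lambda>a. (index (net_nodes TS) (nthd (nthd TS (fst a)) (snd a)),
     index (net_nodes TS) (nthd (nthd TS (fst a)) (Suc (snd a))))) (arc_names TS)"

definition net_trips :: "'v list list \<Rightarrow> nat list list" where
  "net_trips TS = map (\<lambda>k. map (\<lambda>i. index (arc_names TS) (k, i)) [0..<length (nthd TS k) - 1]) [0..<length TS]"

definition net_instance :: "'v list list \<Rightarrow> 'v \<Rightarrow> 'v \<Rightarrow> rtt_instance" where
  "net_instance TS s t = \<lparr>inst_num_nodes = length (net_nodes TS), inst_arcs = map (\<lambda>a. (fst a, snd a, 1, 1)) (net_arcs TS),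
     inst_trips = net_trips TS, inst_source = index (net_nodes TS) s, inst_target = index (net_nodes TS) t\<rparr>"

lemma set_arc_names: "set (arc_names TS) = {(k, i). k < length TS \<and> i < length (TS ! k) - 1}"
  by (auto simp: arc_names_def nthd_nth)

text \<open>Numbering the nodes is an injective renaming, so \<open>reach_map\<close> carries
  reachability over. That every trip has at least two nodes puts each node on an arc and keeps trips
  nonempty.\<close>

lemma
  fixes TS :: "'v list list"
  assumes len: "\<And>T. T \<in> set TS \<Longrightarrow> 2 \<le> length T" and s: "s \<in> set (concat TS)" and t: "t \<in> set (concat TS)"
  shows valid_net_instance: "valid_instance (net_instance TS s t)"
    and temporalisable_net_instance: "temporalisable (inst_digraph (net_instance TS s t)) (inst_weight (net_instance TS s t))
      (inst_trips (net_instance TS s t)) (inst_source (net_instance TS s t)) (inst_target (net_instance TS s t)) \<longleftrightarrow>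
      (\<exists>U. reach TS s U t)"
proof -
  define I where "I = net_instance TS s t"
  define D where "D = inst_digraph I"
  define lab where "lab = index (net_nodes TS)"
  define A where "A = arc_names TS"
  have nodes: "set (net_nodes TS) = set (concat TS)" "distinct (net_nodes TS)"
    by (auto simp: net_nodes_def)
  have lab_less: "lab v < length (net_nodes TS)" if "v \<in> set (concat TS)" for v
    unfolding lab_def using that nodes by (intro index_correct) simp
  have nth_in: "TS ! k ! i \<in> set (concat TS)" if "k < length TS" "i < length (TS ! k)" for k i
    using that by (auto intro!: bexI[of _ "TS ! k"])
  have verts: "verts D = {..<length (net_nodes TS)}" and arcs: "arcs D = {..<length A}"
    by (auto simp: D_def I_def inst_digraph_def net_instance_def net_arcs_def A_def)
  have arc: "index A (k, i) < length A" "tail D (index A (k, i)) = lab (TS ! k ! i)" "head D (index A (k, i)) = lab (TS ! k ! Suc i)"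
    if "k < length TS" "Suc i < length (TS ! k)" for k i
  proof -
    have mem: "(k, i) \<in> set A" using that by (auto simp: A_def set_arc_names)
    note ix = index_correct[OF mem]
    show "index A (k, i) < length A" by (rule ix)
    have "inst_arcs I ! index A (k, i) = (lab (TS ! k ! i), lab (TS ! k ! Suc i), 1, 1)"
      using ix that by (simp add: I_def net_instance_def net_arcs_def A_def[symmetric] lab_def nthd_nth)
    then show "tail D (index A (k, i)) = lab (TS ! k ! i)" "head D (index A (k, i)) = lab (TS ! k ! Suc i)"
      by (simp_all add: D_def inst_digraph_def)
  qed
  have arc_cases: "\<exists>k i. k < length TS \<and> Suc i < length (TS ! k) \<and> e = index A (k, i)" if "e < length A" for e
  proof -
    obtain k i where ki: "A ! e = (k, i)" by fastforce
    then have "(k, i) \<in> set A" using that by (metis nth_mem)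
    moreover have "index A (A ! e) = e" using that by (intro index_nth) (auto simp: A_def arc_names_def)
    ultimately show ?thesis using ki by (intro exI[of _ k] exI[of _ i]) (auto simp: A_def set_arc_names)
  qed
  have trips: "inst_trips I = map (\<lambda>k. map (\<lambda>i. index A (k, i)) [0..<length (TS ! k) - 1]) [0..<length TS]"
    by (simp add: I_def net_instance_def net_trips_def A_def nthd_nth)
  have trip_mem: "map (\<lambda>i. index A (k, i)) [0..<length (TS ! k) - 1] \<in> set (inst_trips I)" if "k < length TS" for k
    using that by (auto simp: trips)
  have wf: "wf_digraph D"
  proof
    fix e assume "e \<in> arcs D"
    then have "e < length A" by (simp add: arcs)
    from arc_cases[OF this] obtain k i where ki: "k < length TS" "Suc i < length (TS ! k)" "e = index A (k, i)"
      by blast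
    show "tail D e \<in> verts D" "head D e \<in> verts D"
      using arc[OF ki(1,2)] ki lab_less[OF nth_in] by (auto simp: verts)
  qed
  have net: "trip_network D (inst_weight I) (inst_trips I)"
    unfolding trip_network_def
  proof (intro conjI ballI)
    show "fin_digraph D"
      using wf by (simp add: fin_digraph_def fin_digraph_axioms_def verts arcs)
    show "inst_weight I e > 0" if "e \<in> arcs D" for e
      using that by (simp add: arcs A_def inst_weight_def I_def net_instance_def net_arcs_def)
  next
    fix T assume "T \<in> set (inst_trips I)"
    then obtain k where k: "k < length TS" "T = map (\<lambda>i. index A (k, i)) [0..<length (TS ! k) - 1]"
      by (auto simp: trips)
    have ne: "T \<noteq> []" using k len[of "TS ! k"] by auto
    then show "T \<noteq> []" .
    have "set T \<subseteq> arcs D" using k arc(1)[of k] by (auto simp: arcs)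
    moreover have "head D (T ! i) = tail D (T ! Suc i)" if "Suc i < length T" for i
      using that k arc(2,3)[of k] by simp
    ultimately show "\<exists>u v. pre_digraph.awalk D u T v"
      unfolding awalk_iff[OF wf ne] by blast
  next
    fix v assume "v \<in> verts D"
    then have v: "v < length (net_nodes TS)" by (simp add: verts)
    then have "net_nodes TS ! v \<in> set (concat TS)" using nodes by (metis nth_mem)
    then obtain k j where kj: "k < length TS" "j < length (TS ! k)" "TS ! k ! j = net_nodes TS ! v"
      by (auto simp: in_set_conv_nth)
    have labv: "lab (TS ! k ! j) = v"
      unfolding kj(3) lab_def using v nodes by (intro index_nth)
    have "2 \<le> length (TS ! k)" using len kj by simp
    \<comment> \<open>The last node of a trip is not the tail of an arc of that trip occurrence; it
      is covered as the head of the arc before it.\<close>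
    define i where "i = (if Suc j < length (TS ! k) then j else j - 1)"
    have i: "Suc i < length (TS ! k)" "j = i \<or> j = Suc i"
      using kj \<open>2 \<le> length (TS ! k)\<close> by (auto simp: i_def)
    let ?T = "map (\<lambda>i. index A (k, i)) [0..<length (TS ! k) - 1]"
    have "index A (k, i) \<in> set ?T" using i by auto
    moreover have "v = tail D (index A (k, i)) \<or> v = head D (index A (k, i))"
      using arc(2,3)[OF kj(1) i(1)] labv i(2) by auto
    ultimately show "\<exists>T \<in> set (inst_trips I). \<exists>e \<in> set T. v = tail D e \<or> v = head D e"
      using trip_mem[OF kj(1)] by blast
  next
    fix e assume "e \<in> arcs D"
    then have "e < length A" by (simp add: arcs)
    from arc_cases[OF this] obtain k i where ki: "k < length TS" "Suc i < length (TS ! k)" "e = index A (k, i)"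
      by blast
    let ?T = "map (\<lambda>i. index A (k, i)) [0..<length (TS ! k) - 1]"
    have "e \<in> set ?T" using ki by auto
    then show "\<exists>T \<in> set (inst_trips I). e \<in> set T" using trip_mem[OF ki(1)] by blast
  qed
  have st: "inst_source I = lab s" "inst_target I = lab t"
    by (simp_all add: I_def net_instance_def lab_def)
  have stV: "lab s \<in> verts D" "lab t \<in> verts D"
    using lab_less[OF s] lab_less[OF t] by (simp_all add: verts)
  show "valid_instance (net_instance TS s t)"
    using net stV st by (simp add: valid_instance_def I_def D_def)
  have "trip_nodes D (map (\<lambda>i. index A (k, i)) [0..<length (TS ! k) - 1]) = map lab (TS ! k)" if "k < length TS" for k
  proof (rule nth_equalityI)
    have l: "2 \<le> length (TS ! k)" using len that by simp
    then show "length (trip_nodes D (map (\<lambda>i. index A (k, i)) [0..<length (TS ! k) - 1])) = length (map lab (TS ! k))"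
      by (simp add: trip_nodes_def)
    fix i assume "i < length (trip_nodes D (map (\<lambda>i. index A (k, i)) [0..<length (TS ! k) - 1]))"
    then have i: "i < length (TS ! k)" using l by (simp add: trip_nodes_def)
    show "trip_nodes D (map (\<lambda>i. index A (k, i)) [0..<length (TS ! k) - 1]) ! i = map lab (TS ! k) ! i"
    proof (cases "Suc i < length (TS ! k)")
      case True
      then have "i < length (TS ! k) - 1" by simp
      then show ?thesis using arc(2)[OF that True] i by (simp add: trip_nodes_def nth_append)
    next
      case False
      then have "i = Suc (length (TS ! k) - 2)" "length (TS ! k) - 1 = i" using i l by auto
      then show ?thesis using arc(3)[OF that, of "length (TS ! k) - 2"] i l
        by (simp add: trip_nodes_def nth_append last_map last_upt)
    qed
  qed
  then have "map (trip_nodes D) (inst_trips I) = map (map lab) (map ((!) TS) [0..<length TS])"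
    by (simp add: trips)
  then have tn: "map (trip_nodes D) (inst_trips I) = map (map lab) TS"
    by (simp only: map_nth)
  have "inj_on lab (set (concat TS))"
    using index_inj[of "net_nodes TS"] nodes by (simp add: lab_def)
  then have "(\<exists>U. reach (map (map lab) TS) (lab s) U (lab t)) \<longleftrightarrow> (\<exists>U. reach TS s U t)"
    using s t by (intro reach_map) auto
  then show "temporalisable (inst_digraph (net_instance TS s t)) (inst_weight (net_instance TS s t))
      (inst_trips (net_instance TS s t)) (inst_source (net_instance TS s t)) (inst_target (net_instance TS s t)) \<longleftrightarrow>
      (\<exists>U. reach TS s U t)"
    using temporalisable_iff_reach[OF net stV] tn st by (simp add: I_def D_def)
qed

lemma enc_list_map: "enc_list f (map g xs) = enc_list (\<lambda>x. f (g x)) xs"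
  by (induction xs) auto

text \<open>The record of an instance is never a value of the class \<open>enc\<close>: once it is
  unfolded and the encodings are moved inside \<open>map\<close>, a composition of list functions
  from the trips to the bit string remains.\<close>

lemma ptime_enc_net_instance [ptime_intros]:
  assumes "ptime TS" "ptime s" "ptime t"
  shows "ptime (\<lambda>e. enc_instance (net_instance (TS e) (s e) (t e)))"
proof -
  have "ptime (\<lambda>z. enc_instance (net_instance (fst z) (fst (snd z)) (snd (snd z) :: 'b)))"
    unfolding net_instance_def enc_instance_def rtt_instance.simps enc_list_map enc_arc.simps net_arcs_def net_trips_def
      arc_names_def net_nodes_def
    by (intro ptime_intros)
  from ptime_comp3[OF this assms] show ?thesis .
qed

section \<open>From satisfiability to trip networks\<close>

type_synonym 'a cnf = "('a \<times> bool) list list"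

definition sat :: "('a \<Rightarrow> bool) \<Rightarrow> 'a cnf \<Rightarrow> bool" where
  "sat \<alpha> cs \<longleftrightarrow> (\<forall>c \<in> set cs. \<exists>l \<in> set c. \<alpha> (fst l) = snd l)"

type_synonym cnf_node = "nat \<times> nat \<times> bool \<times> nat"

text \<open>\<open>xnode i\<close> is the entrance of the gadget of variable \<open>i\<close>,
  \<open>vnode i b j\<close> the point on its side \<open>b\<close> before the edge that belongs to
  clause \<open>j\<close>, \<open>cnode j\<close> the point before clause \<open>j\<close>, and
  \<open>dnode\<close> a dead end. The first component is a tag.\<close>

definition vnode :: "nat \<Rightarrow> bool \<Rightarrow> nat \<Rightarrow> cnf_node" where "vnode i b j = (0, i, b, j)"
definition xnode :: "nat \<Rightarrow> cnf_node" where "xnode i = (1, i, False, 0)"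
definition cnode :: "nat \<Rightarrow> cnf_node" where "cnode j = (2, j, False, 0)"
definition dnode :: cnf_node where "dnode = (3, 0, False, 0)"

lemmas node_defs = vnode_def xnode_def cnode_def dnode_def

lemma ptime_vnode [ptime_intros]: "ptime i \<Longrightarrow> ptime b \<Longrightarrow> ptime j \<Longrightarrow> ptime (\<lambda>e. vnode (i e) (b e) (j e))"
  and ptime_xnode [ptime_intros]: "ptime i \<Longrightarrow> ptime (\<lambda>e. xnode (i e))"
  and ptime_cnode [ptime_intros]: "ptime i \<Longrightarrow> ptime (\<lambda>e. cnode (i e))"
  unfolding node_defs by (intro ptime_intros; assumption)+

lemma node_inject [simp]:
  "vnode i b j = vnode i' b' j' \<longleftrightarrow> i = i' \<and> b = b' \<and> j = j'" "xnode i = xnode i' \<longleftrightarrow> i = i'" "cnode i = cnode i' \<longleftrightarrow> i = i'"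
  by (auto simp: node_defs)

lemma node_distinct [simp]:
  "vnode i b j \<noteq> xnode i'" "vnode i b j \<noteq> cnode j'" "xnode i' \<noteq> vnode i b j" "cnode j' \<noteq> vnode i b j"
  "xnode i \<noteq> cnode j" "cnode j \<noteq> xnode i" "dnode \<noteq> vnode i b j" "dnode \<noteq> xnode i" "dnode \<noteq> cnode j"
  "vnode i b j \<noteq> dnode" "xnode i \<noteq> dnode" "cnode j \<noteq> dnode"
  by (auto simp: node_defs)

definition cnf_vars :: "'a cnf \<Rightarrow> 'a list" where
  "cnf_vars cs = dedup (map fst (concat cs))"

text \<open>The trip of the literal with value \<open>b\<close> contains an edge of the opposite
  side, so choosing the value that falsifies the literal uses the trip up. A literal absent from the
  clause keeps the bare edge, so that every side has one edge per clause.\<close>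

definition lit_trip :: "'a cnf \<Rightarrow> nat \<Rightarrow> bool \<Rightarrow> nat \<Rightarrow> cnf_node list" where
  "lit_trip cs i b j = (if (nthd (cnf_vars cs) i, b) \<in> set (nthd cs j)
     then [cnode j, cnode (Suc j), vnode i (\<not> b) j, vnode i (\<not> b) (Suc j)]
     else [vnode i (\<not> b) j, vnode i (\<not> b) (Suc j)])"

text \<open>The trip to \<open>dnode\<close> ensures that the target occurs in some trip even if the last clause is empty.\<close>

definition cnf_trips :: "'a cnf \<Rightarrow> cnf_node list list" where
  "cnf_trips cs = dedup (
     concat (map (\<lambda>i. concat (map (\<lambda>b.
       [xnode i, vnode i b 0] # [vnode i b (length cs), xnode (Suc i)] #
       map (\<lambda>j. lit_trip cs i b j) [0..<length cs]) [False, True])) [0..<length (cnf_vars cs)]) @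
     [[xnode (length (cnf_vars cs)), cnode 0], [cnode (length cs), dnode]])"

lemma ptime_cnf_trips [ptime_intros]:
  assumes "ptime f"
  shows "ptime (\<lambda>e. cnf_trips (f e))"
proof -
  have "ptime (\<lambda>cs. cnf_trips cs :: cnf_node list list)"
    unfolding cnf_trips_def lit_trip_def cnf_vars_def by (intro ptime_intros)
  from ptime_comp[OF this assms] show ?thesis .
qed

lemma set_cnf_trips:
  "set (cnf_trips cs) =
     {lit_trip cs i b j | i b j. i < length (cnf_vars cs) \<and> j < length cs} \<union>
     {[xnode i, vnode i b 0] | i b. i < length (cnf_vars cs)} \<union>
     {[vnode i b (length cs), xnode (Suc i)] | i b. i < length (cnf_vars cs)} \<union>
     {[xnode (length (cnf_vars cs)), cnode 0], [cnode (length cs), dnode]}"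
proof -
  have "set [False, True] = UNIV" by auto
  then have "set (cnf_trips cs) = (\<Union>i \<in> {..<length (cnf_vars cs)}. \<Union>b.
      insert [xnode i, vnode i b 0] (insert [vnode i b (length cs), xnode (Suc i)] (lit_trip cs i b ` {..<length cs}))) \<union>
      {[xnode (length (cnf_vars cs)), cnode 0], [cnode (length cs), dnode]}"
    unfolding cnf_trips_def by (simp only: set_dedup set_append set_concat set_map image_image list.set(2)[of "[xnode i, vnode i b 0]" for i b]
      list.set(2)[of "[vnode i b k, xnode (Suc i)]" for i b k] set_upt atLeast0LessThan) (simp only: list.set)
  then show ?thesis
    by (simp only:) blast
qed

lemma cnf_trips_cases:
  assumes "T \<in> set (cnf_trips cs)"
  obtains (lit) i b j where "i < length (cnf_vars cs)" "j < length cs" "T = lit_trip cs i b j"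
  | (enter) i b where "i < length (cnf_vars cs)" "T = [xnode i, vnode i b 0]"
  | (leave) i b where "i < length (cnf_vars cs)" "T = [vnode i b (length cs), xnode (Suc i)]"
  | (turn) "T = [xnode (length (cnf_vars cs)), cnode 0]"
  | (sink) "T = [cnode (length cs), dnode]"
  using assms unfolding set_cnf_trips by blast

lemma cnf_trips_mem:
  "i < length (cnf_vars cs) \<Longrightarrow> j < length cs \<Longrightarrow> lit_trip cs i b j \<in> set (cnf_trips cs)"
  "i < length (cnf_vars cs) \<Longrightarrow> [xnode i, vnode i b 0] \<in> set (cnf_trips cs)"
  "i < length (cnf_vars cs) \<Longrightarrow> [vnode i b (length cs), xnode (Suc i)] \<in> set (cnf_trips cs)"
  "[xnode (length (cnf_vars cs)), cnode 0] \<in> set (cnf_trips cs)"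
  "[cnode (length cs), dnode] \<in> set (cnf_trips cs)"
  unfolding set_cnf_trips by blast+

text \<open>The edges of side \<open>b\<close> belong to the trips of the opposite literal. Phrasing
  progress along a side by spent trips makes it monotone in \<open>U\<close>, so that it survives
  all later detours.\<close>

definition used_side :: "'a cnf \<Rightarrow> nat \<Rightarrow> bool \<Rightarrow> nat \<Rightarrow> cnf_node list set \<Rightarrow> bool" where
  "used_side cs i b j U \<longleftrightarrow> (\<forall>j'<j. lit_trip cs i (\<not> b) j' \<in> U)"

definition clause_holds :: "'a cnf \<Rightarrow> (nat \<Rightarrow> bool) \<Rightarrow> nat \<Rightarrow> bool" where
  "clause_holds cs \<beta> j \<longleftrightarrow> (\<exists>i < length (cnf_vars cs). (cnf_vars cs ! i, \<beta> i) \<in> set (cs ! j))"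

lemma used_side_mono: "used_side cs i b j U \<Longrightarrow> used_side cs i b j (insert T U)"
  unfolding used_side_def by blast

text \<open>Before the first visit of a clause node no trip has been taken backwards, so every variable gadget is
  crossed completely along one side. All trips of that side are spent from then on, and a clause can
  only be crossed with a literal of the other side, whatever detours the route takes later.\<close>

lemma cnf_reach_invariant:
  assumes "set_reach (set (cnf_trips cs)) (xnode 0) U v"
  shows "(\<exists>\<beta>. (\<forall>i < length (cnf_vars cs). used_side cs i (\<beta> i) (length cs) U) \<and>
           (\<forall>j. v = cnode j \<longrightarrow> (\<forall>j'<j. j' < length cs \<longrightarrow> clause_holds cs \<beta> j'))) \<or>
         (\<exists>i \<beta>. i \<le> length (cnf_vars cs) \<and> (\<forall>i'<i. used_side cs i' (\<beta> i') (length cs) U) \<and>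
           (v = xnode i \<or> (\<exists>b j. i < length (cnf_vars cs) \<and> v = vnode i b j \<and> used_side cs i b j U)))"
  using assms
proof (induction rule: set_reach.induct)
  case set_reach_refl
  then show ?case by (intro disjI2 exI[of _ 0]) auto
next
  case (set_reach_step U u T v)
  let ?n = "length (cnf_vars cs)" and ?m = "length cs"
  from set_reach_step.IH show ?case
  proof (elim disjE exE conjE)
    fix \<beta>
    assume full: "\<forall>i < ?n. used_side cs i (\<beta> i) ?m U"
      and cl: "\<forall>j. u = cnode j \<longrightarrow> (\<forall>j'<j. j' < ?m \<longrightarrow> clause_holds cs \<beta> j')"
    have "\<forall>j'<j. j' < ?m \<longrightarrow> clause_holds cs \<beta> j'" if v: "v = cnode j" for j
      using set_reach_step.hyps(2)
    proof (cases rule: cnf_trips_cases)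
      case (lit i b j0)
      have side: "lit_trip cs i (\<not> \<beta> i) j0 \<in> U"
        using full lit by (auto simp: used_side_def)
      then have b: "b = \<beta> i" using lit set_reach_step.hyps(3) by (cases b; cases "\<beta> i") auto
      \<comment> \<open>On a trip only \<open>cnode j0\<close> precedes
        \<open>cnode (Suc j0)\<close>, so a clause node cannot be reached from a variable node by
        this trip, and clauses cannot be skipped.\<close>
      have "(nthd (cnf_vars cs) i, b) \<in> set (nthd cs j0) \<and> u = cnode j0 \<and> j = Suc j0"
        using set_reach_step.hyps(4) v lit by (auto simp: lit_trip_def split: if_splits)
      then have "clause_holds cs \<beta> j0" "u = cnode j0" "j = Suc j0"
        using b lit by (auto simp: clause_holds_def nthd_nth)
      then show ?thesis using cl by (auto simp: less_Suc_eq)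
    qed (use v set_reach_step.hyps(4) in auto)
    then show ?thesis using full by (intro disjI1 exI[of _ \<beta>]) (auto intro: used_side_mono)
  next
    fix i \<beta>
    assume i: "i \<le> ?n" and full: "\<forall>i'<i. used_side cs i' (\<beta> i') ?m U" and u: "u = xnode i"
    from set_reach_step.hyps(2) show ?thesis
    proof (cases rule: cnf_trips_cases)
      case (lit i b j)
      then show ?thesis using set_reach_step.hyps(4) u by (auto simp: lit_trip_def split: if_splits)
    next
      case (enter i' b)
      then have "i' = i" "v = vnode i b 0" using set_reach_step.hyps(4) u by auto
      then show ?thesis using enter full
        by (intro disjI2 exI[of _ i] exI[of _ \<beta>]) (auto simp: used_side_def)
    next
      case turn
      then have "i = ?n" "v = cnode 0" using set_reach_step.hyps(4) u by auto
      then show ?thesis using full by (intro disjI1 exI[of _ \<beta>]) (auto intro: used_side_mono)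
    qed (use set_reach_step.hyps(4) u in auto)
  next
    fix i \<beta> b j
    assume full: "\<forall>i'<i. used_side cs i' (\<beta> i') ?m U" and i: "i < ?n" and u: "u = vnode i b j"
      and side: "used_side cs i b j U"
    from set_reach_step.hyps(2) show ?thesis
    proof (cases rule: cnf_trips_cases)
      case (lit i' b' j')
      then have *: "i' = i" "b' = (\<not> b)" "j' = j" "v = vnode i b (Suc j)"
        using set_reach_step.hyps(4) u by (auto simp: lit_trip_def split: if_splits)
      then have "used_side cs i b (Suc j) (insert T U)"
        using side lit by (auto simp: used_side_def less_Suc_eq)
      then show ?thesis using full i *
        by (intro disjI2 exI[of _ i] exI[of _ \<beta>]) (auto intro: used_side_mono)
    next
      case (leave i' b')
      then have "v = xnode (Suc i)" "j = ?m" using set_reach_step.hyps(4) u by auto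
      then show ?thesis using full i side
        by (intro disjI2 exI[of _ "Suc i"] exI[of _ "\<beta>(i := b)"]) (auto intro: used_side_mono simp: less_Suc_eq)
    qed (use set_reach_step.hyps(4) u in auto)
  qed
qed

text \<open>Freshness of a trip is checked through its last node: \<open>L\<close> contains the last
  nodes of all trips used so far, so a trip that ends outside \<open>L\<close> is new. This spares
  listing the used trips.\<close>

lemma set_reach_extend:
  assumes "\<exists>U. set_reach S s U u \<and> last ` U \<subseteq> L" "T \<in> S" "hop T u v" "last T \<notin> L" "insert (last T) L \<subseteq> L'"
  shows "\<exists>U. set_reach S s U v \<and> last ` U \<subseteq> L'"
proof -
  obtain U where "set_reach S s U u" "last ` U \<subseteq> L" using assms(1) by blast
  moreover have "T \<notin> U" using assms(4) \<open>last ` U \<subseteq> L\<close> by blast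
  ultimately show ?thesis using set_reach_step[of S s U u T v] assms by (intro exI[of _ "insert T U"]) auto
qed

lemma last_lit_trip: "last (lit_trip cs i b j) = vnode i (\<not> b) (Suc j)"
  by (simp add: lit_trip_def)

lemma hop_lit_trip: "hop (lit_trip cs i (\<not> b) j) (vnode i b j) (vnode i b (Suc j))"
  by (simp add: lit_trip_def)

lemma cnf_reach_complete:
  assumes "\<And>j. j < length cs \<Longrightarrow> clause_holds cs \<beta> j"
  shows "\<exists>U. set_reach (set (cnf_trips cs)) (xnode 0) U (cnode (length cs))"
proof -
  let ?n = "length (cnf_vars cs)" and ?m = "length cs" and ?S = "set (cnf_trips cs)"
  \<comment> \<open>These cover the last nodes of the trips that lead through the first
    \<open>i\<close> variables: the exits of the gadgets and the points on the chosen sides.\<close>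
  define L where "L i = {xnode i' | i'. i' \<le> i} \<union> {vnode i' (\<beta> i') j | i' j. i' < i}" for i
  have var: "\<exists>U. set_reach ?S (xnode 0) U (xnode i) \<and> last ` U \<subseteq> L i" if "i \<le> ?n" for i
    using that
  proof (induction i)
    case 0
    show ?case by (rule exI[of _ "{}"]) (auto intro: set_reach_refl)
  next
    case (Suc i)
    have i: "i < ?n" using Suc.prems by simp
    have chain: "\<exists>U. set_reach ?S (xnode 0) U (vnode i (\<beta> i) j) \<and> last ` U \<subseteq> L i \<union> {vnode i (\<beta> i) j' | j'. j' \<le> j}" if "j \<le> ?m" for j
      using that
    proof (induction j)
      case 0
      show ?case
        by (rule set_reach_extend[OF Suc.IH cnf_trips_mem(2)[OF i, of "\<beta> i"]]) (use i in \<open>auto simp: L_def\<close>)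
    next
      case (Suc j)
      show ?case
        by (rule set_reach_extend[OF Suc.IH cnf_trips_mem(1)[OF i, of j "\<not> \<beta> i"] hop_lit_trip])
          (use Suc.prems in \<open>auto simp: L_def last_lit_trip\<close>)
    qed
    show ?case
      by (rule set_reach_extend[OF chain[OF order_refl] cnf_trips_mem(3)[OF i, of "\<beta> i"]]) (auto simp: L_def)
  qed
  have "\<exists>U. set_reach ?S (xnode 0) U (cnode j) \<and> last ` U \<subseteq> L ?n \<union> {cnode 0} \<union> {vnode i (\<not> \<beta> i) (Suc j') | i j'. j' < j}"
    if "j \<le> ?m" for j
    using that
  proof (induction j)
    case 0
    show ?case
      by (rule set_reach_extend[OF var[OF order_refl] cnf_trips_mem(4)]) (auto simp: L_def)
  next
    case (Suc j)
    then obtain i where i: "i < ?n" "(cnf_vars cs ! i, \<beta> i) \<in> set (cs ! j)"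
      using assms[of j] by (auto simp: clause_holds_def)
    then have "hop (lit_trip cs i (\<beta> i) j) (cnode j) (cnode (Suc j))"
      using Suc.prems by (simp add: lit_trip_def nthd_nth)
    \<comment> \<open>This trip ends on the side that \<open>\<beta>\<close> does not choose, at
      level \<open>Suc j\<close>; hence it differs from the trips taken through the variables and
      from those of earlier clauses.\<close>
    then show ?case
      by (rule set_reach_extend[OF Suc.IH cnf_trips_mem(1)[OF i(1)], rotated 2])
        (use Suc.prems in \<open>auto simp: L_def last_lit_trip\<close>)
  qed
  then show ?thesis by blast
qed

lemma cnf_reach_iff_sat:
  "(\<exists>U. set_reach (set (cnf_trips cs)) (xnode 0) U (cnode (length cs))) \<longleftrightarrow> (\<exists>\<alpha>. sat \<alpha> cs)"
proof
  let ?xs = "cnf_vars cs"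
  assume "\<exists>U. set_reach (set (cnf_trips cs)) (xnode 0) U (cnode (length cs))"
  then obtain U where "set_reach (set (cnf_trips cs)) (xnode 0) U (cnode (length cs))" by blast
  from cnf_reach_invariant[OF this] obtain \<beta> where \<beta>: "\<forall>j < length cs. clause_holds cs \<beta> j"
    by auto
  have "sat (\<lambda>x. \<beta> (index ?xs x)) cs"
    unfolding sat_def
  proof
    fix c assume "c \<in> set cs"
    then obtain j where "j < length cs" "cs ! j = c" by (auto simp: in_set_conv_nth)
    then obtain i where i: "i < length ?xs" "(?xs ! i, \<beta> i) \<in> set c" using \<beta> unfolding clause_holds_def by auto
    moreover have "index ?xs (?xs ! i) = i" using i by (intro index_nth) (auto simp: cnf_vars_def)
    ultimately show "\<exists>l \<in> set c. \<beta> (index ?xs (fst l)) = snd l" by (intro bexI[of _ "(?xs ! i, \<beta> i)"]) auto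
  qed
  then show "\<exists>\<alpha>. sat \<alpha> cs" by blast
next
  let ?xs = "cnf_vars cs"
  assume "\<exists>\<alpha>. sat \<alpha> cs"
  then obtain \<alpha> where \<alpha>: "sat \<alpha> cs" by blast
  have "clause_holds cs (\<lambda>i. \<alpha> (?xs ! i)) j" if j: "j < length cs" for j
  proof -
    obtain l where l: "l \<in> set (cs ! j)" "\<alpha> (fst l) = snd l" using \<alpha> nth_mem[OF j] unfolding sat_def by blast
    then have "l \<in> set (concat cs)" using nth_mem[OF j] by auto
    then have "fst l \<in> set ?xs" by (simp add: cnf_vars_def)
    then obtain i where "i < length ?xs" "?xs ! i = fst l" by (auto simp: in_set_conv_nth)
    then show ?thesis using l unfolding clause_holds_def by (intro exI[of _ i]) auto
  qed
  then show "\<exists>U. set_reach (set (cnf_trips cs)) (xnode 0) U (cnode (length cs))" by (rule cnf_reach_complete)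
qed

definition cnf_instance :: "'a cnf \<Rightarrow> rtt_instance" where
  "cnf_instance cs = net_instance (cnf_trips cs) (xnode 0) (cnode (length cs))"

text \<open>The language contains codes of instances, so injectivity of the encoding is what turns
  membership of this code into a property of this very instance.\<close>

lemma cnf_instance_in_o2o_rtt: "enc_instance (cnf_instance cs) \<in> o2o_rtt \<longleftrightarrow> (\<exists>\<alpha>. sat \<alpha> cs)"
proof -
  let ?TS = "cnf_trips cs" and ?s = "xnode 0" and ?t = "cnode (length cs)"
  have len: "2 \<le> length T" if "T \<in> set ?TS" for T
    using that by (cases rule: cnf_trips_cases) (auto simp: lit_trip_def)
  have s: "?s \<in> set (concat ?TS)"
  proof (cases "cnf_vars cs = []")
    case True
    then show ?thesis using cnf_trips_mem(4)[of cs] by (auto intro!: bexI[of _ "[xnode 0, cnode 0]"])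
  next
    case False
    then show ?thesis using cnf_trips_mem(2)[of 0 cs True] by (auto intro!: bexI[of _ "[xnode 0, vnode 0 True 0]"])
  qed
  have t: "?t \<in> set (concat ?TS)"
    using cnf_trips_mem(5)[of cs] by (auto intro!: bexI[of _ "[cnode (length cs), dnode]"])
  have dist: "distinct ?TS" by (simp add: cnf_trips_def)
  note v = valid_net_instance[of ?TS ?s ?t, OF len s t]
  have "enc_instance (cnf_instance cs) \<in> o2o_rtt \<longleftrightarrow> (\<exists>U. reach ?TS ?s U ?t)"
    using v temporalisable_net_instance[of ?TS ?s ?t, OF len s t] inj_enc_instance
    unfolding o2o_rtt_def cnf_instance_def by (auto dest: injD)
  then show ?thesis
    unfolding reach_set_reach[OF dist] cnf_reach_iff_sat .
qed

lemma ptime_enc_cnf_instance: "ptime f \<Longrightarrow> ptime (\<lambda>e. enc_instance (cnf_instance (f e)))"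
  unfolding cnf_instance_def
  by (intro ptime_intros)

section \<open>Satisfiability of computation tableaux\<close>

definition clause_true :: "('a \<Rightarrow> bool) \<Rightarrow> ('a \<times> bool) list \<Rightarrow> bool" where
  "clause_true \<alpha> c \<longleftrightarrow> (\<exists>l \<in> set c. \<alpha> (fst l) = snd l)"

lemma sat_simps:
  "sat \<alpha> []" "sat \<alpha> (c # cs) \<longleftrightarrow> clause_true \<alpha> c \<and> sat \<alpha> cs" "sat \<alpha> (cs @ ds) \<longleftrightarrow> sat \<alpha> cs \<and> sat \<alpha> ds"
  "sat \<alpha> (concat (map f xs)) \<longleftrightarrow> (\<forall>x \<in> set xs. sat \<alpha> (f x))" "sat \<alpha> (map g xs) \<longleftrightarrow> (\<forall>x \<in> set xs. clause_true \<alpha> (g x))"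
  by (auto simp: sat_def clause_true_def)

lemma clause_true_simps:
  "clause_true \<alpha> [] \<longleftrightarrow> False" "clause_true \<alpha> ((a, b) # c) \<longleftrightarrow> \<alpha> a = b \<or> clause_true \<alpha> c"
  by (auto simp: clause_true_def)

definition imp_clause :: "'a list \<Rightarrow> 'a \<Rightarrow> ('a \<times> bool) list" where
  "imp_clause as h = map (\<lambda>a. (a, False)) as @ [(h, True)]"

lemma clause_true_imp: "clause_true \<alpha> (imp_clause as h) \<longleftrightarrow> ((\<forall>a \<in> set as. \<alpha> a) \<longrightarrow> \<alpha> h)"
  by (auto simp: clause_true_def imp_clause_def)

lemma ptime_imp_clause [ptime_intros]: "ptime f \<Longrightarrow> ptime g \<Longrightarrow> ptime (\<lambda>e. imp_clause (f e) (g e))"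
  unfolding imp_clause_def by (intro ptime_intros)

definition at_state :: "nat \<Rightarrow> nat \<Rightarrow> nat list" where "at_state t q = [0, t, q]"
definition at_head :: "nat \<Rightarrow> nat \<Rightarrow> nat \<Rightarrow> nat list" where "at_head t i p = [1, t, i, p]"
definition at_cell :: "nat \<Rightarrow> nat \<Rightarrow> nat \<Rightarrow> nat \<Rightarrow> nat list" where "at_cell t i p a = [2, t, i, p, a]"
text \<open>This atom keeps head positions out of the rule bodies: a rule depends on the state and
  the symbols read, wherever the heads of the several tapes are.\<close>

definition at_read :: "nat \<Rightarrow> nat \<Rightarrow> nat \<Rightarrow> nat list" where "at_read t i a = [3, t, i, a]"

lemmas at_defs = at_state_def at_head_def at_cell_def at_read_def

lemma ptime_at [ptime_intros]:
  "ptime t \<Longrightarrow> ptime q \<Longrightarrow> ptime (\<lambda>e. at_state (t e) (q e))"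
  "ptime t \<Longrightarrow> ptime i \<Longrightarrow> ptime p \<Longrightarrow> ptime (\<lambda>e. at_head (t e) (i e) (p e))"
  "ptime t \<Longrightarrow> ptime i \<Longrightarrow> ptime p \<Longrightarrow> ptime a \<Longrightarrow> ptime (\<lambda>e. at_cell (t e) (i e) (p e) (a e))"
  "ptime t \<Longrightarrow> ptime i \<Longrightarrow> ptime a \<Longrightarrow> ptime (\<lambda>e. at_read (t e) (i e) (a e))"
  unfolding at_defs by (intro ptime_intros; assumption)+

text \<open>Halting becomes an ordinary step that rewrites the symbols read and stays, so a run can
  be described up to any length \<open>T\<close> without a special case.\<close>

definition tm_next :: "tm \<Rightarrow> nat \<Rightarrow> nat list \<Rightarrow> nat \<times> (nat \<times> move) list" where
  "tm_next M q ss = (if q = 1 then (q, map (\<lambda>a. (a, Stay)) ss) else delta M q ss)"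

lemma tm_step_next:
  "tm_step M (q, tps) = (fst (tm_next M q (map tape_read tps)), map2 tape_act (snd (tm_next M q (map tape_read tps))) tps)"
  by (simp add: tm_next_def split: prod.splits)

fun move_code :: "move \<Rightarrow> nat" where
  "move_code Move_Left = 0"
| "move_code Stay = 1"
| "move_code Move_Right = 2"

type_synonym tm_rule = "nat \<times> (nat \<times> nat) list \<times> nat \<times> (nat \<times> nat \<times> nat) list"

text \<open>One line of the transition table as data of class \<open>enc\<close>, which the function
  \<open>delta M\<close> is not. The list of all rules depends only on \<open>M\<close> and enters
  the construction of formulas as a constant.\<close>

definition tm_rule :: "tm \<Rightarrow> nat \<Rightarrow> nat list \<Rightarrow> tm_rule" where
  "tm_rule M q ss = (q, map (\<lambda>i. (i, ss ! i)) [0..<num_tapes M], fst (tm_next M q ss),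
     map (\<lambda>i. (i, fst (snd (tm_next M q ss) ! i), move_code (snd (snd (tm_next M q ss) ! i)))) [0..<num_tapes M])"

definition tm_rules :: "tm \<Rightarrow> tm_rule list" where
  "tm_rules M = concat (map (\<lambda>q. map (tm_rule M q) (List.n_lists (num_tapes M) [0..<num_symbols M])) [0..<num_states M])"

definition rule_body :: "nat \<Rightarrow> tm_rule \<Rightarrow> nat list list" where
  "rule_body t r = at_state t (fst r) # map (\<lambda>z. at_read t (fst z) (snd z)) (fst (snd r))"

definition rule_clauses :: "nat \<Rightarrow> nat \<Rightarrow> tm_rule \<Rightarrow> nat list cnf" where
  "rule_clauses P t r = imp_clause (rule_body t r) (at_state (Suc t) (fst (snd (snd r)))) #
     concat (map (\<lambda>z. concat (map (\<lambda>p.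
       [imp_clause (at_head t (fst z) p # rule_body t r) (at_head (Suc t) (fst z) (p + snd (snd z) - 1)),
        imp_clause (at_head t (fst z) p # rule_body t r) (at_cell (Suc t) (fst z) p (fst (snd z)))]) [0..<P]))
       (snd (snd (snd r))))"

text \<open>Cells of the certificate region may also be blank, for certificates shorter than
  \<open>g\<close>. Further clauses of the tableau let a blank there propagate to the right, so the
  region describes a word followed by blanks.\<close>

definition input_clause :: "bool list \<Rightarrow> nat \<Rightarrow> nat \<Rightarrow> nat \<Rightarrow> (nat list \<times> bool) list" where
  "input_clause x g off p =
     (if p < off then [(at_cell 0 0 p 0, True)]
      else if p - off < length x then [(at_cell 0 0 p (if nthd x (p - off) then 2 else 1), True)]
      else if p - off < length x + g then [(at_cell 0 0 p 0, True), (at_cell 0 0 p 1, True), (at_cell 0 0 p 2, True)]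
      else [(at_cell 0 0 p 0, True)])"

text \<open>Position \<open>p\<close> stands for the cell \<open>p - (T + 1)\<close> of a tape. The \<open>g\<close> cells after the input \<open>x\<close> are left open for a
  certificate. The excluded cases of the loops are filled with clauses that hold anyway.\<close>

definition tableau :: "tm \<Rightarrow> bool list \<Rightarrow> nat \<Rightarrow> nat \<Rightarrow> nat list cnf" where
  "tableau M x g T =
     [(at_state 0 0, True)] #
     map (\<lambda>i. [(at_head 0 i (T + 1), True)]) [0..<num_tapes M] @
     concat (map (\<lambda>i. map (\<lambda>p. [(at_cell 0 i p 0, True)]) [0..<2 * T + 3]) [1..<num_tapes M]) @
     map (\<lambda>p. input_clause x g (T + 1) p) [0..<2 * T + 3] @
     map (\<lambda>j. imp_clause [at_cell 0 0 (T + 1 + length x + j) 0] (at_cell 0 0 (T + 1 + length x + Suc j) 0)) [0..<g] @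
     concat (map (\<lambda>t. concat (map (\<lambda>i. concat (map (\<lambda>p. concat (map (\<lambda>a.
       imp_clause [at_head t i p, at_cell t i p a] (at_read t i a) #
       map (\<lambda>p'. if p' = p then imp_clause [at_state t 0] (at_state t 0)
         else imp_clause [at_head t i p, at_cell t i p' a] (at_cell (Suc t) i p' a)) [0..<2 * T + 3])
       [0..<num_symbols M])) [0..<2 * T + 3])) [0..<num_tapes M])) [0..<T]) @
     concat (map (\<lambda>t. concat (map (\<lambda>r. rule_clauses (2 * T + 3) t r) (tm_rules M))) [0..<T]) @
     map (\<lambda>a. if a = 2 then [(at_state 0 0, True)] else [(at_cell T (num_tapes M - 1) (T + 1) a, False)]) [0..<num_symbols M] @
     map (\<lambda>a. [(at_cell T (num_tapes M - 1) (T + 2) a, False)]) [1..<num_symbols M]"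

lemma ptime_tableau:
  assumes "ptime x" "ptime g" "ptime T"
  shows "ptime (\<lambda>e. tableau M (x e) (g e) (T e))"
proof -
  have "ptime (\<lambda>z. tableau M (fst z) (fst (snd z)) (snd (snd z)))"
    unfolding tableau_def rule_clauses_def rule_body_def input_clause_def by (intro ptime_intros)
  from ptime_comp3[OF this assms] show ?thesis .
qed

lemma tm_rules_sat:
  "(\<forall>r \<in> set (tm_rules M). sat \<alpha> (rule_clauses P t r)) \<longleftrightarrow>
   (\<forall>q ss. q < num_states M \<longrightarrow> length ss = num_tapes M \<longrightarrow> (\<forall>a \<in> set ss. a < num_symbols M) \<longrightarrow>
     \<alpha> (at_state t q) \<longrightarrow> (\<forall>i < num_tapes M. \<alpha> (at_read t i (ss ! i))) \<longrightarrow>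
     \<alpha> (at_state (Suc t) (fst (tm_next M q ss))) \<and>
     (\<forall>i < num_tapes M. \<forall>p < P. \<alpha> (at_head t i p) \<longrightarrow>
       \<alpha> (at_head (Suc t) i (p + move_code (snd (snd (tm_next M q ss) ! i)) - 1)) \<and>
       \<alpha> (at_cell (Suc t) i p (fst (snd (tm_next M q ss) ! i)))))"
proof -
  have set: "set (tm_rules M) = (\<Union>q \<in> {..<num_states M}. tm_rule M q `
      {ss. length ss = num_tapes M \<and> (\<forall>a \<in> set ss. a < num_symbols M)})"
    by (simp add: tm_rules_def set_n_lists atLeast0LessThan subset_eq)
  have "sat \<alpha> (rule_clauses P t (tm_rule M q ss)) \<longleftrightarrow>
     (\<alpha> (at_state t q) \<longrightarrow> (\<forall>i < num_tapes M. \<alpha> (at_read t i (ss ! i))) \<longrightarrow>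
     \<alpha> (at_state (Suc t) (fst (tm_next M q ss))) \<and>
     (\<forall>i < num_tapes M. \<forall>p < P. \<alpha> (at_head t i p) \<longrightarrow>
       \<alpha> (at_head (Suc t) i (p + move_code (snd (snd (tm_next M q ss) ! i)) - 1)) \<and>
       \<alpha> (at_cell (Suc t) i p (fst (snd (tm_next M q ss) ! i)))))" for q ss
    by (auto simp: rule_clauses_def rule_body_def tm_rule_def sat_simps clause_true_imp)
  moreover have "(\<forall>r \<in> set (tm_rules M). R r) \<longleftrightarrow> (\<forall>q ss. q < num_states M \<longrightarrow> length ss = num_tapes M \<longrightarrow>
      (\<forall>a \<in> set ss. a < num_symbols M) \<longrightarrow> R (tm_rule M q ss))" for R
    unfolding set by auto
  ultimately show ?thesis by (simp only:)
qed

section \<open>Runs of the machine and satisfying assignments\<close>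

definition tm_config :: "tm \<Rightarrow> bool list \<Rightarrow> nat \<Rightarrow> config" where
  "tm_config M y t = (tm_step M ^^ t) (tm_init M y)"

lemma tape_read_fst: "tape_read tp = fst tp (snd tp)"
  by (cases tp) simp

text \<open>Heads move at most one cell per step and symbols stay in the alphabet; this is why a
  finite window of cells and a finite table of rules capture the run.\<close>

lemma tm_config_inv:
  assumes "wf_tm M"
  shows "fst (tm_config M y t) < num_states M \<and> length (snd (tm_config M y t)) = num_tapes M \<and>
    (\<forall>tp \<in> set (snd (tm_config M y t)). (\<forall>z. fst tp z < num_symbols M) \<and> \<bar>snd tp\<bar> \<le> int t)"
proof (induction t)
  case 0
  then show ?case using assms
    by (auto simp: tm_config_def tm_init_def wf_tm_def string_contents_def bit_symbol_def)
next
  case (Suc t)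
  obtain q tps where c: "tm_config M y t = (q, tps)" by fastforce
  define N where "N = tm_next M q (map tape_read tps)"
  have step: "tm_config M y (Suc t) = (fst N, map2 tape_act (snd N) tps)"
    using c tm_step_next[of M q tps] unfolding tm_config_def N_def by simp
  have q: "q < num_states M" and len: "length tps = num_tapes M"
    and tp: "\<And>tp. tp \<in> set tps \<Longrightarrow> (\<forall>z. fst tp z < num_symbols M) \<and> \<bar>snd tp\<bar> \<le> int t"
    using Suc c by auto
  have rd: "\<forall>a \<in> set (map tape_read tps). a < num_symbols M"
  proof
    fix a assume "a \<in> set (map tape_read tps)"
    then obtain tp' where "tp' \<in> set tps" "a = tape_read tp'" by auto
    then show "a < num_symbols M" using tp[of tp'] by (simp add: tape_read_fst)
  qed
  have N: "fst N < num_states M \<and> length (snd N) = num_tapes M \<and> (\<forall>z \<in> set (snd N). fst z < num_symbols M)"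
  proof (cases "q = 1")
    case True
    then show ?thesis using q len rd by (auto simp: N_def tm_next_def)
  next
    case False
    have "case delta M q (map tape_read tps) of (q', as) \<Rightarrow>
           q' < num_states M \<and> length as = num_tapes M \<and> (\<forall>(a, m) \<in> set as. a < num_symbols M)"
      using assms q len rd unfolding wf_tm_def by auto
    then show ?thesis using False by (auto simp: N_def tm_next_def split: prod.splits)
  qed
  have "(\<forall>z. fst tp' z < num_symbols M) \<and> \<bar>snd tp'\<bar> \<le> int (Suc t)" if mem: "tp' \<in> set (map2 tape_act (snd N) tps)" for tp'
  proof -
    obtain z where z: "z \<in> set (zip (snd N) tps)" "tp' = tape_act (fst z) (snd z)"
      using mem by (auto simp: case_prod_beta simp del: tape_act.simps)
    obtain a m c h where zeq: "z = ((a, m), (c, h))" by (metis prod.collapse)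
    then have *: "tp' = tape_act (a, m) (c, h)" "(a, m) \<in> set (snd N)" "(c, h) \<in> set tps"
      using z set_zip_leftD[of "(a, m)" "(c, h)"] set_zip_rightD[of "(a, m)" "(c, h)"] by auto
    then have "a < num_symbols M" "\<forall>z. c z < num_symbols M" "\<bar>h\<bar> \<le> int t" using N tp by fastforce+
    moreover have "\<bar>move_head m h\<bar> \<le> \<bar>h\<bar> + 1" by (cases m) auto
    ultimately show ?thesis using * by auto
  qed
  then show ?case using step N len by simp
qed

lemma tm_config_step:
  assumes "wf_tm M" "i < num_tapes M"
  shows "fst (tm_config M y (Suc t)) = fst (tm_next M (fst (tm_config M y t)) (map tape_read (snd (tm_config M y t))))"
    "snd (tm_config M y (Suc t)) ! i = tape_act (snd (tm_next M (fst (tm_config M y t)) (map tape_read (snd (tm_config M y t)))) ! i)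
      (snd (tm_config M y t) ! i)"
proof -
  obtain q tps where c: "tm_config M y t = (q, tps)" by fastforce
  define N where "N = tm_next M q (map tape_read tps)"
  have step: "tm_config M y (Suc t) = (fst N, map2 tape_act (snd N) tps)"
    using c tm_step_next[of M q tps] unfolding tm_config_def N_def by simp
  have "length tps = num_tapes M" "length (map2 tape_act (snd N) tps) = num_tapes M"
    using tm_config_inv[OF assms(1), of y t] tm_config_inv[OF assms(1), of y "Suc t"] c step by auto
  then show "fst (tm_config M y (Suc t)) = fst (tm_next M (fst (tm_config M y t)) (map tape_read (snd (tm_config M y t))))"
    "snd (tm_config M y (Suc t)) ! i = tape_act (snd (tm_next M (fst (tm_config M y t)) (map tape_read (snd (tm_config M y t)))) ! i)
      (snd (tm_config M y t) ! i)"
    using step c assms(2) by (auto simp: N_def)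
qed

lemma sat_tableau:
  "sat \<alpha> (tableau M x g T) \<longleftrightarrow>
     \<alpha> (at_state 0 0) \<and> (\<forall>i < num_tapes M. \<alpha> (at_head 0 i (T + 1))) \<and>
     (\<forall>i < num_tapes M. i \<noteq> 0 \<longrightarrow> (\<forall>p < 2 * T + 3. \<alpha> (at_cell 0 i p 0))) \<and>
     (\<forall>p < 2 * T + 3. clause_true \<alpha> (input_clause x g (T + 1) p)) \<and>
     (\<forall>j < g. \<alpha> (at_cell 0 0 (T + 1 + length x + j) 0) \<longrightarrow> \<alpha> (at_cell 0 0 (T + 1 + length x + Suc j) 0)) \<and>
     (\<forall>t < T. \<forall>i < num_tapes M. \<forall>p < 2 * T + 3. \<forall>a < num_symbols M. \<alpha> (at_head t i p) \<longrightarrow>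
       (\<alpha> (at_cell t i p a) \<longrightarrow> \<alpha> (at_read t i a)) \<and>
       (\<forall>p' < 2 * T + 3. p' \<noteq> p \<longrightarrow> \<alpha> (at_cell t i p' a) \<longrightarrow> \<alpha> (at_cell (Suc t) i p' a))) \<and>
     (\<forall>t < T. \<forall>r \<in> set (tm_rules M). sat \<alpha> (rule_clauses (2 * T + 3) t r)) \<and>
     (\<forall>a < num_symbols M. a \<noteq> 2 \<longrightarrow> \<not> \<alpha> (at_cell T (num_tapes M - 1) (T + 1) a)) \<and>
     (\<forall>a < num_symbols M. a \<noteq> 0 \<longrightarrow> \<not> \<alpha> (at_cell T (num_tapes M - 1) (T + 2) a))"
proof -
  have if_clause: "clause_true \<alpha> (if b then c else d) \<longleftrightarrow> (if b then clause_true \<alpha> c else clause_true \<alpha> d)" for b and c d :: "(nat list \<times> bool) list"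
    by simp
  have upt1: "(\<forall>i \<in> set [1..<n]. R i) \<longleftrightarrow> (\<forall>i < n. i \<noteq> 0 \<longrightarrow> R i)" for n and R :: "nat \<Rightarrow> bool"
    by auto
  have upt0: "(\<forall>i \<in> set [0..<n]. R i) \<longleftrightarrow> (\<forall>i < n. R i)" for n and R :: "nat \<Rightarrow> bool"
    by auto
  show ?thesis
    unfolding tableau_def sat_simps upt0 upt1 if_clause clause_true_imp clause_true_simps list.set ball_simps
    by (auto simp: clause_true_simps)
qed

text \<open>Two cells of the last tape decide acceptance: for a machine that has halted with some
  output they tell whether it is \<open>[True]\<close>, by \<open>tape_output_True\<close>.\<close>

definition tm_accepts :: "tm \<Rightarrow> bool list \<Rightarrow> nat \<Rightarrow> bool" where
  "tm_accepts M y T \<longleftrightarrow> fst (last (snd (tm_config M y T))) 0 = 2 \<and> fst (last (snd (tm_config M y T))) 1 = 0"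

definition run_assignment :: "tm \<Rightarrow> bool list \<Rightarrow> nat \<Rightarrow> nat list \<Rightarrow> bool" where
  "run_assignment M y off v \<longleftrightarrow>
     (\<exists>t q. v = at_state t q \<and> fst (tm_config M y t) = q) \<or>
     (\<exists>t i p. v = at_head t i p \<and> int p - int off = snd (snd (tm_config M y t) ! i)) \<or>
     (\<exists>t i p a. v = at_cell t i p a \<and> fst (snd (tm_config M y t) ! i) (int p - int off) = a) \<or>
     (\<exists>t i a. v = at_read t i a \<and> tape_read (snd (tm_config M y t) ! i) = a)"

lemma run_assignment_simps:
  "run_assignment M y off (at_state t q) \<longleftrightarrow> fst (tm_config M y t) = q"
  "run_assignment M y off (at_head t i p) \<longleftrightarrow> int p - int off = snd (snd (tm_config M y t) ! i)"
  "run_assignment M y off (at_cell t i p a) \<longleftrightarrow> fst (snd (tm_config M y t) ! i) (int p - int off) = a"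
  "run_assignment M y off (at_read t i a) \<longleftrightarrow> tape_read (snd (tm_config M y t) ! i) = a"
  by (auto simp: run_assignment_def at_defs)

lemma tm_config_0:
  assumes "wf_tm M" "i < num_tapes M"
  shows "fst (tm_config M y 0) = 0" "snd (tm_config M y 0) ! i = (if i = 0 then string_contents y else (\<lambda>_. 0), 0)"
  using assms by (auto simp: tm_config_def tm_init_def nth_Cons split: nat.splits)

lemma tm_accepts_sat:
  assumes wf: "wf_tm M" and u: "length u \<le> g" and T: "length x + g \<le> T" and acc: "tm_accepts M (x @ u) T"
  shows "sat (run_assignment M (x @ u) (T + 1)) (tableau M x g T)"
proof -
  let ?y = "x @ u" and ?k = "num_tapes M"
  let ?\<alpha> = "run_assignment M ?y (T + 1)"
  note rs = run_assignment_simps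
  have k: "0 < ?k" using wf by (simp add: wf_tm_def)
  note init = tm_config_0[OF wf]
  have lastk: "last (snd (tm_config M ?y T)) = snd (tm_config M ?y T) ! (?k - 1)"
    using tm_config_inv[OF wf, of ?y T] k by (metis last_conv_nth length_0_conv less_irrefl)
  have inp: "clause_true ?\<alpha> (input_clause x g (T + 1) p)" for p
  proof -
    consider "p < T + 1" | j where "p = T + 1 + j" "j < length x" | j where "p = T + 1 + j" "length x \<le> j" "j < length x + g"
      | j where "p = T + 1 + j" "length x + g \<le> j"
      by (metis add_diff_inverse_nat not_less)
    then show ?thesis
    proof cases
      case 1
      then show ?thesis
        using init[OF k] by (simp add: input_clause_def clause_true_simps rs string_contents_def)
    next
      case 2
      then show ?thesis
        using init[OF k] by (simp add: input_clause_def clause_true_simps rs string_contents_def nthd_nth nth_append bit_symbol_def)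
    next
      case 3
      have "string_contents ?y (int j) \<in> {0, 1, 2}"
        by (auto simp: string_contents_def bit_symbol_def)
      then show ?thesis
        using 3 init[OF k] by (auto simp: input_clause_def clause_true_simps rs)
    next
      case 4
      then show ?thesis
        using init[OF k] u by (simp add: input_clause_def clause_true_simps rs string_contents_def)
    qed
  qed
  have guess: "?\<alpha> (at_cell 0 0 (T + 1 + length x + j) 0) \<longrightarrow> ?\<alpha> (at_cell 0 0 (T + 1 + length x + Suc j) 0)" for j
    using init[OF k] by (auto simp: rs string_contents_def split: if_splits)
  have frame: "?\<alpha> (at_cell (Suc t) i p' a)" if "i < ?k" "?\<alpha> (at_head t i p)" "p' \<noteq> p" "?\<alpha> (at_cell t i p' a)" for t i p p' a
  proof -
    obtain c h where ch: "snd (tm_config M ?y t) ! i = (c, h)" by fastforce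
    obtain b m where bm: "snd (tm_next M (fst (tm_config M ?y t)) (map tape_read (snd (tm_config M ?y t)))) ! i = (b, m)" by fastforce
    have "snd (tm_config M ?y (Suc t)) ! i = tape_act (b, m) (c, h)"
      using tm_config_step(2)[OF wf that(1), of ?y t] ch bm by simp
    moreover have "int p' - int (T + 1) \<noteq> h" using that ch by (auto simp: rs)
    ultimately show ?thesis using that ch by (simp add: rs)
  qed
  have rules: "sat ?\<alpha> (rule_clauses (2 * T + 3) t r)" if t: "t < T" and r: "r \<in> set (tm_rules M)" for t r
  proof -
    have "\<forall>r \<in> set (tm_rules M). sat ?\<alpha> (rule_clauses (2 * T + 3) t r)"
      unfolding tm_rules_sat
    proof (intro allI impI)
      fix q ss
      assume "length ss = ?k" and q: "?\<alpha> (at_state t q)" and ss: "\<forall>i < ?k. ?\<alpha> (at_read t i (ss ! i))"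
      let ?c = "tm_config M ?y t"
      have "length (snd ?c) = ?k" using tm_config_inv[OF wf, of ?y t] by simp
      then have sseq: "map tape_read (snd ?c) = ss"
        using ss \<open>length ss = ?k\<close> by (intro nth_equalityI) (auto simp: rs)
      have qeq: "fst ?c = q" using q by (simp add: rs)
      note step = tm_config_step[OF wf, of _ ?y t, unfolded sseq qeq]
      show "?\<alpha> (at_state (Suc t) (fst (tm_next M q ss))) \<and>
         (\<forall>i < ?k. \<forall>p < 2 * T + 3. ?\<alpha> (at_head t i p) \<longrightarrow>
           ?\<alpha> (at_head (Suc t) i (p + move_code (snd (snd (tm_next M q ss) ! i)) - 1)) \<and>
           ?\<alpha> (at_cell (Suc t) i p (fst (snd (tm_next M q ss) ! i))))"
      proof (intro conjI allI impI)
        show "?\<alpha> (at_state (Suc t) (fst (tm_next M q ss)))" using step(1)[OF k] by (simp add: rs)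
        fix i p assume i: "i < ?k" and p: "?\<alpha> (at_head t i p)"
        obtain c h where ch: "snd ?c ! i = (c, h)" by fastforce
        obtain b m where bm: "snd (tm_next M q ss) ! i = (b, m)" by fastforce
        have nxt: "snd (tm_config M ?y (Suc t)) ! i = (c(h := b), move_head m h)"
          using step(2)[OF i] ch bm by simp
        have h: "int p - int (T + 1) = h" using p ch by (simp add: rs)
        have "(c, h) \<in> set (snd ?c)" using ch i \<open>length (snd ?c) = ?k\<close> by (metis nth_mem)
        then have "\<bar>h\<bar> \<le> int t" using tm_config_inv[OF wf, of ?y t] by fastforce
        \<comment> \<open>Before step \<open>T\<close> a head is fewer than \<open>T\<close> cells
          from the origin, and the offset \<open>T + 1\<close> makes its position positive. Moves
          are coded by 0, 1 and 2, so the truncated subtraction of 1 in the new position is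
          exact.\<close>
        then have "1 \<le> p" using h t by linarith
        then show "?\<alpha> (at_head (Suc t) i (p + move_code (snd (snd (tm_next M q ss) ! i)) - 1))"
          using h bm nxt by (cases m) (auto simp: rs)
        show "?\<alpha> (at_cell (Suc t) i p (fst (snd (tm_next M q ss) ! i)))"
          using h bm nxt by (simp add: rs)
      qed
    qed
    then show ?thesis using r by blast
  qed
  show ?thesis
    unfolding sat_tableau
    using inp guess frame rules acc lastk init init[OF k]
    by (auto simp: rs tm_accepts_def tape_read_fst string_contents_def)
qed

text \<open>By induction on time, the state, head and cell atoms that describe the run on
  \<open>x @ u\<close> are true under \<open>\<alpha>\<close>. The assignment may make further atoms
  true, since uniqueness of states, positions and symbols is nowhere demanded; but the negative
  clauses forbid every wrong symbol in the two output cells, so the run must have the right ones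
  there.\<close>

lemma sat_tm_accepts:
  assumes wf: "wf_tm M" and T: "length x + g \<le> T" and sat: "sat \<alpha> (tableau M x g T)"
  shows "\<exists>u. length u \<le> g \<and> tm_accepts M (x @ u) T"
proof -
  let ?k = "num_tapes M" and ?P = "2 * T + 3" and ?off = "T + 1"
  have k: "0 < ?k" using wf by (simp add: wf_tm_def)
  have state0: "\<alpha> (at_state 0 0)" and head0: "\<And>i. i < ?k \<Longrightarrow> \<alpha> (at_head 0 i ?off)"
    and blank0: "\<And>i p. i < ?k \<Longrightarrow> i \<noteq> 0 \<Longrightarrow> p < ?P \<Longrightarrow> \<alpha> (at_cell 0 i p 0)"
    and inp: "\<And>p. p < ?P \<Longrightarrow> clause_true \<alpha> (input_clause x g ?off p)"
    and guess: "\<And>j. j < g \<Longrightarrow> \<alpha> (at_cell 0 0 (?off + length x + j) 0) \<Longrightarrow> \<alpha> (at_cell 0 0 (?off + length x + Suc j) 0)"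
    and read: "\<And>t i p a. t < T \<Longrightarrow> i < ?k \<Longrightarrow> p < ?P \<Longrightarrow> a < num_symbols M \<Longrightarrow> \<alpha> (at_head t i p) \<Longrightarrow>
      \<alpha> (at_cell t i p a) \<Longrightarrow> \<alpha> (at_read t i a)"
    and frame: "\<And>t i p a p'. t < T \<Longrightarrow> i < ?k \<Longrightarrow> p < ?P \<Longrightarrow> a < num_symbols M \<Longrightarrow> \<alpha> (at_head t i p) \<Longrightarrow>
      p' < ?P \<Longrightarrow> p' \<noteq> p \<Longrightarrow> \<alpha> (at_cell t i p' a) \<Longrightarrow> \<alpha> (at_cell (Suc t) i p' a)"
    and rules: "\<And>t. t < T \<Longrightarrow> \<forall>r \<in> set (tm_rules M). sat \<alpha> (rule_clauses ?P t r)"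
    and fin: "\<And>a. a < num_symbols M \<Longrightarrow> a \<noteq> 2 \<Longrightarrow> \<not> \<alpha> (at_cell T (?k - 1) (T + 1) a)"
      "\<And>a. a < num_symbols M \<Longrightarrow> a \<noteq> 0 \<Longrightarrow> \<not> \<alpha> (at_cell T (?k - 1) (T + 2) a)"
    using sat unfolding sat_tableau by simp_all
  let ?bl = "\<lambda>j. \<alpha> (at_cell 0 0 (?off + length x + j) 0)"
  have "?bl g" using inp[of "?off + length x + g"] T by (simp add: input_clause_def clause_true_simps)
  \<comment> \<open>The certificate ends at the first blank after \<open>x\<close>. It exists
    because the cell just behind the open region is forced to be blank.\<close>
  define L where "L = (LEAST j. ?bl j)"
  have L: "?bl L" "L \<le> g" "\<And>j. j < L \<Longrightarrow> \<not> ?bl j"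
    using LeastI[of ?bl, OF \<open>?bl g\<close>] Least_le[of ?bl, OF \<open>?bl g\<close>] not_less_Least[of _ ?bl] by (auto simp: L_def)
  have after: "?bl j" if "L \<le> j" "j \<le> g" for j
    using that
  proof (induction j rule: dec_induct)
    case base
    then show ?case using L by simp
  next
    case (step j)
    then show ?case using guess[of j] by simp
  qed
  \<comment> \<open>An open cell may satisfy the atoms of both symbols 1 and 2. The atom for 2 then
    decides the bit; if it is false, the input clause yields the atom for 1.\<close>
  define u where "u = map (\<lambda>j. \<alpha> (at_cell 0 0 (?off + length x + j) 2)) [0..<L]"
  let ?y = "x @ u"
  note init = tm_config_0[OF wf, of _ ?y]
  have ulen: "length u = L" by (simp add: u_def)
  have cell0: "\<alpha> (at_cell 0 0 p (string_contents ?y (int p - int ?off)))" if p: "p < ?P" for p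
  proof -
    consider "p < ?off" | j where "p = ?off + j" "j < length x" | j where "p = ?off + length x + j" "j < L"
      | j where "p = ?off + length x + j" "L \<le> j" "j < g" | j where "p = ?off + length x + j" "g \<le> j"
      by (metis add.assoc add_diff_inverse_nat not_less)
    then show ?thesis
    proof cases
      case 1
      then show ?thesis using inp[OF p] by (simp add: input_clause_def clause_true_simps string_contents_def)
    next
      case 2
      then show ?thesis using inp[OF p]
        by (simp add: input_clause_def clause_true_simps string_contents_def nthd_nth nth_append bit_symbol_def split: if_splits)
    next
      case 3
      then have j: "j < g" using L(2) by simp
      have "\<not> \<alpha> (at_cell 0 0 p 0)" using L(3)[OF 3(2)] 3(1) by simp
      then have "\<alpha> (at_cell 0 0 p 1) \<or> \<alpha> (at_cell 0 0 p 2)"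
        using inp[OF p] 3(1) j by (simp add: input_clause_def clause_true_simps)
      moreover have "string_contents ?y (int p - int ?off) = bit_symbol (\<alpha> (at_cell 0 0 p 2))"
        using 3 ulen by (simp add: string_contents_def nth_append nat_add_distrib u_def)
      ultimately show ?thesis by (auto simp: bit_symbol_def)
    next
      case 4
      then show ?thesis using after[of j] ulen by (simp add: string_contents_def)
    next
      case 5
      then show ?thesis using inp[OF p] ulen L(2) by (simp add: input_clause_def clause_true_simps string_contents_def)
    qed
  qed
  let ?c = "tm_config M ?y"
  have inv: "\<alpha> (at_state t (fst (?c t))) \<and>
      (\<forall>i < ?k. \<alpha> (at_head t i (nat (snd (snd (?c t) ! i) + int ?off)))) \<and>
      (\<forall>i < ?k. \<forall>p < ?P. \<alpha> (at_cell t i p (fst (snd (?c t) ! i) (int p - int ?off))))" if "t \<le> T" for t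
    using that
  proof (induction t)
    case 0
    then show ?case using state0 head0 blank0 cell0 init k by (auto simp: nat_add_distrib)
  next
    case (Suc t)
    then have t: "t < T" and IH: "\<alpha> (at_state t (fst (?c t)))"
      "\<And>i. i < ?k \<Longrightarrow> \<alpha> (at_head t i (nat (snd (snd (?c t) ! i) + int ?off)))"
      "\<And>i p. i < ?k \<Longrightarrow> p < ?P \<Longrightarrow> \<alpha> (at_cell t i p (fst (snd (?c t) ! i) (int p - int ?off)))"
      by auto
    note ci = tm_config_inv[OF wf, of ?y t]
    let ?ss = "map tape_read (snd (?c t))"
    let ?N = "tm_next M (fst (?c t)) ?ss"
    have mem: "snd (?c t) ! i \<in> set (snd (?c t))" if "i < ?k" for i using ci that by simp
    have sym: "fst (snd (?c t) ! i) z < num_symbols M" and hb: "\<bar>snd (snd (?c t) ! i)\<bar> \<le> int t" if "i < ?k" for i z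
      using ci mem[OF that] by auto
    define pos where "pos i = nat (snd (snd (?c t) ! i) + int ?off)" for i
    \<comment> \<open>Heads stay at positions between 1 and \<open>2 * T + 1\<close>. The window of
      \<open>2 * T + 3\<close> cells contains these, and even for \<open>T = 0\<close> also the
      output cells \<open>T + 1\<close> and \<open>T + 2\<close>.\<close>
    have pos: "int (pos i) - int ?off = snd (snd (?c t) ! i)" "1 \<le> pos i" "pos i < ?P" if "i < ?k" for i
      using hb[OF that] t by (auto simp: pos_def)
    have rd: "\<alpha> (at_read t i (?ss ! i))" if i: "i < ?k" for i
    proof -
      have "\<alpha> (at_cell t i (pos i) (tape_read (snd (?c t) ! i)))"
        using IH(3)[OF i pos(3)[OF i]] pos(1)[OF i] by (simp add: tape_read_fst)
      then have "\<alpha> (at_read t i (tape_read (snd (?c t) ! i)))"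
        using read[OF t i pos(3)[OF i] _ IH(2)[OF i, folded pos_def]] sym[OF i] by (simp add: tape_read_fst)
      then show ?thesis using i ci by simp
    qed
    have ss: "\<forall>a \<in> set ?ss. a < num_symbols M" using ci by (auto simp: tape_read_fst)
    have st: "\<alpha> (at_state (Suc t) (fst ?N)) \<and> (\<forall>i < ?k. \<forall>p < ?P. \<alpha> (at_head t i p) \<longrightarrow>
       \<alpha> (at_head (Suc t) i (p + move_code (snd (snd ?N ! i)) - 1)) \<and> \<alpha> (at_cell (Suc t) i p (fst (snd ?N ! i))))"
      using iffD1[OF tm_rules_sat rules[OF t], rule_format, of "fst (?c t)" ?ss] ci ss IH(1) rd by simp
    note step = tm_config_step[OF wf, of _ ?y t]
    have new: "fst (snd (?c (Suc t)) ! i) = (fst (snd (?c t) ! i))(snd (snd (?c t) ! i) := fst (snd ?N ! i))"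
      "snd (snd (?c (Suc t)) ! i) = move_head (snd (snd ?N ! i)) (snd (snd (?c t) ! i))" if i: "i < ?k" for i
      unfolding step(2)[OF i] by (cases "snd ?N ! i"; cases "snd (?c t) ! i"; simp)+
    show ?case
    proof (intro conjI allI impI)
      show "\<alpha> (at_state (Suc t) (fst (?c (Suc t))))" using st step(1)[OF k] by simp
      fix i assume i: "i < ?k"
      have hd: "\<alpha> (at_head t i (pos i))" using IH(2)[OF i] by (simp add: pos_def)
      have "pos i + move_code (snd (snd ?N ! i)) - 1 = nat (snd (snd (?c (Suc t)) ! i) + int ?off)"
        using new(2)[OF i] pos[OF i] by (cases "snd (snd ?N ! i)") auto
      then show "\<alpha> (at_head (Suc t) i (nat (snd (snd (?c (Suc t)) ! i) + int ?off)))"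
        using st i pos(3)[OF i] hd by metis
      fix p assume p: "p < ?P"
      show "\<alpha> (at_cell (Suc t) i p (fst (snd (?c (Suc t)) ! i) (int p - int ?off)))"
      proof (cases "p = pos i")
        case True
        then have "fst (snd (?c (Suc t)) ! i) (int p - int ?off) = fst (snd ?N ! i)"
          using new(1)[OF i] pos(1)[OF i] by simp
        then show ?thesis using st i p hd True by metis
      next
        case False
        then have "fst (snd (?c (Suc t)) ! i) (int p - int ?off) = fst (snd (?c t) ! i) (int p - int ?off)"
          using new(1)[OF i] pos(1)[OF i] by auto
        then show ?thesis
          using frame[OF t i pos(3)[OF i] sym[OF i] hd p False IH(3)[OF i p]] by simp
      qed
    qed
  qed
  have lastk: "last (snd (?c T)) = snd (?c T) ! (?k - 1)"
    using tm_config_inv[OF wf, of ?y T] k by (metis last_conv_nth length_0_conv less_irrefl)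
  have k1: "?k - 1 < ?k" using k by simp
  have sym: "fst (snd (?c T) ! (?k - 1)) z < num_symbols M" for z
    using tm_config_inv[OF wf, of ?y T] k1 by (metis nth_mem)
  have cell: "\<alpha> (at_cell T (?k - 1) p (fst (snd (?c T) ! (?k - 1)) (int p - int ?off)))" if "p < ?P" for p
    using inv[of T] k1 that by blast
  have "fst (snd (?c T) ! (?k - 1)) 0 = 2" using cell[of "T + 1"] fin(1) sym[of 0] by fastforce
  moreover have "fst (snd (?c T) ! (?k - 1)) 1 = 0" using cell[of "T + 2"] fin(2) sym[of 1] by fastforce
  ultimately have "tm_accepts M ?y T" unfolding tm_accepts_def lastk by simp
  then show ?thesis using ulen L(2) by blast
qed

section \<open>Reduction of an arbitrary language in NP\<close>

lemma poly_nat_mono: "m \<le> n \<Longrightarrow> poly p m \<le> poly (p :: nat poly) n"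
  by (induction p) (auto intro: mult_le_mono)

lemma length_enc_bits: "length (enc_bits x) = 2 * length x + 1"
  by (induction x) (auto simp: enc_bits_def)

lemma tape_output_True: "tape_output tp y \<Longrightarrow> y = [True] \<longleftrightarrow> fst tp 0 = 2 \<and> fst tp 1 = 0"
proof -
  assume out: "tape_output tp y"
  show ?thesis
  proof (cases y)
    case Nil
    then show ?thesis using out by (simp add: tape_output_def)
  next
    case (Cons b bs)
    have "fst tp 0 = bit_symbol b" using out Cons by (force simp: tape_output_def)
    moreover have "fst tp 1 = 0 \<longleftrightarrow> bs = []"
    proof (cases bs)
      case Nil
      then show ?thesis using out Cons by (simp add: tape_output_def)
    next
      case (Cons c ds)
      then have "fst tp (int 1) = bit_symbol c"
        using out \<open>y = b # bs\<close> unfolding tape_output_def by (metis One_nat_def Suc_less_eq length_Cons nth_Cons_0 nth_Cons_Suc zero_less_Suc)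
      then show ?thesis using Cons by simp
    qed
    ultimately show ?thesis using Cons by auto
  qed
qed

lemma halts_accepts:
  assumes "tm_halts_with M y t z" "t \<le> T"
  shows "tm_accepts M y T \<longleftrightarrow> z = [True]"
proof -
  obtain tps where tps: "(tm_step M ^^ t) (tm_init M y) = (1, tps)" "tape_output (last tps) z"
    using assms(1) unfolding tm_halts_with_def by (auto split: prod.splits)
  have "tm_config M y T = (tm_step M ^^ (T - t + t)) (tm_init M y)"
    using assms(2) by (simp add: tm_config_def)
  then have "tm_config M y T = (1, tps)"
    unfolding funpow_add using tps(1) tm_step_halted[where M = M] by simp
  then show ?thesis
    unfolding tm_accepts_def tape_output_True[OF tps(2)] by simp
qed

theorem NP_hard_o2o_rtt: "NP_hard o2o_rtt"
  unfolding NP_hard_def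
proof
  fix A assume "A \<in> NP"
  then obtain V p where V: "poly_time V"
    "\<And>x. x \<in> A \<longleftrightarrow> (\<exists>u. length u \<le> poly p (length x) \<and> V (string_pair x u) = [True])"
    unfolding NP_def by blast
  obtain M q where M: "wf_tm M" "\<And>x. tm_halts_with M x (poly q (length x)) (V x)"
    using V(1) unfolding poly_time_def by blast
  \<comment> \<open>\<open>B x\<close> bounds the length of the verifier's input
    \<open>enc_bits x @ u\<close>. \<open>T x\<close> is at least the time bound for such inputs,
    and also at least \<open>B x\<close>, so that the input fits into the window.\<close>
  define B where "B x = length (enc_bits x) + poly p (length x)" for x
  define T where "T x = poly q (B x) + B x" for x
  define f where "f x = enc_instance (cnf_instance (tableau M (enc_bits x) (poly p (length x)) (T x)))" for x
  have "ptime f"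
    unfolding f_def T_def B_def by (intro ptime_enc_cnf_instance ptime_tableau ptime_intros)
  moreover have "x \<in> A \<longleftrightarrow> f x \<in> o2o_rtt" for x
  proof -
    have acc: "tm_accepts M (enc_bits x @ u) (T x) \<longleftrightarrow> V (string_pair x u) = [True]" if "length u \<le> poly p (length x)" for u
    proof -
      have "poly q (length (enc_bits x @ u)) \<le> poly q (B x)"
        using that by (intro poly_nat_mono) (simp add: B_def)
      then have "poly q (length (enc_bits x @ u)) \<le> T x" by (simp add: T_def)
      from halts_accepts[OF M(2) this] show ?thesis by (simp add: string_pair_def)
    qed
    have T: "length (enc_bits x) + poly p (length x) \<le> T x" by (simp add: T_def B_def)
    have "(\<exists>\<alpha>. sat \<alpha> (tableau M (enc_bits x) (poly p (length x)) (T x))) \<longleftrightarrow>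
        (\<exists>u. length u \<le> poly p (length x) \<and> tm_accepts M (enc_bits x @ u) (T x))"
      using tm_accepts_sat[OF M(1) _ T] sat_tm_accepts[OF M(1) T] by blast
    then show ?thesis
      unfolding f_def cnf_instance_in_o2o_rtt V(2) using acc by auto
  qed
  ultimately show "poly_reducible A o2o_rtt"
    unfolding poly_reducible_def using ptime_poly_time by blast
qed

text \<open>The equation of lists says at once that the first segment starts at \<open>s\<close>,
  that each segment starts where the previous one ends, and that the last one ends at
  \<open>t\<close>; for an empty route it gives \<open>s = t\<close>.\<close>

definition route :: "'v list list \<Rightarrow> 'v \<Rightarrow> 'v \<Rightarrow> (nat \<times> nat \<times> nat) list \<Rightarrow> bool" where
  "route TS s t rs \<longleftrightarrow>
     distinct (map fst rs) \<and> (\<forall>(k, a, b) \<in> set rs. k < length TS \<and> a < b \<and> b < length (TS ! k)) \<and>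
     map (\<lambda>(k, a, b). TS ! k ! a) rs @ [t] = s # map (\<lambda>(k, a, b). TS ! k ! b) rs"

lemma reach_iff_route: "(\<exists>U. reach TS s U t) \<longleftrightarrow> (\<exists>rs. route TS s t rs)"
proof
  have "\<exists>rs. fst ` set rs \<subseteq> U \<and> route TS s t rs" if "reach TS s U t" for U
    using that
  proof (induction rule: reach.induct)
    case reach_refl
    show ?case by (rule exI[of _ "[]"]) (simp add: route_def)
  next
    case (reach_step U u k a b)
    then obtain rs where "fst ` set rs \<subseteq> U" "route TS s u rs" by blast
    with reach_step.hyps show ?case
      by (intro exI[of _ "rs @ [(k, a, b)]"]) (auto simp: route_def simp flip: append_assoc)
  qed
  then show "\<exists>U. reach TS s U t \<Longrightarrow> \<exists>rs. route TS s t rs" by blast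
  have "reach TS s (fst ` set rs) t" if "route TS s t rs" for rs
    using that
  proof (induction rs arbitrary: t rule: rev_induct)
    case Nil
    then show ?case using reach.reach_refl by (simp add: route_def)
  next
    case (snoc h rs)
    obtain k a b where h: "h = (k, a, b)" by (metis prod_cases3)
    have "(map (\<lambda>(k, a, b). TS ! k ! a) rs @ [TS ! k ! a]) @ [t] = (s # map (\<lambda>(k, a, b). TS ! k ! b) rs) @ [TS ! k ! b]"
      using snoc.prems h by (simp add: route_def)
    then have eq: "map (\<lambda>(k, a, b). TS ! k ! a) rs @ [TS ! k ! a] = s # map (\<lambda>(k, a, b). TS ! k ! b) rs" and t: "t = TS ! k ! b"
      unfolding append1_eq_conv by blast+
    then have "reach TS s (fst ` set rs) (TS ! k ! a)"
      using snoc.prems by (intro snoc.IH) (auto simp: route_def)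
    then have "reach TS s (insert k (fst ` set rs)) (TS ! k ! b)"
      using snoc.prems h by (intro reach.reach_step) (auto simp: route_def)
    then show ?case using h t by simp
  qed
  then show "\<exists>rs. route TS s t rs \<Longrightarrow> \<exists>U. reach TS s U t" by blast
qed

section \<open>A polynomial-time verifier\<close>

text \<open>Reading a tree as the list of left subtrees along its right spine loses nothing and
  changes no bit of the code. The decoders of the other types are computed from this view by list
  functions.\<close>

lemma of_tree_bt_list: "to_tree (of_tree t :: bt list) = t"
  by (induction t) auto

lemma ptime_of_tree_spine: "ptime f \<Longrightarrow> ptime (\<lambda>e. of_tree (f e) :: bt list)"
  by (rule ptime_comp[of of_tree], rule ptime_cast) (auto simp: of_tree_bt_list)

lemma of_tree_nat_spine: "of_tree t = length (of_tree t :: bt list)"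
  by (induction t) auto

lemma ptime_of_tree_nat [ptime_intros]: "ptime f \<Longrightarrow> ptime (\<lambda>e. of_tree (f e) :: nat)"
  unfolding of_tree_nat_spine by (intro ptime_intros ptime_of_tree_spine)

lemma ptime_of_tree_bool [ptime_intros]: "ptime f \<Longrightarrow> ptime (\<lambda>e. of_tree (f e) :: bool)"
  unfolding of_tree_bool_def by (intro ptime_intros)

lemma of_tree_list_spine: "of_tree t = map of_tree (of_tree t :: bt list)"
  by (induction t) auto

lemma ptime_of_tree_list [ptime_intros]:
  assumes "ptime (of_tree :: bt \<Rightarrow> 'a::enc)" "ptime f"
  shows "ptime (\<lambda>e. of_tree (f e) :: 'a list)"
proof -
  have "ptime (\<lambda>e. map of_tree (of_tree (f e) :: bt list) :: 'a list)"
    by (intro ptime_intros ptime_of_tree_spine assms ptime_comp[OF assms(1)])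
  moreover have "(\<lambda>e. of_tree (f e) :: 'a list) = (\<lambda>e. map of_tree (of_tree (f e) :: bt list))"
    by (intro ext of_tree_list_spine)
  ultimately show ?thesis by (simp only:)
qed

lemma of_tree_prod_spine:
  "of_tree t = (if (of_tree t :: bt list) = [] then (of_tree Lf, of_tree Lf) else (of_tree (hd (of_tree t :: bt list)), of_tree (to_tree (tl (of_tree t :: bt list)))))"
  by (cases t) (auto simp: of_tree_prod_def of_tree_bt_list)

lemma ptime_to_tree_list: "ptime f \<Longrightarrow> ptime (\<lambda>e. to_tree (f e :: bt list))"
  by (rule ptime_comp[of to_tree], rule ptime_cast) auto

lemma ptime_of_tree_prod [ptime_intros]:
  assumes "ptime (of_tree :: bt \<Rightarrow> 'a::enc)" "ptime (of_tree :: bt \<Rightarrow> 'b::enc)" "ptime f"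
  shows "ptime (\<lambda>e. of_tree (f e) :: 'a \<times> 'b)"
  unfolding of_tree_prod_spine
  by (intro ptime_if ptime_eq ptime_of_tree_spine ptime_const ptime_pair ptime_comp[OF assms(1)] ptime_comp[OF assms(2)] ptime_hd ptime_tl ptime_to_tree_list assms)

text \<open>The code is a preorder word, so read from right to left it can be evaluated with a stack
  of trees: a leaf is pushed, an inner node joins the two topmost trees. On malformed input the
  stack is emptied.\<close>

definition parse_step :: "bool \<Rightarrow> bt list \<Rightarrow> bt list" where
  "parse_step b ts = (if b then (if ts = [] \<or> tl ts = [] then [] else Nd (hd ts) (hd (tl ts)) # tl (tl ts)) else Lf # ts)"

lemma parse_step_simps: "parse_step True (a # b # ts) = Nd a b # ts" "parse_step False ts = Lf # ts"
  by (simp_all add: parse_step_def)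

text \<open>The appended \<open>Lf\<close> is the default result when the stack ends up
  empty.\<close>

definition parse :: "bool list \<Rightarrow> bt" where
  "parse u = hd (fold parse_step (rev u) [] @ [Lf])"

lemma parse_code: "parse (code t) = t"
proof -
  have "foldr parse_step (code t @ r) [] = t # foldr parse_step r []" for r
  proof (induction t arbitrary: r)
    case (Nd a b)
    have "foldr parse_step (code a @ code b @ r) [] = a # b # foldr parse_step r []"
      using Nd(1)[of "code b @ r"] Nd(2)[of r] by simp
    then show ?case by (simp add: parse_step_simps)
  qed (simp add: parse_step_simps)
  from this[of "[]"] show ?thesis by (simp add: parse_def foldr_conv_fold)
qed

lemma enc_size_parse_step: "enc_size (parse_step b ts) \<le> enc_size ts + 2"
proof (cases "b \<and> ts \<noteq> [] \<and> tl ts \<noteq> []")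
  case True
  then obtain x y zs where "ts = x # y # zs" by (metis list.exhaust_sel)
  then show ?thesis using True by (simp add: parse_step_def enc_size_def)
next
  case False
  then show ?thesis using enc_size_pos[of ts] by (auto simp: parse_step_def) (simp_all add: enc_size_def)
qed

lemma ptime_parse [ptime_intros]: "ptime f \<Longrightarrow> ptime (\<lambda>e. parse (f e))"
proof -
  have nd: "ptime (\<lambda>e. Nd (g e) (h e))" if "ptime g" "ptime h" for g h :: "bool list \<times> bool \<times> bt list \<Rightarrow> bt"
    by (rule ptime_comp2[of Nd, OF _ that], rule ptime_cast) auto
  have enc_size: "enc_size (fold parse_step us ts) \<le> 2 * length us + enc_size ts" for us ts
  proof (induction us arbitrary: ts)
    case (Cons b us)
    show ?case using Cons[of "parse_step b ts"] enc_size_parse_step[of b ts] by simp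
  qed simp
  have "ptime (\<lambda>u. fold parse_step (rev u) [])"
  proof (rule ptime_fold[where f = "\<lambda>e. parse_step" and p = "\<lambda>n. 2 * n + 1"])
    show "ptime (\<lambda>z::bool list \<times> bool \<times> bt list. parse_step (fst (snd z)) (snd (snd z)))"
      unfolding parse_step_def by (intro ptime_intros nd)
    fix u :: "bool list" and i
    show "enc_size (fold parse_step (take i (rev u)) []) \<le> 2 * enc_size u + 1"
      using enc_size[of "take i (rev u)" "[]"] length_less_enc_size[of u] by simp
  qed (intro ptime_intros poly_bounded_intros)+
  then have "ptime parse"
    unfolding parse_def by (intro ptime_intros)
  then show "ptime f \<Longrightarrow> ptime (\<lambda>e. parse (f e))" by (rule ptime_comp)
qed

section \<open>Certificates and the tests on them\<close>

type_synonym cert = "nat \<times> (nat \<times> nat \<times> bool list \<times> bool list) list \<times> nat list list \<times> nat \<times> nat \<times> (nat \<times> nat \<times> nat) list"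

abbreviation "c_nodes c \<equiv> fst c"
abbreviation "c_arcs c \<equiv> fst (snd c)"
abbreviation "c_trips c \<equiv> fst (snd (snd c))"
abbreviation "c_source c \<equiv> fst (snd (snd (snd c)))"
abbreviation "c_target c \<equiv> fst (snd (snd (snd (snd c))))"
abbreviation "c_route c \<equiv> snd (snd (snd (snd (snd c))))"

definition cert_enc :: "cert \<Rightarrow> bool list" where
  "cert_enc c = enc_nat (c_nodes c) @
     enc_list (\<lambda>a. enc_nat (fst a) @ enc_nat (fst (snd a)) @ enc_bits (fst (snd (snd a))) @ enc_bits (snd (snd (snd a)))) (c_arcs c) @
     enc_list (enc_list enc_nat) (c_trips c) @ enc_nat (c_source c) @ enc_nat (c_target c)"

text \<open>Numerals have the least significant bit first, so those of positive numbers are the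
  nonempty strings whose last bit is \<open>True\<close>. Positivity of a weight is thus tested
  without its value.\<close>

definition canonical :: "bool list \<Rightarrow> bool" where
  "canonical bs \<longleftrightarrow> bs \<noteq> [] \<and> hd (rev bs)"

definition cert_trip_nodes :: "cert \<Rightarrow> nat list \<Rightarrow> nat list" where
  "cert_trip_nodes c T = map (\<lambda>e. fst (nthd (c_arcs c) e)) T @ [fst (snd (nthd (c_arcs c) (hd (rev T))))]"

definition cert_valid :: "cert \<Rightarrow> bool" where
  "cert_valid c \<longleftrightarrow>
     (\<forall>a \<in> set (c_arcs c). fst a < c_nodes c \<and> fst (snd a) < c_nodes c \<and> canonical (fst (snd (snd a))) \<and> canonical (snd (snd (snd a)))) \<and>
     (\<forall>T \<in> set (c_trips c). T \<noteq> [] \<and> (\<forall>e \<in> set T. e < length (c_arcs c)) \<and>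
       (\<forall>i \<in> set [0..<length T - 1]. fst (snd (nthd (c_arcs c) (nthd T i))) = fst (nthd (c_arcs c) (nthd T (Suc i))))) \<and>
     (\<forall>v \<in> set [0..<c_nodes c]. \<exists>T \<in> set (c_trips c). \<exists>e \<in> set T.
       v = fst (nthd (c_arcs c) e) \<or> v = fst (snd (nthd (c_arcs c) e))) \<and>
     (\<forall>e \<in> set [0..<length (c_arcs c)]. \<exists>T \<in> set (c_trips c). e \<in> set T) \<and>
     c_source c < c_nodes c \<and> c_target c < c_nodes c"

definition cert_route_ok :: "cert \<Rightarrow> bool" where
  "cert_route_ok c \<longleftrightarrow>
     length (dedup (map fst (c_route c))) = length (c_route c) \<and>
     (\<forall>h \<in> set (c_route c). fst h < length (c_trips c) \<and> fst (snd h) < snd (snd h) \<and>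
       snd (snd h) < length (cert_trip_nodes c (nthd (c_trips c) (fst h)))) \<and>
     map (\<lambda>h. nthd (cert_trip_nodes c (nthd (c_trips c) (fst h))) (fst (snd h))) (c_route c) @ [c_target c] =
     c_source c # map (\<lambda>h. nthd (cert_trip_nodes c (nthd (c_trips c) (fst h))) (snd (snd h))) (c_route c)"

text \<open>Nothing is decoded from the input \<open>y\<close>: the certificate contains the
  instance in decoded form, which is encoded again and compared. Only the easy direction of the
  encoding needs a program.\<close>

definition verify :: "bool list \<Rightarrow> bool list \<Rightarrow> cert \<Rightarrow> bool" where
  "verify y u c \<longleftrightarrow> y = enc_bits (cert_enc c) @ u \<and> cert_valid c \<and> cert_route_ok c"

text \<open>The end of the instance in the input is not searched for: all suffixes are tried as certificates, and only
  the right one can succeed because \<open>enc_bits\<close> is a prefix code.\<close>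

definition verifier :: "bool list \<Rightarrow> bool list" where
  "verifier y = [\<exists>i \<in> set [0..<Suc (length y)]. verify y (drop i y) (of_tree (parse (drop i y)))]"

lemma ptime_verifier: "ptime verifier"
proof -
  have "ptime (\<lambda>z :: bool list \<times> bool list \<times> cert. verify (fst z) (fst (snd z)) (snd (snd z)))"
    unfolding verify_def cert_enc_def cert_valid_def canonical_def cert_route_ok_def cert_trip_nodes_def
    by (intro ptime_intros)
  note verify = ptime_comp3[OF this]
  show ?thesis
    unfolding verifier_def by (intro ptime_intros verify)
qed

lemma canonical_Cons: "canonical (b # bs) \<longleftrightarrow> (if bs = [] then b else canonical bs)"
  by (auto simp: canonical_def hd_append)

lemma canonical_nat_bits: "canonical (nat_bits m) \<longleftrightarrow> 0 < m"
proof (induction m rule: less_induct)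
  case (less m)
  show ?case
  proof (cases "m = 0")
    case False
    have "nat_bits (m div 2) = [] \<longleftrightarrow> m div 2 = 0" by (simp add: nat_bits.simps[of "m div 2"])
    then show ?thesis using False less[of "m div 2"] by (auto simp: nat_bits.simps[of m] canonical_Cons)
  qed (simp add: nat_bits.simps canonical_def)
qed

lemma canonical_ex: "canonical bs \<Longrightarrow> \<exists>m. nat_bits m = bs"
proof (induction bs)
  case (Cons b bs)
  show ?case
  proof (cases "bs = []")
    case True
    then have "nat_bits 1 = b # bs" using Cons.prems by (simp add: canonical_Cons nat_bits.simps)
    then show ?thesis by blast
  next
    case False
    then obtain m where m: "nat_bits m = bs" using Cons by (auto simp: canonical_Cons)
    then have "nat_bits (2 * m + (if b then 1 else 0)) = b # bs"
      using False by (cases "m = 0") (auto simp: nat_bits.simps)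
    then show ?thesis by blast
  qed
qed (simp add: canonical_def)

section \<open>Certificates belonging to an instance\<close>

definition cert_of :: "rtt_instance \<Rightarrow> (nat \<times> nat \<times> nat) list \<Rightarrow> cert" where
  "cert_of I rs = (inst_num_nodes I,
     map (\<lambda>(u, v, p, q). (u, v, nat_bits p, nat_bits q)) (inst_arcs I),
     inst_trips I, inst_source I, inst_target I, rs)"

lemma cert_enc_cert_of: "cert_enc (cert_of I rs) = enc_instance I"
proof -
  have "(\<lambda>x. enc_nat (fst (case x of (u, v, p, q) \<Rightarrow> (u, v, nat_bits p, nat_bits q))) @
      enc_nat (fst (snd (case x of (u, v, p, q) \<Rightarrow> (u, v, nat_bits p, nat_bits q)))) @
      enc_bits (fst (snd (snd (case x of (u, v, p, q) \<Rightarrow> (u, v, nat_bits p, nat_bits q))))) @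
      enc_bits (snd (snd (snd (case x of (u, v, p, q) \<Rightarrow> (u, v, nat_bits p, nat_bits q)))))) = enc_arc"
    by (auto simp: enc_nat_def)
  then show ?thesis
    by (simp add: cert_enc_def cert_of_def enc_instance_def enc_list_map)
qed

text \<open>Soundness starts from an arbitrary accepted certificate. Canonical bit strings are
  numerals of numbers, so such a certificate comes from an actual instance.\<close>

lemma cert_of_ex:
  assumes "\<forall>a \<in> set (c_arcs c). canonical (fst (snd (snd a))) \<and> canonical (snd (snd (snd a)))"
  shows "\<exists>I rs. c = cert_of I rs"
proof -
  define val where "val bs = (SOME m. nat_bits m = bs)" for bs
  have val: "nat_bits (val bs) = bs" if "canonical bs" for bs
    unfolding val_def using canonical_ex[OF that] by (rule someI_ex)
  let ?I = "\<lparr>inst_num_nodes = c_nodes c,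
     inst_arcs = map (\<lambda>a. (fst a, fst (snd a), val (fst (snd (snd a))), val (snd (snd (snd a))))) (c_arcs c),
     inst_trips = c_trips c, inst_source = c_source c, inst_target = c_target c\<rparr>"
  have "map (\<lambda>(u, v, p, q). (u, v, nat_bits p, nat_bits q)) (inst_arcs ?I) = c_arcs c"
    using assms val by (auto simp: o_def intro!: map_idI)
  then have "c = cert_of ?I (c_route c)"
    by (simp add: cert_of_def)
  then show ?thesis by blast
qed

lemma nthd_cert_arcs:
  assumes "e < length (inst_arcs I)"
  shows "fst (nthd (c_arcs (cert_of I rs)) e) = tail (inst_digraph I) e"
    "fst (snd (nthd (c_arcs (cert_of I rs)) e)) = head (inst_digraph I) e"
  using assms by (auto simp: cert_of_def nthd_nth inst_digraph_def split: prod.splits)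

text \<open>The conditions are matched one by one, but some equivalences hold only under earlier
  conditions: the walk condition needs a well-formed digraph, and arcs agree on both sides only for
  indices in range. Hence the nested case distinction at the end.\<close>

lemma cert_valid_iff: "cert_valid (cert_of I rs) \<longleftrightarrow> valid_instance I"
proof -
  let ?D = "inst_digraph I" and ?c = "cert_of I rs" and ?n = "inst_num_nodes I" and ?l = "length (inst_arcs I)"
  have DV: "verts ?D = {..<?n}" "arcs ?D = {..<?l}" by (auto simp: inst_digraph_def)
  have len: "length (c_arcs ?c) = ?l" by (simp add: cert_of_def)
  have W: "(\<forall>a \<in> set (c_arcs ?c). fst a < c_nodes ?c \<and> fst (snd a) < c_nodes ?c \<and> canonical (fst (snd (snd a))) \<and> canonical (snd (snd (snd a))))
      \<longleftrightarrow> fin_digraph ?D \<and> (\<forall>e \<in> arcs ?D. inst_weight I e > 0)"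
  proof -
    have "fin_digraph ?D \<longleftrightarrow> (\<forall>e < ?l. tail ?D e < ?n \<and> head ?D e < ?n)"
      unfolding fin_digraph_def wf_digraph_def fin_digraph_axioms_def by (auto simp: DV)
    moreover have "(\<forall>a \<in> set (c_arcs ?c). R a) \<longleftrightarrow> (\<forall>e < ?l. R (nthd (c_arcs ?c) e))" for R
      unfolding all_set_conv_all_nth len by (auto simp: nthd_nth len)
    moreover have "canonical (fst (snd (snd (nthd (c_arcs ?c) e)))) \<and> canonical (snd (snd (snd (nthd (c_arcs ?c) e)))) \<longleftrightarrow> inst_weight I e > 0"
      if "e < ?l" for e
      using that by (auto simp: cert_of_def nthd_nth inst_weight_def canonical_nat_bits zero_less_divide_iff split: prod.splits)
    moreover have "c_nodes ?c = ?n" by (simp add: cert_of_def)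
    ultimately show ?thesis
      using nthd_cert_arcs[of _ I rs] by (auto simp: DV)
  qed
  have Tr: "(\<forall>T \<in> set (c_trips ?c). T \<noteq> [] \<and> (\<forall>e \<in> set T. e < length (c_arcs ?c)) \<and>
       (\<forall>i \<in> set [0..<length T - 1]. fst (snd (nthd (c_arcs ?c) (nthd T i))) = fst (nthd (c_arcs ?c) (nthd T (Suc i))))) \<longleftrightarrow>
     (\<forall>T \<in> set (inst_trips I). T \<noteq> [] \<and> (\<exists>u v. pre_digraph.awalk ?D u T v))" if fin: "fin_digraph ?D"
  proof -
    have wf: "wf_digraph ?D" using fin by (simp add: fin_digraph_def)
    have "T \<noteq> [] \<and> (\<forall>e \<in> set T. e < ?l) \<and>
       (\<forall>i \<in> set [0..<length T - 1]. fst (snd (nthd (c_arcs ?c) (nthd T i))) = fst (nthd (c_arcs ?c) (nthd T (Suc i)))) \<longleftrightarrow>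
      T \<noteq> [] \<and> (\<exists>u v. pre_digraph.awalk ?D u T v)" for T
    proof (cases "T \<noteq> [] \<and> (\<forall>e \<in> set T. e < ?l)")
      case True
      then have "T \<noteq> []" by simp
      have "fst (snd (nthd (c_arcs ?c) (nthd T i))) = fst (nthd (c_arcs ?c) (nthd T (Suc i))) \<longleftrightarrow>
          head ?D (T ! i) = tail ?D (T ! Suc i)" if "Suc i < length T" for i
      proof -
        have "T ! i < ?l" "T ! Suc i < ?l" using True that by auto
        then show ?thesis using that nthd_cert_arcs[of _ I rs] by (simp add: nthd_nth)
      qed
      then show ?thesis
        using True unfolding awalk_iff[OF wf \<open>T \<noteq> []\<close>] DV by (auto simp: less_diff_conv)
    next
      case False
      then show ?thesis using awalk_iff[OF wf, of T] by (auto simp: DV)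
    qed
    then show ?thesis unfolding len by (simp add: cert_of_def)
  qed
  have VE: "((\<forall>v \<in> set [0..<c_nodes ?c]. \<exists>T \<in> set (c_trips ?c). \<exists>e \<in> set T.
       v = fst (nthd (c_arcs ?c) e) \<or> v = fst (snd (nthd (c_arcs ?c) e))) \<longleftrightarrow>
      (\<forall>v \<in> verts ?D. \<exists>T \<in> set (inst_trips I). \<exists>e \<in> set T. v = tail ?D e \<or> v = head ?D e))"
    if bound: "\<forall>T \<in> set (inst_trips I). \<forall>e \<in> set T. e < ?l"
  proof -
    have "(\<exists>T \<in> set (c_trips ?c). \<exists>e \<in> set T. v = fst (nthd (c_arcs ?c) e) \<or> v = fst (snd (nthd (c_arcs ?c) e))) \<longleftrightarrow>
        (\<exists>T \<in> set (inst_trips I). \<exists>e \<in> set T. v = tail ?D e \<or> v = head ?D e)" for v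
    proof -
      have "c_trips ?c = inst_trips I" by (simp add: cert_of_def)
      then show ?thesis using bound nthd_cert_arcs[of _ I rs] by (intro bex_cong) auto
    qed
    moreover have "set [0..<c_nodes ?c] = verts ?D" by (auto simp: cert_of_def DV)
    ultimately show ?thesis by (simp only:)
  qed
  have bound: "\<forall>T \<in> set (inst_trips I). \<forall>e \<in> set T. e < ?l"
    if "\<forall>T \<in> set (inst_trips I). T \<noteq> [] \<and> (\<exists>u v. pre_digraph.awalk ?D u T v)"
    using that by (fastforce simp: pre_digraph.awalk_def DV)
  have rest: "(\<forall>e \<in> set [0..<length (c_arcs ?c)]. \<exists>T \<in> set (c_trips ?c). e \<in> set T) \<and> c_source ?c < c_nodes ?c \<and> c_target ?c < c_nodes ?c \<longleftrightarrow>
      (\<forall>e \<in> arcs ?D. \<exists>T \<in> set (inst_trips I). e \<in> set T) \<and> inst_source I \<in> verts ?D \<and> inst_target I \<in> verts ?D"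
    unfolding len by (auto simp: cert_of_def DV)
  show ?thesis
  proof (cases "fin_digraph ?D")
    case fin: True
    show ?thesis
    proof (cases "\<forall>T \<in> set (inst_trips I). T \<noteq> [] \<and> (\<exists>u v. pre_digraph.awalk ?D u T v)")
      case True
      show ?thesis
        unfolding cert_valid_def valid_instance_def trip_network_def W rest Tr[OF fin] VE[OF bound[OF True]] by blast
    next
      case False
      then show ?thesis
        unfolding cert_valid_def valid_instance_def trip_network_def W rest Tr[OF fin] by blast
    qed
  next
    case False
    then show ?thesis
      unfolding cert_valid_def valid_instance_def trip_network_def W by blast
  qed
qed

lemma length_dedup: "length (dedup xs) = length xs \<longleftrightarrow> distinct xs"
  by (metis card_distinct distinct_card distinct_dedup set_dedup)

lemma cert_route_ok_iff:
  assumes valid: "valid_instance I"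
  shows "cert_route_ok (cert_of I rs) \<longleftrightarrow>
    route (map (trip_nodes (inst_digraph I)) (inst_trips I)) (inst_source I) (inst_target I) rs"
proof -
  let ?D = "inst_digraph I" and ?c = "cert_of I rs" and ?TT = "inst_trips I"
  have nodes: "cert_trip_nodes ?c (nthd ?TT k) = trip_nodes ?D (?TT ! k)" if "k < length ?TT" for k
  proof -
    have "?TT ! k \<noteq> []" "\<forall>e \<in> set (?TT ! k). e < length (inst_arcs I)"
      using valid that unfolding valid_instance_def trip_network_def pre_digraph.awalk_def
      by (auto simp: inst_digraph_def dest!: nth_mem bspec)
    moreover have "last (?TT ! k) < length (inst_arcs I)" using calculation by simp
    ultimately show ?thesis
      using that nthd_cert_arcs[of _ I rs] by (simp add: cert_trip_nodes_def trip_nodes_def nthd_nth hd_rev)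
  qed
  have comps: "c_trips ?c = ?TT" "c_route ?c = rs" "c_target ?c = inst_target I" "c_source ?c = inst_source I"
    by (simp_all add: cert_of_def)
  have hops: "(\<forall>h \<in> set rs. fst h < length ?TT \<and> fst (snd h) < snd (snd h) \<and>
        snd (snd h) < length (cert_trip_nodes ?c (nthd ?TT (fst h)))) \<longleftrightarrow>
      (\<forall>(k, a, b) \<in> set rs. k < length ?TT \<and> a < b \<and> b < length (trip_nodes ?D (?TT ! k)))"
    using nodes by (intro ball_cong) auto
  have maps: "map (\<lambda>h. nthd (cert_trip_nodes ?c (nthd ?TT (fst h))) (fst (snd h))) rs = map (\<lambda>(k, a, b). map (trip_nodes ?D) ?TT ! k ! a) rs"
    "map (\<lambda>h. nthd (cert_trip_nodes ?c (nthd ?TT (fst h))) (snd (snd h))) rs = map (\<lambda>(k, a, b). map (trip_nodes ?D) ?TT ! k ! b) rs"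
    if "\<forall>(k, a, b) \<in> set rs. k < length ?TT \<and> a < b \<and> b < length (trip_nodes ?D (?TT ! k))"
    using that nodes by (auto simp: nthd_nth intro!: map_cong)
  have hops': "(\<forall>(k, a, b) \<in> set rs. k < length ?TT \<and> a < b \<and> b < length (trip_nodes ?D (?TT ! k))) \<longleftrightarrow>
      (\<forall>(k, a, b) \<in> set rs. k < length (map (trip_nodes ?D) ?TT) \<and> a < b \<and> b < length (map (trip_nodes ?D) ?TT ! k))"
    by (intro ball_cong) auto
  have dist: "length (dedup (map fst rs)) = length rs \<longleftrightarrow> distinct (map fst rs)"
    using length_dedup[of "map fst rs"] by simp
  show ?thesis
  proof (cases "\<forall>(k, a, b) \<in> set rs. k < length ?TT \<and> a < b \<and> b < length (trip_nodes ?D (?TT ! k))")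
    case True
    show ?thesis
      unfolding cert_route_ok_def comps hops maps[OF True] dist route_def hops' ..
  next
    case False
    then show ?thesis
      unfolding cert_route_ok_def comps hops dist route_def hops' by blast
  qed
qed

lemma temporalisable_iff_cert:
  assumes "valid_instance I"
  shows "temporalisable (inst_digraph I) (inst_weight I) (inst_trips I) (inst_source I) (inst_target I) \<longleftrightarrow>
    (\<exists>rs. cert_route_ok (cert_of I rs))"
proof -
  have "trip_network (inst_digraph I) (inst_weight I) (inst_trips I)" "inst_source I \<in> verts (inst_digraph I)"
    "inst_target I \<in> verts (inst_digraph I)"
    using assms by (auto simp: valid_instance_def)
  from temporalisable_iff_reach[OF this] show ?thesis
    unfolding cert_route_ok_iff[OF assms] reach_iff_route .
qed

section \<open>Length of certificates\<close>

lemma length_enc_list: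
  "length xs < length (enc_list f xs)" "x \<in> set xs \<Longrightarrow> length (f x) < length (enc_list f xs)"
  by (induction xs) auto

lemma enc_size_bits: "enc_size (bs :: bool list) \<le> 4 * length bs + 1"
  using enc_size_list_bound[of bs 3] enc_size_bool by simp

text \<open>\<open>m\<close> is the binary length of the instance, whereas \<open>enc_size\<close>
  counts unary numbers. The bound works because nodes, arc indices and positions are limited by the
  lengths of lists in the instance; only the weights are not, and their numerals are copied as they
  are.\<close>

lemma enc_size_cert_bound:
  assumes valid: "valid_instance I" and route: "cert_route_ok (cert_of I rs)"
  defines "m \<equiv> length (enc_instance I)"
  shows "enc_size (cert_of I rs) \<le> 5 + 3 * (4 * m + 1) + (m * (16 * m + 8) + 1) + (m * (m * (4 * m + 2) + 2) + 1) + (m * (12 * m + 6) + 1)"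
proof -
  let ?D = "inst_digraph I" and ?n = "inst_num_nodes I" and ?A = "inst_arcs I" and ?TT = "inst_trips I"
  have net: "trip_network ?D (inst_weight I) ?TT" and st: "inst_source I < ?n" "inst_target I < ?n"
    using valid by (auto simp: valid_instance_def inst_digraph_def)
  have mA: "length (enc_list enc_arc ?A) \<le> m" and mT: "length (enc_list (enc_list enc_nat) ?TT) \<le> m"
    by (auto simp: m_def enc_instance_def)
  have lA: "length ?A \<le> m" and lT: "length ?TT \<le> m"
    using length_enc_list(1)[of ?A enc_arc] length_enc_list(1)[of ?TT "enc_list enc_nat"] mA mT by simp_all
  have trip: "length T \<le> m" "e \<in> set T \<Longrightarrow> e < length ?A" if "T \<in> set ?TT" for T e
  proof -
    show "length T \<le> m"
      using length_enc_list(1)[of T enc_nat] length_enc_list(2)[of T ?TT "enc_list enc_nat"] that mT by simp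
    show "e < length ?A" if "e \<in> set T"
      using net \<open>T \<in> set ?TT\<close> that unfolding trip_network_def pre_digraph.awalk_def by (auto simp: inst_digraph_def)
  qed
  have "{..<?n} \<subseteq> (tail ?D ` {..<length ?A}) \<union> (head ?D ` {..<length ?A})"
  proof
    fix v assume "v \<in> {..<?n}"
    then have "v \<in> verts ?D" by (simp add: inst_digraph_def)
    then obtain T e where "T \<in> set ?TT" "e \<in> set T" "v = tail ?D e \<or> v = head ?D e"
      using net unfolding trip_network_def by blast
    then show "v \<in> (tail ?D ` {..<length ?A}) \<union> (head ?D ` {..<length ?A})" using trip(2)[of T e] by auto
  qed
  then have "card {..<?n} \<le> card ((tail ?D ` {..<length ?A}) \<union> (head ?D ` {..<length ?A}))"
    by (intro card_mono) auto
  also have "\<dots> \<le> card (tail ?D ` {..<length ?A}) + card (head ?D ` {..<length ?A})" by (rule card_Un_le)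
  also have "\<dots> \<le> length ?A + length ?A"
    using card_image_le[of "{..<length ?A}" "tail ?D"] card_image_le[of "{..<length ?A}" "head ?D"] by simp
  finally have n: "?n \<le> 2 * m" using lA by simp
  \<comment> \<open>An arc consists of two nodes and two numerals, each of size at most
    \<open>4 * m + 1\<close>, joined by three pair nodes; this gives
    \<open>16 * m + 7\<close>.\<close>
  have "enc_size (c_arcs (cert_of I rs)) \<le> length (c_arcs (cert_of I rs)) * (16 * m + 7 + 1) + 1"
  proof (rule enc_size_list_bound)
    fix a assume "a \<in> set (c_arcs (cert_of I rs))"
    then obtain u v p q where a: "(u, v, p, q) \<in> set ?A" "a = (u, v, nat_bits p, nat_bits q)"
      by (auto simp: cert_of_def)
    have "length (enc_arc (u, v, p, q)) < m" using length_enc_list(2)[OF a(1), of enc_arc] mA by simp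
    then have "length (nat_bits p) \<le> m" "length (nat_bits q) \<le> m" by (auto simp: enc_nat_def length_enc_bits)
    then have "enc_size (nat_bits p) \<le> 4 * m + 1" "enc_size (nat_bits q) \<le> 4 * m + 1"
      using enc_size_bits[of "nat_bits p"] enc_size_bits[of "nat_bits q"] by linarith+
    moreover obtain e where "e < length ?A" "?A ! e = (u, v, p, q)" using a(1) by (auto simp: in_set_conv_nth)
    then have "u < ?n" "v < ?n"
    proof -
      assume e: "e < length ?A" "?A ! e = (u, v, p, q)"
      have "wf_digraph ?D" using net by (simp add: trip_network_def fin_digraph_def)
      then have "tail ?D e \<in> verts ?D" "head ?D e \<in> verts ?D"
        using e(1) by (auto simp: wf_digraph_def) (auto simp: inst_digraph_def)
      then show "u < ?n" "v < ?n" using e by (simp_all add: inst_digraph_def)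
    qed
    ultimately show "enc_size a \<le> 16 * m + 7" using a(2) n by simp
  qed
  also have "\<dots> \<le> m * (16 * m + 8) + 1"
    by (rule add_mono[OF mult_le_mono order_refl]) (simp_all add: lA cert_of_def)
  finally have 1: "enc_size (c_arcs (cert_of I rs)) \<le> m * (16 * m + 8) + 1" .
  have "enc_size ?TT \<le> length ?TT * (m * (4 * m + 2) + 1 + 1) + 1"
  proof (rule enc_size_list_bound)
    fix T assume T: "T \<in> set ?TT"
    have "enc_size T \<le> length T * (4 * m + 1 + 1) + 1"
      by (rule enc_size_list_bound) (use trip(2)[OF T] lA in fastforce)
    also have "\<dots> \<le> m * (4 * m + 2) + 1"
      by (rule add_mono[OF mult_le_mono order_refl]) (simp_all add: trip(1)[OF T])
    finally show "enc_size T \<le> m * (4 * m + 2) + 1" .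
  qed
  also have "\<dots> \<le> m * (m * (4 * m + 2) + 2) + 1"
    by (rule add_mono[OF mult_le_mono order_refl]) (simp_all add: lT)
  finally have 2: "enc_size ?TT \<le> m * (m * (4 * m + 2) + 2) + 1" .
  let ?TS = "map (trip_nodes ?D) ?TT"
  have rs: "distinct (map fst rs)" "\<And>k a b. (k, a, b) \<in> set rs \<Longrightarrow> k < length ?TT \<and> a < b \<and> b < length (?TS ! k)"
    using route unfolding cert_route_ok_iff[OF valid] route_def by auto
  \<comment> \<open>A route uses different trips in its segments, so it has at most as many segments
    as there are trips.\<close>
  have "set (map fst rs) \<subseteq> {..<length ?TT}" using rs(2) by auto
  then have "card (set (map fst rs)) \<le> length ?TT" using card_mono[of "{..<length ?TT}"] by simp
  then have lrs: "length rs \<le> m" using distinct_card[OF rs(1)] lT by simp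
  have "enc_size rs \<le> length rs * (12 * m + 5 + 1) + 1"
  proof (rule enc_size_list_bound)
    fix h assume h: "h \<in> set rs"
    obtain k a b where hk: "h = (k, a, b)" by (metis prod_cases3)
    then have k: "k < length ?TT" "a < b" "b < length (?TS ! k)" using rs(2)[of k a b] h by blast+
    have "length (?TS ! k) \<le> m + 1" using k trip(1)[of "?TT ! k"] by (simp add: trip_nodes_def)
    then show "enc_size h \<le> 12 * m + 5" using k hk lT by simp
  qed
  also have "\<dots> \<le> m * (12 * m + 6) + 1"
    by (rule add_mono[OF mult_le_mono order_refl]) (simp_all add: lrs)
  finally have 3: "enc_size rs \<le> m * (12 * m + 6) + 1" .
  have "enc_size (cert_of I rs) = 5 + enc_size ?n + enc_size (c_arcs (cert_of I rs)) + enc_size ?TT + enc_size (inst_source I) + enc_size (inst_target I) + enc_size rs"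
    by (simp add: cert_of_def)
  also have "\<dots> \<le> 5 + (4 * m + 1) + (m * (16 * m + 8) + 1) + (m * (m * (4 * m + 2) + 2) + 1) + (4 * m + 1) + (4 * m + 1) + (m * (12 * m + 6) + 1)"
    using n st by (intro add_mono 1 2 3) auto
  finally show ?thesis by simp
qed

lemma prefix_code_enc_bits: "prefix_code enc_bits"
  unfolding enc_bits_def by (rule prefix_code_enc_list) (simp add: prefix_code_def)

lemma o2o_rtt_in_NP: "o2o_rtt \<in> NP"
proof -
  let ?b = "\<lambda>m. 5 + 3 * (4 * m + 1) + (m * (16 * m + 8) + 1) + (m * (m * (4 * m + 2) + 2) + 1) + (m * (12 * m + 6) + 1)"
  have "poly_bounded ?b" by (intro poly_bounded_intros)
  then obtain p :: "nat poly" where p: "\<forall>n. ?b n \<le> poly p n"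
    using poly_bounded_poly by blast
  have "x \<in> o2o_rtt \<longleftrightarrow> (\<exists>u. length u \<le> poly p (length x) \<and> verifier (string_pair x u) = [True])" for x
  proof
    assume "x \<in> o2o_rtt"
    then obtain I where I: "x = enc_instance I" "valid_instance I"
      "temporalisable (inst_digraph I) (inst_weight I) (inst_trips I) (inst_source I) (inst_target I)"
      unfolding o2o_rtt_def by blast
    then obtain rs where rs: "cert_route_ok (cert_of I rs)" using temporalisable_iff_cert by blast
    let ?c = "cert_of I rs"
    define u where "u = code (to_tree ?c)"
    let ?y = "string_pair x u"
    have "length u \<le> poly p (length x)"
      using order_trans[OF enc_size_cert_bound[OF I(2) rs] p[rule_format]] I(1) unfolding enc_size_def u_def by (simp only:)
    moreover have "verify ?y u ?c"
      using I rs cert_valid_iff cert_enc_cert_of by (simp add: verify_def string_pair_def)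
    moreover have "of_tree (parse u) = ?c"
      by (simp only: u_def parse_code of_tree_to_tree)
    ultimately have len: "length u \<le> poly p (length x)"
      and "verify ?y (drop (length (enc_bits x)) ?y) (of_tree (parse (drop (length (enc_bits x)) ?y)))"
      by (simp_all add: string_pair_def)
    from this(2) have "verifier ?y = [True]"
      unfolding verifier_def by (auto simp: string_pair_def intro!: bexI[of _ "length (enc_bits x)"])
    with len show "\<exists>u. length u \<le> poly p (length x) \<and> verifier (string_pair x u) = [True]" by blast
  next
    assume "\<exists>u. length u \<le> poly p (length x) \<and> verifier (string_pair x u) = [True]"
    then obtain u i where "verify (string_pair x u) (drop i (string_pair x u)) (of_tree (parse (drop i (string_pair x u))))"
      unfolding verifier_def list.inject by blast
    then obtain u' c where c: "enc_bits x @ u = enc_bits (cert_enc c) @ u'" "cert_valid c" "cert_route_ok c"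
      unfolding verify_def string_pair_def by blast
    then have x: "x = cert_enc c" using prefix_codeD[OF prefix_code_enc_bits] by blast
    obtain I rs where I: "c = cert_of I rs"
      using cert_of_ex[of c] c(2) unfolding cert_valid_def by blast
    have "valid_instance I" using c(2) unfolding I cert_valid_iff .
    moreover have "temporalisable (inst_digraph I) (inst_weight I) (inst_trips I) (inst_source I) (inst_target I)"
      using temporalisable_iff_cert[OF calculation] c(3) unfolding I by blast
    ultimately show "x \<in> o2o_rtt" unfolding o2o_rtt_def x I cert_enc_cert_of by blast
  qed
  then show ?thesis
    unfolding NP_def using ptime_poly_time[OF ptime_verifier] by blast
qed

theorem theorem1:
  shows "NP_complete o2o_rtt"
  unfolding NP_complete_def using o2o_rtt_in_NP NP_hard_o2o_rtt by simp

end
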